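(* Let $q \geq 3$ be a prime power. Then $\rho(\mathrm{PGL}_2(q))=q^2+1$. Furthermore, $\rho(\mathrm{PSL}_2(q))=q^2+1$ if $q \geq 7$.
   Context: A cover of a finite group $G$ is a family of proper subgroups of $G$ whose union is $G$. A partition of $G$ is a cover $\{H_1,\ldots,H_n\}$ of $G$ such that $H_i\cap H_j=\{1\}$ whenever $i\neq j$. A group is partitionable if it admits a partition, and in this case $\rho(G)$ denotes the minimal size (number of members) of a partition of $G$. $\mathrm{PGL}_2(q)$ and $\mathrm{PSL}_2(q)$ are the projective general and projective special linear groups of degree $2$ over the field with $q$ elements. (The groups in the statement are partitionable.) *)

theory Defs
  imports
    "HOL-Algebra.Coset"
    "HOL-Analysis.Determinants"
    "HOL-Library.Extended_Nat"
    "HOL-Number_Theory.Prime_Powers"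
begin

definition group_cover :: "('g, 'm) monoid_scheme \<Rightarrow> 'g set set \<Rightarrow> bool" where
  "group_cover G P \<longleftrightarrow>
     (\<forall>H\<in>P. subgroup H G \<and> H \<noteq> carrier G) \<and> \<Union>P = carrier G"

definition group_partition :: "('g, 'm) monoid_scheme \<Rightarrow> 'g set set \<Rightarrow> bool" where
  "group_partition G P \<longleftrightarrow>
     finite P \<and> group_cover G P \<and> (\<forall>H\<in>P. \<forall>K\<in>P. H \<noteq> K \<longrightarrow> H \<inter> K = {\<one>\<^bsub>G\<^esub>})"

definition partitionable :: "('g, 'm) monoid_scheme \<Rightarrow> bool" where
  "partitionable G \<longleftrightarrow> (\<exists>P. group_partition G P)"

text \<open>
  The infimum of the empty set in \<^typ>\<open>enat\<close> is \<open>\<infinity>\<close>, so \<open>rho G\<close> is finite precisely when \<open>G\<close> is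
  partitionable, and then it is an attained minimum.
\<close>

definition rho :: "('g, 'm) monoid_scheme \<Rightarrow> enat" where
  "rho G = Inf {enat (card P) | P. group_partition G P}"

lemma rho_eq_infinity_iff: "rho G = \<infinity> \<longleftrightarrow> \<not> partitionable G"
proof -
  have "rho G \<le> enat (card P)" if "group_partition G P" for P
    unfolding rho_def using that by (intro Inf_lower) blast
  then have "rho G \<noteq> \<infinity>" if "partitionable G"
    using that by (metis enat_ord_simps(5) enat.distinct(2) partitionable_def)
  moreover have "rho G = \<infinity>" if "\<not> partitionable G"
    using that by (simp add: rho_def partitionable_def Inf_enat_def)
  ultimately show ?thesis by blast
qed

lemma rho_attained:
  assumes "partitionable G"
  obtains P where "group_partition G P" "rho G = enat (card P)"
proof -
  let ?S = "{enat (card P) | P. group_partition G P}"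
  have "?S \<noteq> {}" using assms by (auto simp: partitionable_def)
  then obtain n where n: "n \<in> ?S" by blast
  have "rho G = (LEAST n. n \<in> ?S)"
    unfolding rho_def Inf_enat_def using \<open>?S \<noteq> {}\<close> by (rule if_not_P)
  also have "\<dots> \<in> ?S" using n by (rule LeastI)
  finally have "rho G \<in> ?S" .
  then show ?thesis using that by blast
qed

definition GL :: "('a::field ^ 'n ^ 'n) monoid" where
  "GL = \<lparr>carrier = {A. invertible A}, monoid.mult = (**), one = mat 1\<rparr>"

definition SL :: "('a::field ^ 'n ^ 'n) monoid" where
  "SL = GL\<lparr>carrier := {A. det A = 1}\<rparr>"

definition scalar_matrices :: "('a::field ^ 'n ^ 'n) set" where
  "scalar_matrices = range mat"

definition PGL :: "('a::field ^ 'n ^ 'n) set monoid" where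
  "PGL = GL Mod (scalar_matrices \<inter> carrier GL)"

definition PSL :: "('a::field ^ 'n ^ 'n) set monoid" where
  "PSL = SL Mod (scalar_matrices \<inter> carrier SL)"

lemma mat_mult_left: "(mat c ** A) $ i $ j = c * A $ i $ j" for A :: "'a::field ^ 'n ^ 'n"
proof -
  have "(mat c ** A) $ i $ j = (\<Sum>k\<in>UNIV. (if i = k then c else 0) * A $ k $ j)"
    by (simp add: matrix_matrix_mult_def mat_def)
  also have "\<dots> = (\<Sum>k\<in>UNIV. if i = k then c * A $ k $ j else 0)"
    by (rule sum.cong) auto
  finally show ?thesis by simp
qed

lemma mat_mult_right: "(A ** mat c) $ i $ j = c * A $ i $ j" for A :: "'a::field ^ 'n ^ 'n"
proof -
  have "(A ** mat c) $ i $ j = (\<Sum>k\<in>UNIV. A $ i $ k * (if k = j then c else 0))"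
    by (simp add: matrix_matrix_mult_def mat_def)
  also have "\<dots> = (\<Sum>k\<in>UNIV. if k = j then c * A $ i $ k else 0)"
    by (rule sum.cong) auto
  finally show ?thesis by simp
qed

lemma mat_mult_commute: "mat c ** A = A ** mat c" for A :: "'a::field ^ 'n ^ 'n"
  by (simp add: vec_eq_iff mat_mult_left mat_mult_right)

lemma mat_mult_mat: "mat a ** mat b = (mat (a * b) :: 'a::field ^ 'n ^ 'n)"
  by (simp add: vec_eq_iff mat_mult_left) (simp add: mat_def)

lemma group_GL: "group (GL :: ('a::field ^ 'n ^ 'n) monoid)"
proof (rule groupI)
  fix A :: "'a ^ 'n ^ 'n"
  assume "A \<in> carrier GL"
  then obtain B where "A ** B = mat 1" "B ** A = mat 1"
    by (auto simp: GL_def invertible_def)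
  then show "\<exists>B\<in>carrier GL. B \<otimes>\<^bsub>GL\<^esub> A = \<one>\<^bsub>GL\<^esub>"
    unfolding GL_def invertible_def by auto
next
  fix A B C :: "'a ^ 'n ^ 'n"
  show "A \<otimes>\<^bsub>GL\<^esub> B \<otimes>\<^bsub>GL\<^esub> C = A \<otimes>\<^bsub>GL\<^esub> (B \<otimes>\<^bsub>GL\<^esub> C)"
    by (simp add: GL_def matrix_mul_assoc)
qed (simp_all add: GL_def invertible_det_nz det_mul)

lemma subgroup_SL: "subgroup {A. det A = 1} (GL :: ('a::field ^ 'n ^ 'n) monoid)"
proof (rule group.subgroupI[OF group_GL])
  fix A :: "'a ^ 'n ^ 'n"
  assume A: "A \<in> {A. det A = 1}"
  then have *: "A \<in> carrier GL" by (simp add: GL_def invertible_det_nz)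
  have "A \<otimes>\<^bsub>GL\<^esub> inv\<^bsub>GL\<^esub> A = \<one>\<^bsub>GL\<^esub>"
    using group.r_inv[OF group_GL *] .
  then have "det (A ** inv\<^bsub>GL\<^esub> A) = 1" by (simp add: GL_def)
  then show "inv\<^bsub>GL\<^esub> A \<in> {A. det A = 1}" using A by (simp add: det_mul)
next
  have "mat 1 \<in> {A :: 'a ^ 'n ^ 'n. det A = 1}" by simp
  then show "{A :: 'a ^ 'n ^ 'n. det A = 1} \<noteq> {}" by blast
qed (simp_all add: GL_def invertible_det_nz det_mul subset_iff)

lemma group_SL: "group (SL :: ('a::field ^ 'n ^ 'n) monoid)"
  unfolding SL_def by (rule group.subgroup_imp_group[OF group_GL subgroup_SL])

lemma scalar_normal:
  fixes G :: "('a::field ^ 'n ^ 'n) monoid"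
  assumes G: "group G" and "monoid.mult G = (**)" "one G = mat 1"
  shows "(scalar_matrices \<inter> carrier G) \<lhd> G"
proof -
  interpret group G by (rule G)
  have comm: "Z \<otimes>\<^bsub>G\<^esub> A = A \<otimes>\<^bsub>G\<^esub> Z" if "Z \<in> scalar_matrices" for Z A
    using that assms by (auto simp: scalar_matrices_def mat_mult_commute)
  have inv_scalar: "inv\<^bsub>G\<^esub> Z \<in> scalar_matrices" if Z: "Z \<in> scalar_matrices" "Z \<in> carrier G" for Z
  proof -
    obtain c where c: "Z = mat c" using Z(1) by (auto simp: scalar_matrices_def)
    have ZZ: "Z ** inv\<^bsub>G\<^esub> Z = mat 1"
      using r_inv[OF Z(2)] assms by simp
    have "c \<noteq> 0"
    proof
      assume "c = 0"
      then have "Z = 0" using c by (simp add: mat_def vec_eq_iff)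
      then have "mat 1 = (0 :: 'a ^ 'n ^ 'n)" using ZZ by simp
      then have "(mat 1 :: 'a ^ 'n ^ 'n) $ i $ i = 0" for i by simp
      then show False by (simp add: mat_def)
    qed
    then have "mat (1/c) ** Z = mat 1" using c by (simp add: mat_mult_mat)
    then have "inv\<^bsub>G\<^esub> Z = mat (1/c) ** (Z ** inv\<^bsub>G\<^esub> Z)"
      by (simp add: matrix_mul_assoc)
    then have "inv\<^bsub>G\<^esub> Z = mat (1/c)" by (simp add: ZZ)
    then show ?thesis by (simp add: scalar_matrices_def)
  qed
  have "subgroup (scalar_matrices \<inter> carrier G) G"
  proof (rule subgroupI)
    have "\<one>\<^bsub>G\<^esub> \<in> scalar_matrices \<inter> carrier G"
      using assms one_closed by (auto simp: scalar_matrices_def)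
    then show "scalar_matrices \<inter> carrier G \<noteq> {}" by blast
  next
    fix A B assume AB: "A \<in> scalar_matrices \<inter> carrier G" "B \<in> scalar_matrices \<inter> carrier G"
    then obtain a b where "A = mat a" "B = mat b" by (auto simp: scalar_matrices_def)
    then have "A ** B = mat (a * b)"
      by (simp add: mat_mult_mat)
    then have "A \<otimes>\<^bsub>G\<^esub> B \<in> scalar_matrices" using assms by (simp add: scalar_matrices_def)
    then show "A \<otimes>\<^bsub>G\<^esub> B \<in> scalar_matrices \<inter> carrier G" using AB by simp
  qed (use inv_scalar in auto)
  then show ?thesis
  proof (rule normal_invI)
    fix A Z assume *: "A \<in> carrier G" "Z \<in> scalar_matrices \<inter> carrier G"
    then have "A \<otimes>\<^bsub>G\<^esub> Z \<otimes>\<^bsub>G\<^esub> inv\<^bsub>G\<^esub> A = Z \<otimes>\<^bsub>G\<^esub> (A \<otimes>\<^bsub>G\<^esub> inv\<^bsub>G\<^esub> A)"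
      using comm[of Z A] m_assoc[of Z A "inv\<^bsub>G\<^esub> A"] by simp
    also have "\<dots> = Z" using * by (subst r_inv) simp_all
    finally show "A \<otimes>\<^bsub>G\<^esub> Z \<otimes>\<^bsub>G\<^esub> inv\<^bsub>G\<^esub> A \<in> scalar_matrices \<inter> carrier G" using * by simp
  qed
qed

lemma group_PGL: "group (PGL :: ('a::field ^ 'n ^ 'n) set monoid)"
  unfolding PGL_def
  by (rule normal.factorgroup_is_group[OF scalar_normal[OF group_GL]]) (simp_all add: GL_def)

lemma group_PSL: "group (PSL :: ('a::field ^ 'n ^ 'n) set monoid)"
  unfolding PSL_def
  by (rule normal.factorgroup_is_group[OF scalar_normal[OF group_SL]]) (simp_all add: SL_def GL_def)

end

(*
Every nontrivial element of the group fixes 0, 1 or 2 points of the projective line: it lies in a unique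
nonsplit torus, in a unique unipotent radical (order q), or in a unique split torus. The stabiliser of one
point, the q(q-1)/2 split tori avoiding that point, the q(q-1)/2 nonsplit tori and the q remaining unipotent
radicals form a partition of size q^2 + 1.

Conversely, tori are cyclic, so a member of a partition contains each torus that it meets nontrivially.
Counting elements and comparing with Burnside's lemma for the action on the line shows that a proper
subgroup with this property and containing no point stabiliser contains at most one torus. There are q^2
tori, so if no member is a point stabiliser there are q^2 members containing a torus, and one more is needed
for the unipotents. If a point stabiliser is a member, it absorbs q tori and its own unipotents; the other
q(q-1) unipotents lie in torus-free members, which have order at most q, so there are at least q of these
besides the q^2 - q members with a torus.
*)
theory Submission
  imports Defs "HOL-Algebra.Group_Action" "HOL-Algebra.Multiplicative_Group"
begin

section \<open>Groups acting like PGL(2,q) and PSL(2,q) on the projective line\<close>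

text \<open>The extra member for the unipotents is the delicate point. For odd \<open>q\<close> a
  member with just one torus contains no unipotent, but for even \<open>q\<close> it may be
  dihedral, of twice the order of the torus, and all its elements outside the torus are then
  unipotent. Members of this kind might conceivably share out all unipotents between them. They
  cannot, because such subgroups seldom meet trivially; for two nonsplit tori the obstruction is
  \<open>CC_common\<close>, an element normalizing both.

  A nonsplit torus has its fixed points over the quadratic extension only, so the action on the line
  does not show it. Hence the tori in \<open>CC\<close> are given as data, and
  \<open>CC_normalizer\<close> says that the normalizer of such a torus contains it with index at
  most 2.

  The bound \<open>dt3\<close> stands for \<open>q \<ge> 7\<close> in the case \<open>d = 2\<close>.
  In PSL(2,5) the alternating group of degree 4 contains seven tori and no unipotent, so there the
  bound of one torus per subgroup fails.\<close>

text \<open>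
  The points are \<open>Om\<close>; \<open>CC\<close> is the family of nonsplit tori, of order \<open>c = (q + 1) / d\<close>, while the two-point
  stabilisers are the split tori, of order \<open>t = (q - 1) / d\<close>. Here \<open>d = 2\<close> for PSL with \<open>q\<close> odd, and
  \<open>d = 1\<close> otherwise.
\<close>

locale line_action = group G for G (structure) +
  fixes act :: "'a \<Rightarrow> 'o \<Rightarrow> 'o" and Om :: "'o set" and CC :: "'a set set" and q t c d :: nat
  assumes fin: "finite (carrier G)"
    and act_closed: "\<And>g x. g \<in> carrier G \<Longrightarrow> x \<in> Om \<Longrightarrow> act g x \<in> Om"
    and act_one: "\<And>x. x \<in> Om \<Longrightarrow> act \<one> x = x"
    and act_mult: "\<And>g h x. g \<in> carrier G \<Longrightarrow> h \<in> carrier G \<Longrightarrow> x \<in> Om \<Longrightarrow> act (g \<otimes> h) x = act g (act h x)"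
    and card_Om: "card Om = q + 1"
    and three: "\<And>g a b c. g \<in> carrier G \<Longrightarrow> {a, b, c} \<subseteq> Om \<Longrightarrow> a \<noteq> b \<Longrightarrow> a \<noteq> c \<Longrightarrow> b \<noteq> c \<Longrightarrow>
      act g a = a \<Longrightarrow> act g b = b \<Longrightarrow> act g c = c \<Longrightarrow> g = \<one>"
    and unip: "\<And>a. a \<in> Om \<Longrightarrow> \<exists>V. subgroup V G \<and> card V = q \<and>
      (\<forall>g\<in>V - {\<one>}. {x \<in> Om. act g x = x} = {a})"
    and stab_cyclic: "\<And>a b. a \<in> Om \<Longrightarrow> b \<in> Om \<Longrightarrow> a \<noteq> b \<Longrightarrow>
      \<exists>g\<in>carrier G. {h \<in> carrier G. act h a = a \<and> act h b = b} = range (\<lambda>k::nat. g [^] k)"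
    and stab_card: "\<And>a b. a \<in> Om \<Longrightarrow> b \<in> Om \<Longrightarrow> a \<noteq> b \<Longrightarrow>
      card {h \<in> carrier G. act h a = a \<and> act h b = b} = t"
    and CC_subgroup: "\<And>C. C \<in> CC \<Longrightarrow> subgroup C G"
    and CC_cyclic: "\<And>C. C \<in> CC \<Longrightarrow> \<exists>g\<in>carrier G. C = range (\<lambda>k::nat. g [^] k)"
    and CC_card: "\<And>C. C \<in> CC \<Longrightarrow> card C = c"
    and CC_disjoint: "\<And>C C'. C \<in> CC \<Longrightarrow> C' \<in> CC \<Longrightarrow> C \<noteq> C' \<Longrightarrow> C \<inter> C' = {\<one>}"
    and CC_iff: "\<And>g. g \<in> carrier G \<Longrightarrow> g \<noteq> \<one> \<Longrightarrow> (\<exists>C\<in>CC. g \<in> C) \<longleftrightarrow> {x \<in> Om. act g x = x} = {}"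
    and CC_normalizer: "\<And>C x y. C \<in> CC \<Longrightarrow> x \<in> carrier G - C \<Longrightarrow> y \<in> carrier G - C \<Longrightarrow>
      (\<forall>z\<in>C. x \<otimes> z \<otimes> inv x \<in> C) \<Longrightarrow> (\<forall>z\<in>C. y \<otimes> z \<otimes> inv y \<in> C) \<Longrightarrow> x \<otimes> y \<in> C"
    and CC_common: "\<And>C C'. even q \<Longrightarrow> C \<in> CC \<Longrightarrow> C' \<in> CC \<Longrightarrow> C \<noteq> C' \<Longrightarrow>
      \<exists>w\<in>carrier G - {\<one>}. (\<forall>z\<in>C. w \<otimes> z \<otimes> inv w \<in> C) \<and> (\<forall>z\<in>C'. w \<otimes> z \<otimes> inv w \<in> C')"
    and q3: "q \<ge> 3" and dt: "d * t + 1 = q" and dc: "d * c = q + 1"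
    and d12: "d = 1 \<or> d = 2" and dt3: "d = 2 \<Longrightarrow> t \<ge> 3"
begin

section \<open>Fixed points and point stabilisers\<close>

lemma fin_Om: "finite Om"
  using card_Om by (metis Suc_eq_plus1 card.infinite nat.simps(3))

lemma t2: "t \<ge> 2"
  using q3 dt d12 dt3 by auto

lemma c2: "c \<ge> 2"
  using q3 dc d12 by auto

text \<open>
  \<open>T p\<close> is a split torus when \<open>p\<close> is a pair of points and a Borel subgroup when \<open>p\<close> is a single point;
  \<open>U a\<close> is the unipotent radical of the Borel subgroup \<open>T {a}\<close>.
\<close>

definition Fix where "Fix g = {x \<in> Om. act g x = x}"
definition T where "T p = {g \<in> carrier G. \<forall>x\<in>p. act g x = x}"
definition U where "U a = {g \<in> carrier G. g = \<one> \<or> Fix g = {a}}"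
definition pairs where "pairs = {p. p \<subseteq> Om \<and> card p = 2}"

lemma act_inv: "g \<in> carrier G \<Longrightarrow> x \<in> Om \<Longrightarrow> act (inv g) (act g x) = x"
  by (metis act_mult act_one inv_closed l_inv)

lemma act_inv': "g \<in> carrier G \<Longrightarrow> x \<in> Om \<Longrightarrow> act g (act (inv g) x) = x"
  by (metis act_mult act_one inv_closed r_inv)

lemma act_eq: "g \<in> carrier G \<Longrightarrow> x \<in> Om \<Longrightarrow> y \<in> Om \<Longrightarrow> act g x = act g y \<longleftrightarrow> x = y"
  by (metis act_inv)

lemma act_inj: "g \<in> carrier G \<Longrightarrow> inj_on (act g) Om"
  by (simp add: act_eq inj_on_def)

lemma act_image: "g \<in> carrier G \<Longrightarrow> act g ` Om = Om"
  by (rule endo_inj_surj[OF fin_Om _ act_inj]) (auto simp: act_closed)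

lemma Fix_one: "Fix \<one> = Om"
  by (auto simp: Fix_def act_one)

lemma Fix_sub: "Fix g \<subseteq> Om"
  by (auto simp: Fix_def)

lemma finite_Fix: "finite (Fix g)"
  by (rule finite_subset[OF Fix_sub fin_Om])

lemma Fix_le2: assumes g: "g \<in> carrier G" "g \<noteq> \<one>" shows "card (Fix g) \<le> 2"
proof (rule ccontr)
  assume "\<not> ?thesis"
  then have "\<exists>S\<subseteq>Fix g. card S = 3"
    by (metis not_less_eq_eq numeral_2_eq_2 numeral_3_eq_3 obtain_subset_with_card_n)
  then obtain a b c where "{a, b, c} \<subseteq> Fix g" "a \<noteq> b" "a \<noteq> c" "b \<noteq> c"
    by (metis card_3_iff)
  then show False using three[of g a b c] g by (auto simp: Fix_def)
qed

lemma pairsE: assumes "p \<in> pairs" obtains a b where "p = {a, b}" "a \<noteq> b" "a \<in> Om" "b \<in> Om"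
  using assms by (auto simp: pairs_def card_2_iff)

lemma pairsI: "a \<noteq> b \<Longrightarrow> a \<in> Om \<Longrightarrow> b \<in> Om \<Longrightarrow> {a, b} \<in> pairs"
  by (auto simp: pairs_def)

lemma finite_pairs: "finite pairs"
  unfolding pairs_def using fin_Om by simp

lemma card_pairs: "card pairs = (q + 1) choose 2"
  unfolding pairs_def using n_subsets[OF fin_Om, of 2] card_Om by simp

lemma T_pair: "T {a, b} = {h \<in> carrier G. act h a = a \<and> act h b = b}"
  by (auto simp: T_def)

lemma T_cyclic: "p \<in> pairs \<Longrightarrow> \<exists>g\<in>carrier G. T p = range (\<lambda>k::nat. g [^] k)"
  by (erule pairsE) (simp add: T_pair stab_cyclic)

lemma T_card: "p \<in> pairs \<Longrightarrow> card (T p) = t"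
  by (erule pairsE) (simp add: T_pair stab_card)

lemma T_subgroup: assumes "p \<subseteq> Om" shows "subgroup (T p) G"
proof (rule subgroupI)
  show "T p \<subseteq> carrier G" by (auto simp: T_def)
  have "\<one> \<in> T p" using assms by (auto simp: T_def act_one)
  then show "T p \<noteq> {}" by blast
  show "inv g \<in> T p" if "g \<in> T p" for g
  proof -
    have "act (inv g) x = x" if x: "x \<in> p" for x
    proof -
      have "act (inv g) (act g x) = x" using x assms \<open>g \<in> T p\<close> by (intro act_inv) (auto simp: T_def)
      then show ?thesis using x \<open>g \<in> T p\<close> by (simp add: T_def)
    qed
    then show ?thesis using that by (simp add: T_def)
  qed
  show "g \<otimes> h \<in> T p" if "g \<in> T p" "h \<in> T p" for g h
    using that assms by (auto simp: T_def act_mult subset_iff)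
qed

lemma pairs_sub: "p \<in> pairs \<Longrightarrow> p \<subseteq> Om"
  by (simp add: pairs_def)

lemma T_Fix: assumes "p \<in> pairs" "g \<in> T p" "g \<noteq> \<one>" shows "Fix g = p"
proof -
  have "p \<subseteq> Fix g" using assms by (auto simp: T_def Fix_def pairs_def)
  moreover have "card (Fix g) \<le> card p" using Fix_le2[of g] assms by (auto simp: T_def pairs_def)
  ultimately show ?thesis using finite_Fix card_seteq by metis
qed

lemma Fix_T: "g \<in> carrier G \<Longrightarrow> p \<subseteq> Fix g \<Longrightarrow> g \<in> T p"
  by (auto simp: Fix_def T_def)

lemma subgroup_finite: "subgroup H G \<Longrightarrow> finite H"
  by (meson fin finite_subset subgroup.subset)

lemma subgroup_one: "subgroup H G \<Longrightarrow> \<one> \<in> H"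
  by (rule subgroup.one_closed)

lemma subgroup_carrier: "subgroup H G \<Longrightarrow> x \<in> H \<Longrightarrow> x \<in> carrier G"
  using subgroup.subset by blast

lemma subgroup_card_dvd: assumes "subgroup H G" "subgroup K G" "H \<subseteq> K" shows "card H dvd card K"
proof -
  interpret K: group "G\<lparr>carrier := K\<rparr>" using assms subgroup_imp_group by blast
  have "subgroup H (G\<lparr>carrier := K\<rparr>)" by (rule subgroup_incl[OF assms])
  from K.lagrange[OF this] show ?thesis by (simp add: order_def) (metis dvd_triv_right)
qed

text \<open>The product map from \<open>H \<times> K\<close> to \<open>L\<close> is injective: two
  factorizations of one element differ by an element of \<open>H \<inter> K\<close>.\<close>

lemma card_product_le: assumes H: "subgroup H G" "subgroup K G" "H \<inter> K = {\<one>}" "H \<subseteq> L" "K \<subseteq> L" "subgroup L G"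
  shows "card H * card K \<le> card L"
proof -
  have "inj_on (\<lambda>(h, k). h \<otimes> k) (H \<times> K)"
  proof (rule inj_onI, clarsimp)
    fix h k h' k' assume *: "h \<in> H" "k \<in> K" "h' \<in> H" "k' \<in> K" "h \<otimes> k = h' \<otimes> k'"
    have car: "h \<in> carrier G" "k \<in> carrier G" "h' \<in> carrier G" "k' \<in> carrier G"
      using * H subgroup_carrier by blast+
    have "inv h' \<otimes> h = k' \<otimes> inv k"
    proof -
      have "inv h' \<otimes> h = inv h' \<otimes> (h \<otimes> k) \<otimes> inv k" using car by (simp add: m_assoc)
      also have "\<dots> = inv h' \<otimes> (h' \<otimes> k') \<otimes> inv k" using * by simp
      also have "\<dots> = k' \<otimes> inv k" using car by (simp add: m_assoc[symmetric])
      finally show ?thesis .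
    qed
    moreover have "inv h' \<otimes> h \<in> H" using * H by (meson subgroup.m_closed subgroup.m_inv_closed)
    moreover have "k' \<otimes> inv k \<in> K" using * H by (meson subgroup.m_closed subgroup.m_inv_closed)
    ultimately have "inv h' \<otimes> h = \<one>" "k' \<otimes> inv k = \<one>" using H(3) by auto
    then have "h = h'" "k' = k" using car inv_solve_left'[of \<one> h' h] inv_solve_right'[of \<one> k' k] by auto
    then show "h = h' \<and> k = k'" by simp
  qed
  moreover have "(\<lambda>(h, k). h \<otimes> k) ` (H \<times> K) \<subseteq> L"
    using H by (auto simp: subgroup.m_closed subset_iff)
  ultimately have "card (H \<times> K) \<le> card L" using subgroup_finite[OF H(6)] card_inj_on_le by blast
  then show ?thesis by (simp add: card_cartesian_product)
qed

lemma other_point: "\<exists>b\<in>Om. b \<noteq> a"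
proof (rule ccontr)
  assume "\<not> ?thesis"
  then have "card Om \<le> card {a}" by (intro card_mono) auto
  then show False using card_Om q3 by simp
qed

text \<open>Sort the stabiliser of \<open>a\<close> by the image of a second point \<open>b\<close>:
  there are \<open>q\<close> possible images, and a nonempty fibre can be translated into
  \<open>T {a, b}\<close>. Equality has to wait for the unipotents, which provide
  transitivity.\<close>

lemma stab_card_le: assumes "a \<in> Om" shows "card (T {a}) \<le> q * t"
proof -
  obtain b where b: "b \<in> Om" "b \<noteq> a" using other_point by blast
  have "T {a} = (\<Union>x\<in>Om - {a}. {g\<in>T {a}. act g b = x})"
    using act_closed b assms by (auto simp: T_def) (metis act_eq)
  also have "card \<dots> \<le> (\<Sum>x\<in>Om - {a}. card {g\<in>T {a}. act g b = x})"
    by (rule card_UN_le) (use fin_Om in auto)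
  also have "\<dots> \<le> (\<Sum>x\<in>Om - {a}. t)"
  proof (rule sum_mono)
    fix x assume x: "x \<in> Om - {a}"
    show "card {g\<in>T {a}. act g b = x} \<le> t"
    proof (cases "{g\<in>T {a}. act g b = x} = {}")
      case False
      then obtain h where h: "h \<in> carrier G" "act h a = a" "act h b = x" by (auto simp: T_def)
      have "inj_on (\<lambda>g. inv h \<otimes> g) {g\<in>T {a}. act g b = x}"
        using h by (intro inj_onI) (simp add: T_def)
      moreover have "(\<lambda>g. inv h \<otimes> g) ` {g\<in>T {a}. act g b = x} \<subseteq> T {a, b}"
        using h b assms act_inv[of h a] act_inv[of h b] by (auto simp: T_def act_mult)
      moreover have "finite (T {a, b})" using fin by (auto simp: T_def)
      ultimately have "card {g\<in>T {a}. act g b = x} \<le> card (T {a, b})" by (rule card_inj_on_le)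
      also have "\<dots> = t" using b assms by (intro T_card pairsI) auto
      finally show ?thesis .
    qed (simp only: card.empty)
  qed
  also have "\<dots> = q * t" using card_Om assms fin_Om by simp
  finally show ?thesis .
qed


section \<open>Orbits and Burnside's lemma for subgroups\<close>

definition orb where "orb H x = (\<lambda>g. act g x) ` H"

text \<open>\<open>BijGroup Om\<close> contains only functions that are extensional on
  \<open>Om\<close>, hence the \<open>restrict\<close>. The action is set up for every subgroup, so
  that orbit-stabiliser and Burnside apply to the members of a partition.\<close>

lemma group_action_restrict:
  assumes H: "subgroup H G"
  shows "group_action (G\<lparr>carrier := H\<rparr>) Om (\<lambda>g. restrict (act g) Om)"
proof (rule group_action.intro)
  interpret H: group "G\<lparr>carrier := H\<rparr>" using H by (rule subgroup_imp_group)
  have car: "g \<in> carrier G" if "g \<in> carrier (G\<lparr>carrier := H\<rparr>)" for g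
    using H subgroup_carrier that by auto
  have B: "restrict (act g) Om \<in> carrier (BijGroup Om)" if "g \<in> carrier (G\<lparr>carrier := H\<rparr>)" for g
    using car[OF that] by (simp add: BijGroup_def Bij_def bij_betw_def act_image act_inj)
  have M: "restrict (act (g \<otimes>\<^bsub>G\<lparr>carrier := H\<rparr>\<^esub> h)) Om = restrict (act g) Om \<otimes>\<^bsub>BijGroup Om\<^esub> restrict (act h) Om"
    if "g \<in> carrier (G\<lparr>carrier := H\<rparr>)" "h \<in> carrier (G\<lparr>carrier := H\<rparr>)" for g h
  proof -
    have "restrict (act (g \<otimes> h)) Om = compose Om (restrict (act g) Om) (restrict (act h) Om)"
      using car[OF that(1)] car[OF that(2)] by (auto simp: compose_def act_mult act_closed)
    then show ?thesis using B[OF that(1)] B[OF that(2)] by (simp add: BijGroup_def)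
  qed
  show "group_hom (G\<lparr>carrier := H\<rparr>) (BijGroup Om) (\<lambda>g. restrict (act g) Om)"
    using B M H.group_axioms group_BijGroup by (simp add: group_hom_def group_hom_axioms_def hom_def)
qed

lemma orb_orbit: "x \<in> Om \<Longrightarrow> orbit (G\<lparr>carrier := H\<rparr>) (\<lambda>g. restrict (act g) Om) x = orb H x"
  by (auto simp: orbit_def orb_def)

lemma orb_orbits: "orbits (G\<lparr>carrier := H\<rparr>) Om (\<lambda>g. restrict (act g) Om) = orb H ` Om"
  unfolding orbits_def Setcompr_eq_image by (intro image_cong refl orb_orbit)

lemma orbit_stab: assumes "subgroup H G" "x \<in> Om"
  shows "card (orb H x) * card (H \<inter> T {x}) = card H"
proof -
  interpret A: group_action "G\<lparr>carrier := H\<rparr>" Om "\<lambda>g. restrict (act g) Om"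
    by (rule group_action_restrict[OF assms(1)])
  have "stabilizer (G\<lparr>carrier := H\<rparr>) (\<lambda>g. restrict (act g) Om) x = H \<inter> T {x}"
    using assms subgroup_carrier by (auto simp: stabilizer_def T_def)
  with A.orbit_stabilizer_theorem[OF assms(2)] show ?thesis
    using assms(2) by (simp add: orb_orbit order_def)
qed

lemma burnside_Fix: assumes "subgroup H G"
  shows "card (orb H ` Om) * card H = (\<Sum>g\<in>H. card (Fix g))"
proof -
  interpret A: group_action "G\<lparr>carrier := H\<rparr>" Om "\<lambda>g. restrict (act g) Om"
    by (rule group_action_restrict[OF assms(1)])
  have "invariants Om (\<lambda>g. restrict (act g) Om) g = Fix g" for g
    by (auto simp: invariants_def Fix_def)
  with A.burnside fin_Om subgroup_finite[OF assms] show ?thesis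
    by (simp add: orb_orbits order_def)
qed

lemma orb_disjoint: assumes "subgroup H G" "x \<in> Om" "y \<in> Om"
  shows "orb H x = orb H y \<or> orb H x \<inter> orb H y = {}"
proof -
  interpret A: group_action "G\<lparr>carrier := H\<rparr>" Om "\<lambda>g. restrict (act g) Om"
    by (rule group_action_restrict[OF assms(1)])
  show ?thesis using A.disjoint_union[of "orb H x" "orb H y"] assms unfolding orb_orbits by blast
qed

lemma orb_self: "subgroup H G \<Longrightarrow> x \<in> Om \<Longrightarrow> x \<in> orb H x"
  unfolding orb_def by (metis act_one imageI subgroup_one)

lemma orb_sub: "subgroup H G \<Longrightarrow> x \<in> Om \<Longrightarrow> orb H x \<subseteq> Om"
  unfolding orb_def using act_closed subgroup_carrier by blast

lemma orb_ge: assumes "subgroup C G" "C \<subseteq> H" "subgroup H G" "x \<in> Om" "C \<inter> T {x} = {\<one>}"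
  shows "card C \<le> card (orb H x)"
proof -
  have "card (orb C x) = card C" using orbit_stab[OF assms(1,4)] assms(5) by simp
  moreover have "orb C x \<subseteq> orb H x" using assms(2) by (auto simp: orb_def)
  moreover have "finite (orb H x)" using subgroup_finite[OF assms(3)] by (simp add: orb_def)
  ultimately show ?thesis by (metis card_mono)
qed

section \<open>Unipotent radicals and Borel subgroups\<close>

lemma card_Union_punctured:
  assumes "finite I" and sub: "\<And>i. i \<in> I \<Longrightarrow> subgroup (K i) G" and m: "\<And>i. i \<in> I \<Longrightarrow> card (K i) = m"
    and disj: "\<And>i j g. i \<in> I \<Longrightarrow> j \<in> I \<Longrightarrow> g \<in> K i \<Longrightarrow> g \<in> K j \<Longrightarrow> g \<noteq> \<one> \<Longrightarrow> i = j"
  shows "card (\<Union>i\<in>I. K i - {\<one>}) = card I * (m - 1)"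
proof -
  have "card (\<Union>i\<in>I. K i - {\<one>}) = (\<Sum>i\<in>I. card (K i - {\<one>}))"
    using assms(1) subgroup_finite[OF sub] disj by (intro card_UN_disjoint) blast+
  also have "\<dots> = (\<Sum>i\<in>I. m - 1)"
    using m subgroup_one[OF sub] by (intro sum.cong) (simp_all add: card_Diff_singleton)
  finally show ?thesis by simp
qed

text \<open>Hypothesis \<open>unip\<close> provides only some subgroup \<open>V\<close> of order
  \<open>q\<close> whose nontrivial elements fix just \<open>a\<close>. Together with the
  \<open>q * (t - 1)\<close> nontrivial elements of the split tori through \<open>a\<close> it
  already exhausts the bound \<open>q * t\<close> for \<open>T {a}\<close>, so no further element
  fixes exactly \<open>a\<close>, and \<open>U a\<close> is \<open>V\<close>.\<close>

lemma U_facts: assumes a: "a \<in> Om" shows "subgroup (U a) G \<and> card (U a) = q"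
proof -
  obtain V where V: "subgroup V G" "card V = q" "\<And>g. g \<in> V \<Longrightarrow> g \<noteq> \<one> \<Longrightarrow> Fix g = {a}"
    using unip[OF a] unfolding Fix_def by blast
  let ?W = "(\<Union>x\<in>Om - {a}. T {a, x} - {\<one>})"
  have fT: "finite (T p)" for p using fin by (simp add: T_def)
  have Wcard: "card ?W = q * (t - 1)"
  proof -
    have "card ?W = card (Om - {a}) * (t - 1)"
    proof (rule card_Union_punctured)
      fix i j g assume ij: "i \<in> Om - {a}" "j \<in> Om - {a}" "g \<in> T {a, i}" "g \<in> T {a, j}" "g \<noteq> \<one>"
      then have "Fix g = {a, i}" "Fix g = {a, j}"
        using T_Fix[OF pairsI[of a i]] T_Fix[OF pairsI[of a j]] a by auto
      then show "i = j" using ij by auto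
    qed (use a fin_Om T_subgroup T_card[OF pairsI] in auto)
    then show ?thesis using fin_Om a card_Om by simp
  qed
  have VW: "V \<inter> ?W = {}"
  proof (rule ccontr)
    assume "V \<inter> ?W \<noteq> {}"
    then obtain g x where g: "g \<in> V" "x \<in> Om - {a}" "g \<in> T {a, x}" "g \<noteq> \<one>" by blast
    then show False using T_Fix[OF pairsI[of a x]] V(3) a by auto
  qed
  have VT: "V \<subseteq> T {a}"
  proof
    fix g assume g: "g \<in> V"
    then show "g \<in> T {a}"
      using V(3)[of g] subgroup_carrier[OF V(1)] a by (cases "g = \<one>") (auto simp: T_def act_one Fix_def)
  qed
  have WT: "?W \<subseteq> T {a}" by (auto simp: T_def)
  have "card (V \<union> ?W) = q + q * (t - 1)"
    using VW V(2) Wcard fT fin_Om subgroup_finite[OF V(1)] by (subst card_Un_disjoint) auto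
  also have "\<dots> = q * t" using t2 by (cases t) auto
  finally have "T {a} = V \<union> ?W"
    using card_seteq[OF fT, of "V \<union> ?W" "{a}"] VT WT stab_card_le[OF a] by auto
  have "U a = V"
  proof
    show "V \<subseteq> U a" using V subgroup_carrier[OF V(1)] by (auto simp: U_def)
    show "U a \<subseteq> V"
    proof
      fix g assume g: "g \<in> U a"
      show "g \<in> V"
      proof (cases "g = \<one>")
        case False
        then have F: "Fix g = {a}" "g \<in> carrier G" using g by (auto simp: U_def)
        then have "g \<in> T {a}" by (auto simp: Fix_def T_def)
        moreover have "g \<notin> ?W" using F a by (auto simp: T_def Fix_def)
        ultimately show ?thesis using \<open>T {a} = V \<union> ?W\<close> by blast
      qed (use subgroup_one[OF V(1)] in simp)
    qed
  qed
  then show ?thesis using V by simp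
qed

lemmas U_subgroup = U_facts[THEN conjunct1] and U_card = U_facts[THEN conjunct2]

lemma U_T: "a \<in> Om \<Longrightarrow> U a \<subseteq> T {a}"
  by (auto simp: U_def T_def act_one Fix_def)

text \<open>A nontrivial element of \<open>U a\<close> fixes no point but \<open>a\<close>, so the
  orbit of \<open>x\<close> has \<open>q\<close> elements and fills \<open>Om - {a}\<close>.\<close>

lemma U_trans: assumes a: "a \<in> Om" and x: "x \<in> Om" "x \<noteq> a" and y: "y \<in> Om" "y \<noteq> a"
  shows "\<exists>u\<in>U a. act u x = y"
proof -
  have "U a \<inter> T {x} = {\<one>}" using subgroup_one[OF U_subgroup[OF a]] x
    by (auto simp: T_def U_def Fix_def act_one)
  then have c: "card (orb (U a) x) = q" using orbit_stab[OF U_subgroup[OF a] x(1)] U_card[OF a] by simp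
  have "orb (U a) x \<subseteq> Om - {a}"
  proof -
    have "act u x \<noteq> a" if "u \<in> U a" for u
    proof -
      have "act u a = a" "u \<in> carrier G" using that U_T[OF a] by (auto simp: T_def)
      then show ?thesis using act_eq[of u x a] a x by auto
    qed
    then show ?thesis using orb_sub[OF U_subgroup[OF a] x(1)] by (auto simp: orb_def)
  qed
  moreover have "card (Om - {a}) = q" using card_Om fin_Om a by simp
  ultimately have "orb (U a) x = Om - {a}" using c fin_Om by (intro card_seteq) auto
  then have "y \<in> (\<lambda>g. act g x) ` U a" using y unfolding orb_def by blast
  then show ?thesis by blast
qed

lemma stab_card_eq: assumes a: "a \<in> Om" shows "card (T {a}) = q * t"
proof -
  obtain b where b: "b \<in> Om" "b \<noteq> a" using other_point by blast
  have "card (T {a, b}) * card (U a) \<le> card (T {a})"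
  proof (rule card_product_le)
    show "T {a, b} \<inter> U a = {\<one>}"
      using b a by (auto simp: T_def U_def act_one Fix_def)
    show "T {a, b} \<subseteq> T {a}" by (auto simp: T_def)
  qed (use a b U_T T_subgroup U_subgroup in auto)
  then show ?thesis using stab_card_le[OF a] T_card[OF pairsI, of a b] U_card[OF a] a b by (simp add: mult.commute)
qed

lemma third_point: "\<exists>x\<in>Om. x \<noteq> a \<and> x \<noteq> b"
proof (rule ccontr)
  assume "\<not> ?thesis"
  then have "card Om \<le> card {a, b}" by (intro card_mono) auto
  then show False using card_Om q3 card_insert_if[of "{b}" a] by (simp split: if_splits)
qed

lemma G_trans: assumes "x \<in> Om" "y \<in> Om" shows "\<exists>g\<in>carrier G. act g x = y"
proof -
  obtain a where "a \<in> Om" "a \<noteq> x" "a \<noteq> y" using third_point by blast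
  then show ?thesis using U_trans[of a x y] assms subgroup_carrier[OF U_subgroup] by blast
qed

lemma card_G: "card (carrier G) = (q + 1) * (q * t)"
proof -
  obtain a where a: "a \<in> Om" using other_point by blast
  have "orb (carrier G) a = Om"
    using G_trans[OF a] act_closed a unfolding orb_def by blast
  moreover have "carrier G \<inter> T {a} = T {a}" by (auto simp: T_def)
  ultimately show ?thesis using orbit_stab[OF subgroup_self a] card_Om stab_card_eq[OF a] by simp
qed

lemma Fix_conj: assumes "h \<in> carrier G" "g \<in> carrier G"
  shows "Fix (h \<otimes> g \<otimes> inv h) = act h ` Fix g"
proof
  show "act h ` Fix g \<subseteq> Fix (h \<otimes> g \<otimes> inv h)"
    using assms by (auto simp: Fix_def act_mult act_closed act_inv)
  show "Fix (h \<otimes> g \<otimes> inv h) \<subseteq> act h ` Fix g"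
  proof
    fix x assume x: "x \<in> Fix (h \<otimes> g \<otimes> inv h)"
    then have xO: "x \<in> Om" by (simp add: Fix_def)
    have "act h (act g (act (inv h) x)) = x" using x xO assms by (simp add: Fix_def act_mult act_closed)
    then have "act g (act (inv h) x) = act (inv h) x"
      using act_inv[of h "act g (act (inv h) x)"] assms xO by (simp add: act_closed)
    then have "act (inv h) x \<in> Fix g" using assms xO by (simp add: Fix_def act_closed)
    then show "x \<in> act h ` Fix g" using act_inv'[of h x] assms xO by (metis imageI)
  qed
qed

lemma pairs_act: "h \<in> carrier G \<Longrightarrow> p \<in> pairs \<Longrightarrow> act h ` p \<in> pairs"
  by (auto simp: pairs_def act_closed subset_iff card_image inj_on_subset[OF act_inj])

lemma unconj: assumes "h \<in> carrier G" "g \<in> carrier G" shows "h \<otimes> (inv h \<otimes> g \<otimes> h) \<otimes> inv h = g"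
proof -
  have "h \<otimes> (inv h \<otimes> g \<otimes> h) \<otimes> inv h = (h \<otimes> inv h) \<otimes> g \<otimes> (h \<otimes> inv h)"
    using assms by (simp only: m_assoc m_closed inv_closed)
  then show ?thesis using assms by simp
qed

lemma unconj': "h \<in> carrier G \<Longrightarrow> g \<in> carrier G \<Longrightarrow> inv h \<otimes> (h \<otimes> g \<otimes> inv h) \<otimes> h = g"
  using unconj[of "inv h" g] by simp

lemma conj_eq_one: "h \<in> carrier G \<Longrightarrow> g \<in> carrier G \<Longrightarrow> h \<otimes> g \<otimes> inv h = \<one> \<longleftrightarrow> g = \<one>"
  using unconj'[of h g] by auto

lemma T_conj: assumes h: "h \<in> carrier G" and p: "p \<subseteq> Om" and g: "g \<in> T p"
  shows "h \<otimes> g \<otimes> inv h \<in> T (act h ` p)"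
proof -
  have gc: "g \<in> carrier G" "p \<subseteq> Fix g" using g p by (auto simp: T_def Fix_def)
  then have "act h ` p \<subseteq> Fix (h \<otimes> g \<otimes> inv h)" using Fix_conj[OF h] by auto
  then show ?thesis using Fix_T h gc by simp
qed

lemma T_conj_sub: assumes H: "subgroup H G" and h: "h \<in> H" and p: "p \<subseteq> Om" and T: "T p \<subseteq> H"
  shows "T (act h ` p) \<subseteq> H"
proof
  fix g assume g: "g \<in> T (act h ` p)"
  have hc: "h \<in> carrier G" using H h subgroup_carrier by blast
  have gc: "g \<in> carrier G" using g by (simp add: T_def)
  have hp: "act h ` p \<subseteq> Om" using act_closed[OF hc] p by blast
  have "inv h \<otimes> g \<otimes> inv (inv h) \<in> T (act (inv h) ` act h ` p)"
    by (rule T_conj[OF _ hp g]) (use hc in simp)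
  moreover have "act (inv h) ` act h ` p = p"
    using p act_inv[OF hc] by (force simp: image_iff subset_iff)
  ultimately have "inv h \<otimes> g \<otimes> h \<in> H" using T hc by auto
  then have "h \<otimes> (inv h \<otimes> g \<otimes> h) \<otimes> inv h \<in> H"
    using H h by (meson subgroup.m_closed subgroup.m_inv_closed)
  then show "g \<in> H" using unconj[OF hc gc] by simp
qed

text \<open>
  The torus acts semiregularly on the nontrivial elements of \<open>U a\<close>, so \<open>H \<inter> U a\<close> has more than \<open>q / 2\<close>
  elements and Lagrange's theorem forces \<open>U a \<subseteq> H\<close>.
\<close>

lemma U_sub_borel:
  assumes H: "subgroup H G" and a: "a \<in> Om" and p: "p \<in> pairs" "a \<in> p" "T p \<subseteq> H"
    and HU: "H \<inter> U a \<noteq> {\<one>}"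
  shows "T {a} \<subseteq> H"
proof -
  obtain b where b: "p = {a, b}" "b \<noteq> a" "b \<in> Om" using p by (elim pairsE) auto
  define V where "V = H \<inter> U a"
  have V: "subgroup V G" unfolding V_def using H U_subgroup[OF a] by (rule subgroups_Inter_pair)
  have fV: "finite V" using subgroup_finite[OF V] .
  have V1: "\<one> \<in> V" using subgroup_one[OF V] .
  obtain u where u: "u \<in> V" "u \<noteq> \<one>" using HU V1 V_def by auto
  have uc: "u \<in> carrier G" "Fix u = {a}" "u \<in> H" using u by (auto simp: V_def U_def)
  have ub: "act u b \<in> Om" "act u b \<noteq> b" "act u b \<noteq> a"
  proof -
    show "act u b \<in> Om" using act_closed uc b by simp
    show "act u b \<noteq> b" using uc b by (auto simp: Fix_def)
    have "act u a = a" using uc by (auto simp: Fix_def)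
    then show "act u b \<noteq> a" using act_eq[OF uc(1) b(3) a] b by auto
  qed
  have Tsub: "subgroup (T p) G" using T_subgroup pairs_sub p by blast
  have "inj_on (\<lambda>x. x \<otimes> u \<otimes> inv x) (T p)"
  proof (rule inj_onI)
    fix x y assume xy: "x \<in> T p" "y \<in> T p" "x \<otimes> u \<otimes> inv x = y \<otimes> u \<otimes> inv y"
    then have c: "x \<in> carrier G" "y \<in> carrier G" by (auto simp: T_def)
    \<comment> \<open>This element commutes with \<open>u\<close> and fixes \<open>a\<close> and
      \<open>b\<close>, hence also the third point \<open>act u b\<close>; so it is trivial.\<close>
    define z where "z = inv y \<otimes> x"
    have zc: "z \<in> carrier G" using c by (simp add: z_def)
    have zT: "z \<in> T p" unfolding z_def using xy(1,2) Tsub by (meson subgroup.m_closed subgroup.m_inv_closed)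
    have "z \<otimes> u = inv y \<otimes> (x \<otimes> u \<otimes> inv x) \<otimes> x" using c uc by (simp add: z_def m_assoc)
    also have "\<dots> = u \<otimes> z" unfolding xy(3) using c uc by (simp add: z_def m_assoc[symmetric])
    finally have zu: "z \<otimes> u = u \<otimes> z" .
    have "act z b = b" "act z a = a" using zT b by (auto simp: T_def)
    then have "act z (act u b) = act u b" using zu zc uc b by (metis act_mult)
    then have "z = \<one>" using three[of z a b "act u b"] zc a b ub \<open>act z b = b\<close> \<open>act z a = a\<close> by auto
    then have "inv y \<otimes> x = \<one>" by (simp add: z_def)
    then show "x = y" using c inv_solve_left'[of \<one> y x] by auto
  qed
  moreover have "(\<lambda>x. x \<otimes> u \<otimes> inv x) ` T p \<subseteq> V - {\<one>}"
  proof clarify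
    fix x assume x: "x \<in> T p"
    then have xc: "x \<in> carrier G" "act x a = a" "x \<in> H" using p by (auto simp: T_def)
    have "Fix (x \<otimes> u \<otimes> inv x) = {a}" using Fix_conj[OF xc(1) uc(1)] uc xc by simp
    then have "x \<otimes> u \<otimes> inv x \<in> U a" using xc uc by (simp add: U_def)
    moreover have "x \<otimes> u \<otimes> inv x \<in> H" using H xc uc by (meson subgroup.m_closed subgroup.m_inv_closed)
    moreover have "x \<otimes> u \<otimes> inv x \<noteq> \<one>" using conj_eq_one xc uc u by simp
    ultimately show "x \<otimes> u \<otimes> inv x \<in> V - {\<one>}" by (simp add: V_def)
  qed
  ultimately have "card (T p) \<le> card (V - {\<one>})" using fV card_inj_on_le by blast
  then have Vge: "card V \<ge> t + 1" using T_card[OF p(1)] V1 fV t2 by simp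
  have "card V dvd q" using subgroup_card_dvd[OF V U_subgroup[OF a]] U_card[OF a] by (auto simp: V_def)
  then obtain m where m: "q = card V * m" by (auto simp: dvd_def)
  \<comment> \<open>Index 2 or more would give \<open>2 * (t + 1) \<le> q = d * t + 1\<close>,
    against \<open>d \<le> 2\<close>.\<close>
  have "m < 2"
  proof (rule ccontr)
    assume "\<not> m < 2"
    then have "(t + 1) * 2 \<le> card V * m" using Vge by (intro mult_le_mono) auto
    then show False using m dt d12 by auto
  qed
  then have "m = 1" using m q3 by (cases m) auto
  then have "V = U a" using m U_card[OF a] subgroup_finite[OF U_subgroup[OF a]] by (intro card_subset_eq) (auto simp: V_def)
  then have UH: "U a \<subseteq> H" by (auto simp: V_def)
  show ?thesis
  proof
    fix g assume g: "g \<in> T {a}"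
    then have gc: "g \<in> carrier G" "act g a = a" by (auto simp: T_def)
    have "act g b \<in> Om" "act g b \<noteq> a" using act_closed gc b act_eq[of g b a] a by auto
    \<comment> \<open>The Borel subgroup is radical times torus: \<open>v\<close> corrects
      \<open>g\<close> so that \<open>inv v \<otimes> g\<close> fixes \<open>b\<close> as well as
      \<open>a\<close>.\<close>
    then obtain v where v: "v \<in> U a" "act v b = act g b" using U_trans[OF a b(3,2)] by blast
    have vc: "v \<in> carrier G" "act v a = a" using v U_T[OF a] by (auto simp: T_def)
    have "inv v \<otimes> g \<in> T p" using gc vc v act_inv[of v a] act_inv[of v b] a b by (auto simp: b(1) T_def act_mult)
    then have "v \<otimes> (inv v \<otimes> g) \<in> H" using p UH v H by (meson subgroup.m_closed subsetD)
    then show "g \<in> H" using vc gc by (simp add: m_assoc[symmetric])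
  qed
qed

text \<open>The radical \<open>U a\<close> lies in \<open>H\<close> and is transitive on the points
  other than \<open>a\<close>. Once some \<open>h\<close> in \<open>H\<close> moves
  \<open>a\<close>, the subgroup is therefore transitive on the line, and it contains a full point
  stabiliser.\<close>

lemma borel_maximal: assumes H: "subgroup H G" and a: "a \<in> Om" "T {a} \<subseteq> H"
  shows "H = T {a} \<or> H = carrier G"
proof (rule disjCI)
  assume "H \<noteq> carrier G"
  show "H = T {a}"
  proof (rule ccontr)
    assume "H \<noteq> T {a}"
    then obtain h where h: "h \<in> H" "act h a \<noteq> a" using a subgroup_carrier[OF H] by (auto simp: T_def)
    have hc: "h \<in> carrier G" using h H subgroup_carrier by blast
    have "g \<in> H" if g: "g \<in> carrier G" for g
    proof -
      have "\<exists>k\<in>H. act k a = act g a"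
      proof (cases "act g a = a")
        case True then show ?thesis using act_one a subgroup_one[OF H] by auto
      next
        case False
        then obtain u where u: "u \<in> U a" "act u (act h a) = act g a"
          using U_trans[OF a(1), of "act h a" "act g a"] h hc g a act_closed by blast
        then have "u \<in> H" "u \<in> carrier G" using U_T[OF a(1)] a by (auto simp: T_def)
        then show ?thesis using u h hc act_mult[of u h a] a H by (metis subgroup.m_closed)
      qed
      then obtain k where k: "k \<in> H" "act k a = act g a" by blast
      have kc: "k \<in> carrier G" using k H subgroup_carrier by blast
      have "inv k \<otimes> g \<in> T {a}" using kc g k act_inv[of k a] a by (simp add: T_def act_mult)
      then have "k \<otimes> (inv k \<otimes> g) \<in> H" using a k H by (meson subgroup.m_closed subsetD)
      then show "g \<in> H" using kc g by (simp add: m_assoc[symmetric])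
    qed
    then show False using \<open>H \<noteq> carrier G\<close> subgroup.subset[OF H] by blast
  qed
qed

lemma T_nontriv: assumes "p \<in> pairs" obtains g where "g \<in> T p" "g \<noteq> \<one>" "Fix g = p"
proof -
  have "\<not> T p \<subseteq> {\<one>}"
  proof
    assume "T p \<subseteq> {\<one>}"
    then have "card (T p) \<le> card {\<one>}" by (intro card_mono) auto
    then show False using T_card[OF assms] t2 by simp
  qed
  then show ?thesis using that T_Fix[OF assms] by blast
qed

text \<open>Otherwise \<open>H\<close> contains no nontrivial element of \<open>U a\<close>, and the
  product bound inside the Borel subgroup leaves at most \<open>t\<close> elements for
  \<open>H \<inter> T {a}\<close>. Both tori have order \<open>t\<close>, so both would equal this
  intersection.\<close>

lemma two_tori_borel:
  assumes H: "subgroup H G" and a: "a \<in> Om" and p: "p \<in> pairs" "a \<in> p" "T p \<subseteq> H"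
    and p': "p' \<in> pairs" "a \<in> p'" "T p' \<subseteq> H" and ne: "p \<noteq> p'"
  shows "T {a} \<subseteq> H"
proof (rule ccontr)
  assume nb: "\<not> T {a} \<subseteq> H"
  define K where "K = H \<inter> T {a}"
  have Ks: "subgroup K G" unfolding K_def by (rule subgroups_Inter_pair[OF H T_subgroup]) (use a in simp)
  have fK: "finite K" using subgroup_finite[OF Ks] .
  have "H \<inter> U a = {\<one>}" using U_sub_borel[OF H a p] nb by blast
  then have "K \<inter> U a = {\<one>}" using U_T[OF a] by (auto simp: K_def)
  then have "card K * card (U a) \<le> card (T {a})"
    using Ks U_subgroup[OF a] U_T[OF a] a T_subgroup by (intro card_product_le) (auto simp: K_def)
  then have "card K \<le> t" using U_card[OF a] stab_card_eq[OF a] q3 by (simp add: mult.commute)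
  moreover have "T p \<subseteq> K" "T p' \<subseteq> K" using p p' by (auto simp: K_def T_def)
  ultimately have "T p = K" "T p' = K" using T_card p p' fK card_seteq by metis+
  then have "T p = T p'" by simp
  then show False using ne by (metis T_Fix T_nontriv p(1) p'(1))
qed

section \<open>Element counts in isolated subgroups\<close>

text \<open>Members of a partition are isolated because tori are cyclic.\<close>

definition isolated where "isolated H \<longleftrightarrow> subgroup H G \<and>
  (\<forall>p\<in>pairs. H \<inter> T p \<noteq> {\<one>} \<longrightarrow> T p \<subseteq> H) \<and> (\<forall>C\<in>CC. H \<inter> C \<noteq> {\<one>} \<longrightarrow> C \<subseteq> H)"
definition split_tori where "split_tori H = {p \<in> pairs. T p \<subseteq> H}"
definition nonsplit_tori where "nonsplit_tori H = {C \<in> CC. C \<subseteq> H}"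
definition unipotents where "unipotents H = {g \<in> H. card (Fix g) = 1}"

lemma finite_CC: "finite CC"
  by (rule finite_subset[of _ "Pow (carrier G)"]) (use CC_subgroup subgroup.subset fin in auto)

lemma finite_split_tori: "finite (split_tori H)" and finite_nonsplit_tori: "finite (nonsplit_tori H)"
  using finite_pairs finite_CC by (auto simp: split_tori_def nonsplit_tori_def)

lemma CC_Fix: "C \<in> CC \<Longrightarrow> g \<in> C \<Longrightarrow> g \<noteq> \<one> \<Longrightarrow> Fix g = {}"
  unfolding Fix_def using CC_iff CC_subgroup subgroup_carrier by blast

lemma Fix_CC: "g \<in> carrier G \<Longrightarrow> Fix g = {} \<Longrightarrow> \<exists>C\<in>CC. g \<in> C"
  using CC_iff[of g] Fix_one other_point unfolding Fix_def[symmetric] by blast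

lemma isolated_H2: assumes "isolated H"
  shows "{g \<in> H. card (Fix g) = 2} = (\<Union>p\<in>split_tori H. T p - {\<one>})" (is "?L = ?R")
proof
  have H: "subgroup H G" using assms isolated_def by blast
  show "?L \<subseteq> ?R"
  proof
    fix g assume g: "g \<in> ?L"
    then have gc: "g \<in> carrier G" using H subgroup_carrier by blast
    have p: "Fix g \<in> pairs" using g Fix_sub by (simp add: pairs_def)
    have g1: "g \<noteq> \<one>" using g Fix_one card_Om q3 by auto
    have "g \<in> T (Fix g)" using Fix_T gc by blast
    then have "T (Fix g) \<subseteq> H" using assms p g g1 isolated_def by blast
    then show "g \<in> ?R" using p g1 \<open>g \<in> T (Fix g)\<close> by (auto simp: split_tori_def)
  qed
  show "?R \<subseteq> ?L"
    using T_Fix by (fastforce simp: split_tori_def pairs_def)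
qed

lemma isolated_H0: assumes "isolated H"
  shows "{g \<in> H. card (Fix g) = 0} = (\<Union>C\<in>nonsplit_tori H. C - {\<one>})" (is "?L = ?R")
proof
  have H: "subgroup H G" using assms isolated_def by blast
  show "?L \<subseteq> ?R"
  proof
    fix g assume g: "g \<in> ?L"
    then have gc: "g \<in> carrier G" using H subgroup_carrier by blast
    have "Fix g = {}" using g finite_Fix by simp
    then obtain C where C: "C \<in> CC" "g \<in> C" using Fix_CC gc by blast
    have g1: "g \<noteq> \<one>" using g Fix_one card_Om q3 by auto
    then have "C \<subseteq> H" using assms C g isolated_def by blast
    then show "g \<in> ?R" using C g1 by (auto simp: nonsplit_tori_def)
  qed
  show "?R \<subseteq> ?L"
    using CC_Fix by (fastforce simp: nonsplit_tori_def)
qed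

lemma card_H2: assumes "isolated H" shows "card {g \<in> H. card (Fix g) = 2} = card (split_tori H) * (t - 1)"
  unfolding isolated_H2[OF assms]
proof (rule card_Union_punctured[OF finite_split_tori])
  show "p = p'" if "p \<in> split_tori H" "p' \<in> split_tori H" "g \<in> T p" "g \<in> T p'" "g \<noteq> \<one>" for p p' g
    using T_Fix[of p g] T_Fix[of p' g] that by (simp add: split_tori_def)
qed (auto simp: split_tori_def T_card intro!: T_subgroup pairs_sub)

lemma card_H0: assumes "isolated H" shows "card {g \<in> H. card (Fix g) = 0} = card (nonsplit_tori H) * (c - 1)"
  unfolding isolated_H0[OF assms]
proof (rule card_Union_punctured[OF finite_nonsplit_tori])
  show "C = C'" if "C \<in> nonsplit_tori H" "C' \<in> nonsplit_tori H" "g \<in> C" "g \<in> C'" "g \<noteq> \<one>" for C C' g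
    using CC_disjoint[of C C'] that unfolding nonsplit_tori_def by blast
qed (auto simp: nonsplit_tori_def CC_card CC_subgroup)

lemma split_by_Fix: assumes H: "subgroup H G"
  shows "H = {\<one>} \<union> {g \<in> H. card (Fix g) = 2} \<union> {g \<in> H. card (Fix g) = 0} \<union> unipotents H"
proof -
  have "card (Fix g) = 0 \<or> card (Fix g) = 1 \<or> card (Fix g) = 2" if "g \<in> H" "g \<noteq> \<one>" for g
    using Fix_le2[of g] subgroup_carrier[OF H] that by force
  then show ?thesis using subgroup_one[OF H] unfolding unipotents_def by blast
qed

lemma sum_by_Fix: fixes f :: "'a \<Rightarrow> nat" assumes H: "subgroup H G"
  shows "(\<Sum>g\<in>H. f g) = f \<one> + (\<Sum>g\<in>{g \<in> H. card (Fix g) = 2}. f g) +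
    (\<Sum>g\<in>{g \<in> H. card (Fix g) = 0}. f g) + (\<Sum>g\<in>unipotents H. f g)"
proof -
  have fH: "finite H" using subgroup_finite[OF H] .
  have one: "card (Fix \<one>) = q + 1" using Fix_one card_Om by simp
  show ?thesis
    apply (subst split_by_Fix[OF H])
    apply (subst sum.union_disjoint, use fH one q3 in \<open>auto simp: unipotents_def\<close>)+
    done
qed

lemma card_isolated: assumes "isolated H"
  shows "card H = 1 + card (split_tori H) * (t - 1) + card (nonsplit_tori H) * (c - 1) + card (unipotents H)"
  using sum_by_Fix[of H "\<lambda>_. 1"] card_H0[OF assms] card_H2[OF assms] assms by (simp add: isolated_def)

text \<open>The identity contributes \<open>q + 1\<close> fixed points, an element of a split torus
  2, a unipotent 1 and an element of a nonsplit torus none. Eliminating \<open>card H\<close> with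
  \<open>card_isolated\<close> gives an equation between the numbers of tori, unipotents and
  orbits.\<close>

lemma burnside_isolated: assumes "isolated H"
  shows "card (orb H ` Om) * card H = q + 1 + 2 * card (split_tori H) * (t - 1) + card (unipotents H)"
proof -
  have H: "subgroup H G" using assms isolated_def by blast
  have "(\<Sum>g\<in>{g \<in> H. card (Fix g) = 2}. card (Fix g)) = (\<Sum>g\<in>{g \<in> H. card (Fix g) = 2}. 2)"
    by (rule sum.cong) auto
  also have "\<dots> = 2 * card (split_tori H) * (t - 1)" using card_H2[OF assms] by simp
  moreover have "(\<Sum>g\<in>unipotents H. card (Fix g)) = (\<Sum>g\<in>unipotents H. 1)" by (rule sum.cong) (auto simp: unipotents_def)
  ultimately show ?thesis unfolding burnside_Fix[OF H] sum_by_Fix[OF H] using Fix_one card_Om by simp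
qed

section \<open>Conjugation of nonsplit tori and their normalizers\<close>

definition conj_image where "conj_image h C = (\<lambda>z. h \<otimes> z \<otimes> inv h) ` C"

lemma inj_conj: "h \<in> carrier G \<Longrightarrow> C \<subseteq> carrier G \<Longrightarrow> inj_on (\<lambda>z. h \<otimes> z \<otimes> inv h) C"
  by (rule inj_on_inverseI[where g = "\<lambda>z. inv h \<otimes> z \<otimes> h"]) (auto simp: unconj')

lemma CC_sub: "C \<in> CC \<Longrightarrow> C \<subseteq> carrier G"
  using CC_subgroup subgroup.subset by blast

text \<open>Brings cyclicity into the form in which it is used: one nontrivial element drags all of
  \<open>K\<close> into every subgroup containing it.\<close>

lemma cyclic_generator:
  assumes g: "g \<in> carrier G" "K = range (\<lambda>k::nat. g [^] k)" and K: "card K \<ge> 2"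
  shows "g \<in> K \<and> g \<noteq> \<one> \<and> (\<forall>L. subgroup L G \<longrightarrow> g \<in> L \<longrightarrow> K \<subseteq> L)"
proof (intro conjI allI impI)
  have "g [^] (1::nat) \<in> K" using g by blast
  then show "g \<in> K" using g by simp
  show "g \<noteq> \<one>"
  proof
    assume "g = \<one>"
    then have "K = {\<one>}" using g by auto
    then show False using K by simp
  qed
  show "K \<subseteq> L" if L: "subgroup L G" "g \<in> L" for L
  proof -
    have "g [^] k \<in> L" for k :: nat
      by (induction k) (use L in \<open>auto intro: subgroup.m_closed subgroup.one_closed\<close>)
    then show ?thesis using g by auto
  qed
qed

lemma CC_generator: assumes "C \<in> CC"
  obtains g where "g \<in> C" "g \<noteq> \<one>" "\<And>K. subgroup K G \<Longrightarrow> g \<in> K \<Longrightarrow> C \<subseteq> K"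
proof -
  obtain g where g: "g \<in> carrier G" "C = range (\<lambda>k::nat. g [^] k)" using CC_cyclic[OF assms] by blast
  show ?thesis using cyclic_generator[OF g] CC_card[OF assms] c2 that by blast
qed

lemma T_generator: assumes "p \<in> pairs"
  obtains g where "g \<in> T p" "g \<noteq> \<one>" "\<And>K. subgroup K G \<Longrightarrow> g \<in> K \<Longrightarrow> T p \<subseteq> K"
proof -
  obtain g where g: "g \<in> carrier G" "T p = range (\<lambda>k::nat. g [^] k)" using T_cyclic[OF assms] by blast
  show ?thesis using cyclic_generator[OF g] T_card[OF assms] t2 that by blast
qed

lemma conj_mult: "h \<in> carrier G \<Longrightarrow> x \<in> carrier G \<Longrightarrow> y \<in> carrier G \<Longrightarrow>
  h \<otimes> (x \<otimes> y) \<otimes> inv h = (h \<otimes> x \<otimes> inv h) \<otimes> (h \<otimes> y \<otimes> inv h)"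
proof -
  assume a: "h \<in> carrier G" "x \<in> carrier G" "y \<in> carrier G"
  have "(h \<otimes> x \<otimes> inv h) \<otimes> (h \<otimes> y \<otimes> inv h) = h \<otimes> x \<otimes> (inv h \<otimes> h) \<otimes> y \<otimes> inv h"
    using a by (simp only: m_assoc m_closed inv_closed)
  then show ?thesis using a by (simp add: m_assoc)
qed

text \<open>This is the conjugate of \<open>K\<close> by \<open>inv h\<close>, written as a preimage
  so that the image of a single generator decides whether a whole torus is conjugated into
  \<open>K\<close>.\<close>

lemma preimage_conj_subgroup: assumes h: "h \<in> carrier G" and K: "subgroup K G"
  shows "subgroup {z \<in> carrier G. h \<otimes> z \<otimes> inv h \<in> K} G"
proof (rule subgroupI)
  show "{z \<in> carrier G. h \<otimes> z \<otimes> inv h \<in> K} \<noteq> {}" using h subgroup_one[OF K] by (auto intro!: exI[of _ \<one>])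
  fix x assume x: "x \<in> {z \<in> carrier G. h \<otimes> z \<otimes> inv h \<in> K}"
  have "h \<otimes> inv x \<otimes> inv h = inv (h \<otimes> x \<otimes> inv h)" using h x by (simp add: inv_mult_group m_assoc)
  then show "inv x \<in> {z \<in> carrier G. h \<otimes> z \<otimes> inv h \<in> K}" using x K by (simp add: subgroup.m_inv_closed)
  fix y assume y: "y \<in> {z \<in> carrier G. h \<otimes> z \<otimes> inv h \<in> K}"
  then show "x \<otimes> y \<in> {z \<in> carrier G. h \<otimes> z \<otimes> inv h \<in> K}"
    using x h conj_mult[of h x y] K by (simp add: subgroup.m_closed)
qed auto

text \<open>The conjugate of a generator is again free of fixed points and so lies in some
  \<open>C'\<close> of the family. The generator carries all of \<open>C\<close> into
  \<open>C'\<close>, and equal orders give equality.\<close>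

lemma conj_image_CC: assumes h: "h \<in> carrier G" and C: "C \<in> CC" shows "conj_image h C \<in> CC"
proof -
  obtain g where g: "g \<in> C" "g \<noteq> \<one>" "\<And>K. subgroup K G \<Longrightarrow> g \<in> K \<Longrightarrow> C \<subseteq> K" using CC_generator[OF C] by metis
  have gc: "g \<in> carrier G" using g CC_sub C by blast
  have "Fix (h \<otimes> g \<otimes> inv h) = {}" using Fix_conj[OF h gc] CC_Fix[OF C g(1,2)] by simp
  then obtain C' where C': "C' \<in> CC" "h \<otimes> g \<otimes> inv h \<in> C'" using Fix_CC[of "h \<otimes> g \<otimes> inv h"] h gc by auto
  have "C \<subseteq> {z \<in> carrier G. h \<otimes> z \<otimes> inv h \<in> C'}"
    using preimage_conj_subgroup[OF h CC_subgroup[OF C'(1)]] gc C' by (intro g(3)) auto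
  then have "conj_image h C \<subseteq> C'" by (auto simp: conj_image_def)
  moreover have "card (conj_image h C) = card C'"
    unfolding conj_image_def using card_image[OF inj_conj[OF h CC_sub[OF C]]] CC_card C C' by simp
  ultimately have "conj_image h C = C'" using subgroup_finite[OF CC_subgroup[OF C'(1)]] card_subset_eq by blast
  then show ?thesis using C' by simp
qed

lemma conj_image_mult: "g \<in> carrier G \<Longrightarrow> h \<in> carrier G \<Longrightarrow> C \<subseteq> carrier G \<Longrightarrow> conj_image (g \<otimes> h) C = conj_image g (conj_image h C)"
  unfolding conj_image_def image_image by (rule image_cong) (auto simp: inv_mult_group m_assoc subset_iff)

lemma conj_image_one: "C \<subseteq> carrier G \<Longrightarrow> conj_image \<one> C = C"
proof -
  assume "C \<subseteq> carrier G"
  then have "conj_image \<one> C = (\<lambda>z. z) ` C" unfolding conj_image_def by (intro image_cong) auto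
  then show ?thesis by simp
qed

lemma conj_image_nonsplit_tori: assumes H: "subgroup H G" and h: "h \<in> H" and C: "C \<in> nonsplit_tori H" shows "conj_image h C \<in> nonsplit_tori H"
proof -
  have "conj_image h C \<in> CC" using conj_image_CC C h subgroup_carrier[OF H] by (simp add: nonsplit_tori_def)
  moreover have "conj_image h C \<subseteq> H" using C h H unfolding conj_image_def nonsplit_tori_def
    by (auto simp: subset_iff subgroup.m_closed subgroup.m_inv_closed)
  ultimately show ?thesis by (simp add: nonsplit_tori_def)
qed

lemma group_action_nonsplit_tori:
  assumes H: "subgroup H G"
  shows "group_action (G\<lparr>carrier := H\<rparr>) (nonsplit_tori H) (\<lambda>g. restrict (conj_image g) (nonsplit_tori H))"
proof (rule group_action.intro)
  interpret H: group "G\<lparr>carrier := H\<rparr>" using H by (rule subgroup_imp_group)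
  have car: "g \<in> carrier G" if "g \<in> carrier (G\<lparr>carrier := H\<rparr>)" for g
    using H subgroup_carrier that by auto
  have sub: "C \<subseteq> carrier G" if "C \<in> nonsplit_tori H" for C using that CC_sub by (simp add: nonsplit_tori_def)
  have inv_conj_image: "conj_image (inv g) (conj_image g C) = C" if "g \<in> H" "C \<in> nonsplit_tori H" for g C
    using conj_image_mult[of "inv g" g C] conj_image_one sub[OF that(2)] subgroup_carrier[OF H that(1)] by simp
  have B: "restrict (conj_image g) (nonsplit_tori H) \<in> carrier (BijGroup (nonsplit_tori H))" if "g \<in> carrier (G\<lparr>carrier := H\<rparr>)" for g
  proof -
    have g: "g \<in> H" using that by simp
    have "inj_on (conj_image g) (nonsplit_tori H)" by (rule inj_on_inverseI[of _ "conj_image (inv g)"]) (use inv_conj_image g in auto)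
    moreover have "conj_image g ` nonsplit_tori H = nonsplit_tori H"
      by (rule endo_inj_surj[OF finite_nonsplit_tori _ calculation]) (use conj_image_nonsplit_tori[OF H g] in auto)
    ultimately show ?thesis by (simp add: BijGroup_def Bij_def bij_betw_def)
  qed
  have M: "restrict (conj_image (g \<otimes>\<^bsub>G\<lparr>carrier := H\<rparr>\<^esub> h)) (nonsplit_tori H) = restrict (conj_image g) (nonsplit_tori H) \<otimes>\<^bsub>BijGroup (nonsplit_tori H)\<^esub> restrict (conj_image h) (nonsplit_tori H)"
    if "g \<in> carrier (G\<lparr>carrier := H\<rparr>)" "h \<in> carrier (G\<lparr>carrier := H\<rparr>)" for g h
  proof -
    have "restrict (conj_image (g \<otimes> h)) (nonsplit_tori H) = compose (nonsplit_tori H) (restrict (conj_image g) (nonsplit_tori H)) (restrict (conj_image h) (nonsplit_tori H))"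
      using car[OF that(1)] car[OF that(2)] conj_image_nonsplit_tori[OF H] that sub
      by (intro ext) (auto simp: compose_def conj_image_mult restrict_def)
    then show ?thesis using B[OF that(1)] B[OF that(2)] by (simp add: BijGroup_def)
  qed
  show "group_hom (G\<lparr>carrier := H\<rparr>) (BijGroup (nonsplit_tori H)) (\<lambda>g. restrict (conj_image g) (nonsplit_tori H))"
    using B M H.group_axioms group_BijGroup by (simp add: group_hom_def group_hom_axioms_def hom_def)
qed

text \<open>Any two elements of \<open>N\<close> outside \<open>C\<close> have their product in
  \<open>C\<close>, by \<open>CC_normalizer\<close>; so \<open>N\<close> consists of at most two
  cosets of \<open>C\<close>.\<close>

lemma normalizer_card:
  assumes N: "subgroup N G" and C: "C \<in> CC" "C \<subseteq> N" and norm: "\<And>x. x \<in> N \<Longrightarrow> conj_image x C = C"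
  shows "card N = c \<or> card N = 2 * c"
proof -
  have nm: "\<forall>z\<in>C. x \<otimes> z \<otimes> inv x \<in> C" if "x \<in> N" for x
    using norm[OF that] by (auto simp: conj_image_def)
  have "card N \<le> 2 * c"
  proof (cases "N = C")
    case False
    then obtain x where x: "x \<in> N" "x \<notin> C" using C by blast
    have xc: "x \<in> carrier G" using x N subgroup_carrier by blast
    have ix: "inv x \<in> N" "inv x \<in> carrier G - C"
      using x N xc CC_subgroup[OF C(1)] by (auto simp: subgroup.m_inv_closed) (metis inv_inv subgroup.m_inv_closed)
    have "N \<subseteq> C \<union> (\<lambda>z. x \<otimes> z) ` C"
    proof
      fix y assume y: "y \<in> N"
      then have yc: "y \<in> carrier G" using N subgroup_carrier by blast
      show "y \<in> C \<union> (\<lambda>z. x \<otimes> z) ` C"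
      proof (cases "y \<in> C")
        case False
        then have "inv x \<otimes> y \<in> C" using CC_normalizer[OF C(1) ix(2) _ nm[OF ix(1)] nm[OF y]] yc by simp
        moreover have "y = x \<otimes> (inv x \<otimes> y)" using xc yc by (simp add: m_assoc[symmetric])
        ultimately show ?thesis by blast
      qed simp
    qed
    then have "card N \<le> card (C \<union> (\<lambda>z. x \<otimes> z) ` C)"
      using subgroup_finite[OF CC_subgroup[OF C(1)]] by (intro card_mono) auto
    also have "\<dots> \<le> card C + card ((\<lambda>z. x \<otimes> z) ` C)" by (rule card_Un_le)
    also have "\<dots> \<le> card C + card C" using card_image_le subgroup_finite[OF CC_subgroup[OF C(1)]] by simp
    finally show ?thesis using CC_card C by simp
  qed (use CC_card C in simp)
  moreover obtain m where m: "card N = c * m"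
    using subgroup_card_dvd[OF CC_subgroup[OF C(1)] N C(2)] CC_card[OF C(1)] by (auto simp: dvd_def)
  moreover have "card N \<noteq> 0" using subgroup_finite[OF N] subgroup_one[OF N] by auto
  ultimately have "m \<noteq> 0" "m \<le> 2" using c2 by auto
  then have "m = 1 \<or> m = 2" by auto
  then show ?thesis using m by auto
qed

text \<open>Every conjugacy class of nonsplit tori in \<open>H\<close> has size \<open>t\<close> or \<open>2 * t\<close>.\<close>

lemma nonsplit_tori_card_dvd:
  assumes H: "subgroup H G" and card: "card H = 2 * t * c"
  shows "t dvd card (nonsplit_tori H)"
proof -
  interpret A: group_action "G\<lparr>carrier := H\<rparr>" "nonsplit_tori H" "\<lambda>g. restrict (conj_image g) (nonsplit_tori H)"
    by (rule group_action_nonsplit_tori[OF H])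
  let ?O = "orbits (G\<lparr>carrier := H\<rparr>) (nonsplit_tori H) (\<lambda>g. restrict (conj_image g) (nonsplit_tori H))"
  have "t dvd card Y" if Y: "Y \<in> ?O" for Y
  proof -
    obtain C where C: "C \<in> nonsplit_tori H" "Y = orbit (G\<lparr>carrier := H\<rparr>) (\<lambda>g. restrict (conj_image g) (nonsplit_tori H)) C"
      using Y unfolding orbits_def by blast
    let ?N = "stabilizer (G\<lparr>carrier := H\<rparr>) (\<lambda>g. restrict (conj_image g) (nonsplit_tori H)) C"
    have os: "card Y * card ?N = 2 * t * c" using A.orbit_stabilizer_theorem[OF C(1)] C card by (simp add: order_def)
    have N: "?N = {h \<in> H. conj_image h C = C}" using C by (auto simp: stabilizer_def)
    have Ns: "subgroup ?N G"
      using A.stabilizer_subgroup[OF C(1)] H by (rule incl_subgroup[rotated])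
    have "C \<subseteq> ?N"
    proof
      fix z assume z: "z \<in> C"
      then have "z \<in> H" using C by (auto simp: nonsplit_tori_def)
      have "conj_image z C \<subseteq> C" using z C CC_subgroup[of C] by (auto simp: conj_image_def nonsplit_tori_def subgroup.m_closed subgroup.m_inv_closed)
      moreover have "card (conj_image z C) = card C" unfolding conj_image_def
        by (rule card_image[OF inj_conj]) (use z C CC_sub in \<open>auto simp: nonsplit_tori_def\<close>)
      ultimately have "conj_image z C = C" using C subgroup_finite[OF CC_subgroup[of C]] by (simp add: nonsplit_tori_def card_subset_eq)
      then show "z \<in> ?N" using \<open>z \<in> H\<close> N by simp
    qed
    then have "card ?N = c \<or> card ?N = 2 * c" using Ns C N by (intro normalizer_card) (auto simp: nonsplit_tori_def)
    then have "card Y = 2 * t \<or> card Y = t" using os c2 by auto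
    then show ?thesis by auto
  qed
  moreover have "card (nonsplit_tori H) = (\<Sum>Y\<in>?O. card Y)"
    using A.disjoint_sum[OF finite_nonsplit_tori, of "\<lambda>_. 1::nat"] by simp
  ultimately show ?thesis by (simp add: dvd_sum)
qed

section \<open>The number of nonsplit tori\<close>

lemma unipotents_eq: "subgroup H G \<Longrightarrow> unipotents H = (\<Union>a\<in>Om. H \<inter> U a - {\<one>})"
proof -
  assume H: "subgroup H G"
  have "g \<in> unipotents H \<longleftrightarrow> g \<in> (\<Union>a\<in>Om. H \<inter> U a - {\<one>})" for g
  proof
    assume "g \<in> unipotents H"
    then have g: "g \<in> H" "card (Fix g) = 1" by (auto simp: unipotents_def)
    then obtain a where a: "Fix g = {a}" by (auto simp: card_1_singleton_iff)
    then have "a \<in> Om" using Fix_sub by blast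
    moreover have "g \<noteq> \<one>" using g Fix_one card_Om q3 by auto
    ultimately show "g \<in> (\<Union>a\<in>Om. H \<inter> U a - {\<one>})" using g a subgroup_carrier[OF H] by (auto simp: U_def)
  qed (auto simp: unipotents_def U_def)
  then show ?thesis by blast
qed

lemma isolated_carrier: "isolated (carrier G)"
  using subgroup_self CC_sub by (auto simp: isolated_def T_def)

lemma card_u1_carrier: "card (unipotents (carrier G)) = (q + 1) * (q - 1)"
proof -
  have "unipotents (carrier G) = (\<Union>a\<in>Om. U a - {\<one>})" using unipotents_eq[OF subgroup_self] by (auto simp: U_def)
  also have "card \<dots> = card Om * (q - 1)"
    by (rule card_Union_punctured) (use fin_Om U_subgroup U_card in \<open>auto simp: U_def\<close>)
  finally show ?thesis using card_Om by simp
qed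

lemma two_pairs: "2 * card pairs = (q + 1) * q"
  unfolding card_pairs choose_two by simp

text \<open>The size of the family \<open>CC\<close> is forced: the order of the group, the elements
  of split tori and the unipotents are already counted, and each nonsplit torus accounts for
  \<open>c - 1\<close> of the remaining elements.\<close>

lemma two_CC: "2 * card CC = q * (q - 1)"
proof -
  have split_tori: "split_tori (carrier G) = pairs" "nonsplit_tori (carrier G) = CC" using CC_sub by (auto simp: split_tori_def nonsplit_tori_def T_def)
  \<comment> \<open>This substitution removes the truncated subtractions. The factor cancelled at
    the end is \<open>c - 1\<close>, equal to \<open>s + 3\<close> for \<open>d = 1\<close> and to
    \<open>s + 2\<close> for \<open>d = 2\<close>.\<close>
  obtain s where s: "t = s + 2" using t2 by (metis add.commute le_Suc_ex)
  have *: "(q + 1) * (q * t) = 1 + card pairs * (t - 1) + card CC * (c - 1) + (q + 1) * (q - 1)"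
    using card_isolated[OF isolated_carrier] card_G card_u1_carrier split_tori by simp
  then have eq: "2 * ((q + 1) * (q * t)) = 2 + (q + 1) * q * (t - 1) + 2 * card CC * (c - 1) + 2 * ((q + 1) * (q - 1))"
  proof -
    have "2 * (card pairs * (t - 1)) = (q + 1) * q * (t - 1)" by (simp only: two_pairs[symmetric] mult.assoc)
    moreover have "2 * card CC * (c - 1) = 2 * (card CC * (c - 1))" by (rule mult.assoc)
    ultimately show ?thesis using * by linarith
  qed
  from d12 show ?thesis
  proof
    assume d: "d = 1"
    then have "q = s + 3" "c = s + 4" using dt dc s by auto
    then have "(s + 3) * (2 * card CC) = (s + 3) * ((s + 3) * (s + 2))" using eq s by (simp add: algebra_simps)
    then show ?thesis using \<open>q = s + 3\<close> by simp
  next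
    assume d: "d = 2"
    then have "q = 2 * s + 5" "c = s + 3" using dt dc s by auto
    then have "(s + 2) * (2 * card CC) = (s + 2) * ((2 * s + 5) * (2 * s + 4))" using eq s by (simp add: algebra_simps)
    then have "2 * card CC = (2 * s + 5) * (2 * s + 4)" by (subst (asm) mult_left_cancel) auto
    then show ?thesis using \<open>q = 2 * s + 5\<close> by simp
  qed
qed

section \<open>Isolated subgroups\<close>

definition borel_free where "borel_free H \<longleftrightarrow> isolated H \<and> (\<forall>a\<in>Om. \<not> T {a} \<subseteq> H)"

lemma isolated_subgroup: "isolated H \<Longrightarrow> subgroup H G"
  by (simp add: isolated_def)

text \<open>Two split tori with a common point would force the Borel subgroup of that point into
  \<open>H\<close>. The pairs are thus disjoint, which caps their number at half of
  \<open>q + 1\<close>.\<close>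

lemma split_tori_disjoint: assumes "borel_free H" "p \<in> split_tori H" "p' \<in> split_tori H" "p \<noteq> p'" shows "p \<inter> p' = {}"
proof (rule ccontr)
  assume "p \<inter> p' \<noteq> {}"
  then obtain a where a: "a \<in> p" "a \<in> p'" by blast
  have "T {a} \<subseteq> H"
    by (rule two_tori_borel[of H a p p']) (use assms a pairs_sub in \<open>auto simp: split_tori_def borel_free_def isolated_def\<close>)
  then show False using assms a pairs_sub by (auto simp: split_tori_def borel_free_def)
qed

lemma card_Union_split_tori: assumes "borel_free H" shows "card (\<Union>(split_tori H)) = 2 * card (split_tori H)"
proof -
  have "card (\<Union>(split_tori H)) = (\<Sum>p\<in>split_tori H. card p)"
    using split_tori_disjoint[OF assms] finite_subset[OF pairs_sub fin_Om]
    by (intro card_Union_disjoint) (auto simp: pairwise_def disjnt_def split_tori_def)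
  also have "\<dots> = (\<Sum>p\<in>split_tori H. 2)" by (rule sum.cong) (auto simp: split_tori_def pairs_def)
  finally show ?thesis by simp
qed

lemma split_tori_le: assumes "borel_free H" shows "2 * card (split_tori H) \<le> q + 1"
proof -
  have "card (\<Union>(split_tori H)) \<le> card Om" by (rule card_mono[OF fin_Om]) (auto simp: split_tori_def pairs_def)
  then show ?thesis using card_Union_split_tori[OF assms] card_Om by simp
qed

lemma split_tori_U: assumes "borel_free H" "a \<in> \<Union>(split_tori H)" shows "H \<inter> U a = {\<one>}"
proof (rule ccontr)
  obtain p where p: "p \<in> pairs" "a \<in> p" "T p \<subseteq> H" using assms by (auto simp: split_tori_def)
  have a: "a \<in> Om" using p pairs_sub by blast
  assume "H \<inter> U a \<noteq> {\<one>}"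
  then have "T {a} \<subseteq> H" using U_sub_borel[OF _ a p] assms by (simp add: borel_free_def isolated_def)
  then show False using assms a by (simp add: borel_free_def)
qed

text \<open>Here the pairs exhaust the line, and at a point of such a pair \<open>H\<close> has no
  unipotents.\<close>

lemma split_tori_full: assumes "borel_free H" "2 * card (split_tori H) = q + 1" shows "unipotents H = {}"
proof -
  have "\<Union>(split_tori H) \<subseteq> Om" by (auto simp: split_tori_def pairs_def)
  then have "\<Union>(split_tori H) = Om"
    using card_Union_split_tori[OF assms(1)] assms(2) card_Om fin_Om by (intro card_subset_eq) auto
  then have "H \<inter> U a = {\<one>}" if "a \<in> Om" for a using split_tori_U[OF assms(1)] that by blast
  then show ?thesis using unipotents_eq[of H] assms(1) by (auto simp: borel_free_def isolated_def)
qed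

lemma split_tori_act: assumes "subgroup H G" "h \<in> H" "p \<in> split_tori H" shows "act h ` p \<in> split_tori H"
  using assms T_conj_sub pairs_act subgroup_carrier pairs_sub by (simp add: split_tori_def)

text \<open>\<open>H\<close> permutes its own split tori, so the set of points on their pairs is
  invariant; under a transitive action it is the whole line as soon as it is nonempty.\<close>

lemma one_orbit_full: assumes H: "borel_free H" and k: "card (orb H ` Om) = 1" and s: "split_tori H \<noteq> {}"
  shows "2 * card (split_tori H) = q + 1"
proof -
  have Hs: "subgroup H G" using H by (simp add: borel_free_def isolated_def)
  obtain p where p: "p \<in> split_tori H" using s by blast
  then obtain a where a: "a \<in> p" "a \<in> Om" unfolding split_tori_def by (blast elim: pairsE)
  have "Om \<subseteq> \<Union>(split_tori H)"
  proof
    fix x assume x: "x \<in> Om"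
    obtain Y where "orb H ` Om = {Y}" using k by (auto simp: card_1_singleton_iff)
    then have "orb H x = orb H a" using a x by (metis imageI singletonD)
    then have "x \<in> orb H a" using orb_self[OF Hs x] by simp
    then obtain h where "h \<in> H" "x = act h a" by (auto simp: orb_def)
    then show "x \<in> \<Union>(split_tori H)" using split_tori_act[OF Hs _ p] a by blast
  qed
  moreover have "\<Union>(split_tori H) \<subseteq> Om" by (auto simp: split_tori_def pairs_def)
  ultimately show ?thesis using card_Union_split_tori[OF H] card_Om by simp
qed

lemma orbits_pos: "card (orb H ` Om) \<noteq> 0"
  using fin_Om card_Om by auto

lemma C_semireg: assumes "C \<in> CC" "x \<in> Om" shows "C \<inter> T {x} = {\<one>}"
proof -
  have "g = \<one>" if "g \<in> C" "act g x = x" for g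
    using CC_Fix[OF assms(1) that(1)] that assms(2) by (auto simp: Fix_def)
  moreover have "\<one> \<in> C \<inter> T {x}" using subgroup_one[OF CC_subgroup[OF assms(1)]] assms(2) by (simp add: T_def act_one)
  ultimately show ?thesis by (auto simp: T_def)
qed

text \<open>A nonsplit torus acts semiregularly, so each orbit has at least \<open>c\<close> points,
  out of \<open>d * c\<close> in all.\<close>

lemma nonsplit_tori_orbits: assumes H: "subgroup H G" and C: "C \<in> nonsplit_tori H" shows "card (orb H ` Om) \<le> d"
proof -
  have C': "C \<in> CC" "C \<subseteq> H" using C by (auto simp: nonsplit_tori_def)
  have "card (\<Union>(orb H ` Om)) = (\<Sum>Y\<in>orb H ` Om. card Y)"
  proof (rule card_Union_disjoint)
    show "pairwise disjnt (orb H ` Om)" using orb_disjoint[OF H] by (auto simp: pairwise_def disjnt_def)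
    show "\<And>A. A \<in> orb H ` Om \<Longrightarrow> finite A" using orb_sub[OF H] fin_Om finite_subset by blast
  qed
  moreover have "\<dots> \<ge> (\<Sum>Y\<in>orb H ` Om. c)"
  proof (rule sum_mono)
    fix Y assume "Y \<in> orb H ` Om"
    then obtain x where x: "x \<in> Om" "Y = orb H x" by blast
    show "c \<le> card Y" using orb_ge[OF CC_subgroup[OF C'(1)] C'(2) H x(1) C_semireg[OF C'(1) x(1)]] CC_card[OF C'(1)] x by simp
  qed
  moreover have "card (\<Union>(orb H ` Om)) \<le> card Om" using orb_sub[OF H] fin_Om by (intro card_mono) auto
  ultimately have "card (orb H ` Om) * c \<le> d * c" using card_Om dc by simp
  then show ?thesis using c2 by simp
qed

lemma nonsplit_tori_one_normal: assumes H: "subgroup H G" and n: "nonsplit_tori H = {C}" and h: "h \<in> H" and z: "z \<in> C"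
  shows "h \<otimes> z \<otimes> inv h \<in> C"
proof -
  have "conj_image h C = C" using conj_image_nonsplit_tori[OF H h, of C] n by auto
  then show ?thesis using z by (auto simp: conj_image_def)
qed

text \<open>
  Burnside's lemma compared with the element count. For \<open>d = 2\<close> it leaves one numerical possibility,
  \<open>card H = 2 * t * c\<close> with \<open>t + 2\<close> nonsplit tori, which the class sizes of these tori exclude.
\<close>

lemma nonsplit_case:
  assumes H: "borel_free H" and n: "nonsplit_tori H \<noteq> {}"
  shows "card (nonsplit_tori H) = 1 \<and> split_tori H = {}"
proof -
  have iso: "isolated H" and Hs: "subgroup H G" using H by (auto simp: borel_free_def isolated_def)
  define s where "s = card (split_tori H)"
  define m where "m = card (nonsplit_tori H)"
  define u where "u = card (unipotents H)"
  define k where "k = card (orb H ` Om)"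
  have m0: "m \<noteq> 0" using n finite_nonsplit_tori by (simp add: m_def)
  have k: "k \<le> d" "k \<noteq> 0" using nonsplit_tori_orbits[OF Hs] n orbits_pos by (auto simp: k_def)
  have hc: "card H = 1 + s * (t - 1) + m * (c - 1) + u" using card_isolated[OF iso] by (simp add: s_def m_def u_def)
  have b: "k * card H = q + 1 + 2 * s * (t - 1) + u" using burnside_isolated[OF iso] by (simp add: s_def k_def u_def)
  obtain r where r: "t = r + 2" using t2 by (metis add.commute le_Suc_ex)
  have full: "2 * s = q + 1 \<and> u = 0" if "k = 1" "s \<noteq> 0"
  proof -
    have "split_tori H \<noteq> {}" using that(2) by (auto simp: s_def)
    then show ?thesis using one_orbit_full[OF H] split_tori_full[OF H] that(1) by (auto simp: k_def s_def u_def)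
  qed
  have s0_iff: "s = 0 \<longleftrightarrow> split_tori H = {}" using finite_split_tori by (simp add: s_def)
  show ?thesis
  proof (cases "d = 1")
    case True
    then have q: "q = r + 3" "c = r + 4" "k = 1" using dt dc r k by auto
    \<comment> \<open>With a single orbit the unipotents cancel and
      \<open>m * (c - 1) = q + s * (t - 1)\<close> remains; for \<open>d = 1\<close> one has
      \<open>c - 1 = q\<close>.\<close>
    have eq: "m * (r + 3) = (r + 3) + s * (r + 1)" using b hc q r by (simp add: algebra_simps)
    show ?thesis
    proof (cases "s = 0")
      case True then show ?thesis using eq s0_iff by (auto simp: m_def)
    next
      case False
      then have "2 * s = r + 4" using full q by simp
      then have "m * (r + 3) + 1 = s * (r + 3)" using eq by (simp add: algebra_simps)
      then have "(r + 3) dvd 1" by (metis dvd_add_right_iff dvd_triv_right)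
      then show ?thesis by simp
    qed
  next
    case False
    then have d2: "d = 2" using d12 by simp
    then have q: "q = 2 * r + 5" "c = r + 3" "r \<ge> 1" using dt dc r dt3 by auto
    have "k = 1 \<or> k = 2" using k d2 by auto
    then show ?thesis
    proof
      assume k1: "k = 1"
      have eq: "m * (r + 2) = 2 * r + 5 + s * (r + 1)" using b hc q r k1 by (simp add: algebra_simps)
      show ?thesis
      proof (cases "s = 0")
        case True
        then have "m * (r + 2) = 2 * (r + 2) + 1" using eq by simp
        then have "(r + 2) dvd 1" by (metis dvd_add_right_iff dvd_triv_right)
        then show ?thesis by simp
      next
        case False
        then have su: "s = r + 3" "u = 0" using full[OF k1] q by auto
        then have "m * (r + 2) = (r + 4) * (r + 2)" using eq by (simp add: algebra_simps)
        then have m: "m = r + 4" by (subst (asm) mult_right_cancel) auto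
        \<comment> \<open>The surviving numerical case. For \<open>r = 0\<close>, that is
          \<open>q = 5\<close>, it is realized by the alternating group of degree 4; for
          \<open>r \<ge> 1\<close> the number \<open>r + 4\<close> of nonsplit tori is no multiple
          of \<open>t = r + 2\<close>.\<close>
        have "card H = 2 * t * c" using hc su m r q by (simp add: algebra_simps)
        then have "t dvd m" using nonsplit_tori_card_dvd[OF Hs] by (simp add: m_def)
        moreover have "m = (r + 2) + 2" using m by simp
        ultimately have "(r + 2) dvd (r + 2) + 2" using r by (simp only:)
        then have "(r + 2) dvd 2" by (metis dvd_add_right_iff dvd_refl)
        then have "r + 2 \<le> 2" by (rule dvd_imp_le) simp
        then show ?thesis using q by simp
      qed
    next
      assume k2: "k = 2"
      \<comment> \<open>With two orbits it is the split tori that cancel, so the count yields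
        \<open>m = 1\<close> but says nothing about \<open>s\<close>.\<close>
      have eq: "2 * m * (r + 2) + u = 2 * (r + 2)" using b hc q r k2 by (simp add: algebra_simps)
      have m1: "m = 1"
      proof (rule ccontr)
        assume "m \<noteq> 1"
        then have "2 * 2 * (r + 2) \<le> 2 * m * (r + 2)" using m0 by (intro mult_le_mono) auto
        then show False using eq by simp
      qed
      then obtain C where C: "nonsplit_tori H = {C}" by (auto simp: m_def card_1_singleton_iff)
      then have CCC: "C \<in> CC" by (auto simp: nonsplit_tori_def)
      \<comment> \<open>The only nonsplit torus \<open>C\<close> is normal in \<open>H\<close>, so
        by \<open>CC_normalizer\<close> any two nontrivial elements of a split torus would multiply
        into \<open>C\<close>, hence to the identity. A split torus would then have at most two
        elements, against \<open>t \<ge> 3\<close>.\<close>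
      have "split_tori H = {}"
      proof (rule ccontr)
        assume "split_tori H \<noteq> {}"
        then obtain p where p: "p \<in> pairs" "T p \<subseteq> H" by (auto simp: split_tori_def)
        have TC: "T p \<inter> C = {\<one>}"
          using T_Fix[OF p(1)] CC_Fix[OF CCC] p(1) subgroup_one[OF T_subgroup[OF pairs_sub[OF p(1)]]]
            subgroup_one[OF CC_subgroup[OF CCC]] by (auto elim!: pairsE)
        have prod: "x \<otimes> y = \<one>" if "x \<in> T p - {\<one>}" "y \<in> T p - {\<one>}" for x y
        proof -
          have "x \<in> carrier G - C" "y \<in> carrier G - C" using that TC by (auto simp: T_def)
          then have "x \<otimes> y \<in> C"
            using CC_normalizer[OF CCC] nonsplit_tori_one_normal[OF Hs C] that p by (meson DiffD1 subsetD)
          moreover have "x \<otimes> y \<in> T p" using that T_subgroup[OF pairs_sub[OF p(1)]] by (simp add: subgroup.m_closed)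
          ultimately show ?thesis using TC by blast
        qed
        obtain x where x: "x \<in> T p" "x \<noteq> \<one>" using T_nontriv[OF p(1)] by blast
        have "T p \<subseteq> {\<one>, x}"
        proof
          fix y assume y: "y \<in> T p"
          have "y = x" if "y \<noteq> \<one>"
          proof -
            have "x \<in> carrier G" "y \<in> carrier G" using x y by (auto simp: T_def)
            moreover have "x \<otimes> x = \<one>" "y \<otimes> x = \<one>" using prod x y that by auto
            ultimately show ?thesis using inv_equality[of x x] inv_equality[of y x] by simp
          qed
          then show "y \<in> {\<one>, x}" by blast
        qed
        then have "card (T p) \<le> card {\<one>, x}" by (intro card_mono) auto
        also have "\<dots> \<le> 2" by (simp add: card_insert_if)
        finally show False using T_card[OF p(1)] dt3 d2 by simp
      qed
      then show ?thesis using m1 by (simp add: m_def)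
    qed
  qed
qed

text \<open>Two or more split tori are impossible for any number \<open>k\<close> of orbits:
  \<open>k = 1\<close> and \<open>k = 3\<close> fail numerically, \<open>k = 2\<close> by
  divisibility by \<open>t\<close>, and from \<open>k = 4\<close> on two tori already contribute
  more than \<open>q\<close> allows.\<close>

lemma split_case:
  assumes H: "borel_free H" and n: "nonsplit_tori H = {}" and s: "split_tori H \<noteq> {}"
  shows "card (split_tori H) = 1"
proof (rule ccontr)
  assume ne1: "card (split_tori H) \<noteq> 1"
  have iso: "isolated H" and Hs: "subgroup H G" using H by (auto simp: borel_free_def isolated_def)
  define s where "s = card (split_tori H)"
  define u where "u = card (unipotents H)"
  define k where "k = card (orb H ` Om)"
  have "s \<noteq> 0" using \<open>split_tori H \<noteq> {}\<close> finite_split_tori by (simp add: s_def)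
  then have s2: "s \<ge> 2" using ne1 by (simp add: s_def)
  have hc: "card H = 1 + s * (t - 1) + u" using card_isolated[OF iso] n by (simp add: s_def u_def)
  have b: "k * card H = q + 1 + 2 * s * (t - 1) + u" using burnside_isolated[OF iso] by (simp add: s_def k_def u_def)
  obtain r where r: "t = r + 2" using t2 by (metis add.commute le_Suc_ex)
  have full: "u = 0" if "2 * s = q + 1" using split_tori_full[OF H] that by (simp add: s_def u_def)
  have "k \<noteq> 0" using orbits_pos by (simp add: k_def)
  moreover have "k \<noteq> 1" using b hc q3 by auto
  moreover have "k \<noteq> 2"
  proof
    assume k2: "k = 2"
    then have u: "u = q - 1" using b hc q3 by (simp add: algebra_simps)
    obtain p where p: "p \<in> pairs" "T p \<subseteq> H" using s by (auto simp: split_tori_def)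
    have "t dvd card H" using subgroup_card_dvd[OF T_subgroup[OF pairs_sub[OF p(1)]] Hs p(2)] T_card[OF p(1)] by simp
    \<comment> \<open>Adding \<open>s - 1\<close> turns \<open>card H\<close> into a multiple of
      \<open>t\<close>, and \<open>t\<close> divides \<open>card H\<close> by Lagrange. Hence
      \<open>s \<ge> t + 1\<close>, which reaches the cap on disjoint pairs, where \<open>H\<close>
      has no unipotents; but \<open>u = q - 1\<close>.\<close>
    moreover define e where "e = s - 1"
    then have e: "s = e + 1" "e \<ge> 1" using s2 by auto
    have "card H + e = (s + d) * t"
      using hc u dt r e by (simp add: algebra_simps)
    then have "t dvd card H + e" by simp
    ultimately have "t dvd e" using dvd_add_right_iff by blast
    then have "t \<le> e" using e by (intro dvd_imp_le) auto
    then have "s \<ge> t + 1" using e by simp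
    then have "2 * s = q + 1" using split_tori_le[OF H] dt d12 t2 by (auto simp: s_def)
    then show False using full u q3 by simp
  qed
  moreover have "k \<noteq> 3"
  proof
    assume "k = 3"
    \<comment> \<open>For \<open>d = 1\<close> two tori already exceed \<open>q\<close>. For
      \<open>d = 2\<close> two tori violate parity, and three or more exceed \<open>q\<close>
      because \<open>t \<ge> 3\<close>.\<close>
    then have eq: "s * (r + 1) + 2 * u + 2 = q" using b hc r by (simp add: algebra_simps)
    show False
    proof (cases "d = 1")
      case True
      have "2 * (r + 1) \<le> s * (r + 1)" using s2 by (intro mult_le_mono) auto
      then show False using eq dt r True by simp
    next
      case False
      then have d2: "q = 2 * r + 5" "r \<ge> 1" using d12 dt dt3 r by auto
      show False
      proof (cases "s = 2")
        case True then show False using eq d2 by presburger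
      next
        case False
        then have "3 * (r + 1) \<le> s * (r + 1)" using s2 by (intro mult_le_mono) auto
        then show False using eq d2 by simp
      qed
    qed
  qed
  ultimately have "k \<ge> 4" by linarith
  then have "4 * card H \<le> q + 1 + 2 * s * (t - 1) + u" unfolding b[symmetric] by (intro mult_le_mono) auto
  then have "2 * (s * (r + 1)) + 3 \<le> q" using hc r by (simp add: algebra_simps)
  moreover have "2 * (r + 1) \<le> s * (r + 1)" using s2 by (intro mult_le_mono) auto
  ultimately show False using dt r d12 by auto
qed

text \<open>All nontrivial elements of \<open>H\<close> are unipotent, and Burnside's lemma becomes
  \<open>(k - 1) * card H = q\<close> for \<open>k\<close> orbits.\<close>

lemma torus_free_case:
  assumes iso: "isolated H" and n: "nonsplit_tori H = {}" and s: "split_tori H = {}"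
  shows "card H \<le> q"
proof -
  define k where "k = card (orb H ` Om)"
  have hc: "card H = 1 + card (unipotents H)" using card_isolated[OF iso] n s by simp
  have "k * card H = q + 1 + card (unipotents H)" using burnside_isolated[OF iso] s by (simp add: k_def)
  then have *: "k * card H = q + card H" using hc by simp
  have "k \<noteq> 0" by (rule notI) (use * q3 in simp)
  moreover have "k \<noteq> 1" by (rule notI) (use * q3 in simp)
  ultimately obtain e where "k = Suc (Suc e)" by (metis One_nat_def not0_implies_Suc)
  then show ?thesis using * by simp
qed

lemma torus_count: assumes "borel_free H" shows "card (split_tori H) + card (nonsplit_tori H) \<le> 1"
  using nonsplit_case[OF assms] split_case[OF assms] by (cases "nonsplit_tori H = {}"; cases "split_tori H = {}") auto

section \<open>Dihedral subgroups for even q\<close>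

text \<open>The subgroups below occur only for even \<open>q\<close>: then the involutions of a dihedral group are unipotent.\<close>

definition dihedral where
  "dihedral H K \<longleftrightarrow> borel_free H \<and> subgroup K G \<and> K \<subset> H \<and>
     ((\<exists>p. split_tori H = {p} \<and> nonsplit_tori H = {} \<and> K = T p) \<or> split_tori H = {} \<and> nonsplit_tori H = {K})"

text \<open>A unipotent lies in no torus, so the only torus of \<open>H\<close> is a proper subgroup
  of it.\<close>

lemma dihedral_exists:
  assumes H: "borel_free H" and n: "card (split_tori H) + card (nonsplit_tori H) = 1" and u: "unipotents H \<noteq> {}"
  shows "\<exists>K. dihedral H K"
proof -
  obtain w where w: "w \<in> H" "card (Fix w) = 1" using u by (auto simp: unipotents_def)
  have "card (split_tori H) = 1 \<and> card (nonsplit_tori H) = 0 \<or> card (split_tori H) = 0 \<and> card (nonsplit_tori H) = 1" using n by linarith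
  then consider p where "split_tori H = {p}" "nonsplit_tori H = {}" | C where "split_tori H = {}" "nonsplit_tori H = {C}"
    using finite_split_tori finite_nonsplit_tori by (auto simp: card_1_singleton_iff)
  then show ?thesis
  proof cases
    case 1
    then have p: "p \<in> pairs" "T p \<subseteq> H" by (auto simp: split_tori_def)
    have "w \<noteq> \<one>" using w Fix_one card_Om q3 by auto
    then have "w \<notin> T p" using T_Fix[OF p(1)] w p by (auto simp: pairs_def)
    then have "dihedral H (T p)" using 1 p w H T_subgroup[OF pairs_sub[OF p(1)]] by (auto simp: dihedral_def)
    then show ?thesis by blast
  next
    case 2
    then have C: "C \<in> CC" "C \<subseteq> H" by (auto simp: nonsplit_tori_def)
    have "w \<noteq> \<one>" using w Fix_one card_Om q3 by auto
    then have "w \<notin> C" using CC_Fix[OF C(1)] w by auto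
    then have "dihedral H C" using 2 C w H CC_subgroup[OF C(1)] by (auto simp: dihedral_def)
    then show ?thesis by blast
  qed
qed

lemma dihedral_subgroup: "dihedral H K \<Longrightarrow> subgroup H G"
  by (simp add: dihedral_def borel_free_def isolated_def)

lemma dihedral_unip: assumes D: "dihedral H K" and g: "g \<in> H - K"
  shows "card (Fix g) = 1"
proof -
  have iso: "isolated H" and Hs: "subgroup H G" and K: "subgroup K G"
    using D by (auto simp: dihedral_def borel_free_def isolated_def)
  have g1: "g \<noteq> \<one>" using g subgroup_one[OF K] by blast
  have gc: "g \<in> carrier G" using g subgroup_carrier[OF Hs] by blast
  have "card (Fix g) \<noteq> 2"
  proof
    assume "card (Fix g) = 2"
    then have "g \<in> (\<Union>p\<in>split_tori H. T p - {\<one>})" using isolated_H2[OF iso] g by blast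
    then show False using D g by (auto simp: dihedral_def)
  qed
  moreover have "card (Fix g) \<noteq> 0"
  proof
    assume "card (Fix g) = 0"
    then have "g \<in> (\<Union>C\<in>nonsplit_tori H. C - {\<one>})" using isolated_H0[OF iso] g by blast
    then show False using D g by (auto simp: dihedral_def)
  qed
  ultimately show ?thesis using Fix_le2[OF gc g1] by linarith
qed

lemma dihedral_pair: assumes D: "dihedral H K" and p: "split_tori H = {p}" and h: "h \<in> H"
  shows "act h ` p = p"
  using split_tori_act[OF dihedral_subgroup[OF D] h, of p] unfolding p by simp

lemma dihedral_swap: assumes D: "dihedral H K" and p: "split_tori H = {{a, b}}" "a \<noteq> b" and g: "g \<in> H - K"
  shows "act g a = b \<and> act g b = a"
proof -
  have Hs: "subgroup H G" using D by (rule dihedral_subgroup)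
  have pp: "{a, b} \<in> pairs" using p by (auto simp: split_tori_def)
  have im: "{act g a, act g b} = {a, b}" using dihedral_pair[OF D p(1)] g by auto
  have "g \<notin> T {a, b}" using D p g by (auto simp: dihedral_def)
  then have "\<not> (act g a = a \<and> act g b = b)" using g subgroup_carrier[OF Hs] by (auto simp: T_def)
  then show ?thesis using im p(2) by (auto simp: doubleton_eq_iff)
qed

text \<open>Says that \<open>K\<close> has index 2. In the split case both elements exchange the two
  points of the pair; in the nonsplit case \<open>K\<close> is normal in \<open>H\<close> and
  \<open>CC_normalizer\<close> applies.\<close>

lemma dihedral_prod: assumes D: "dihedral H K" and g: "g \<in> H - K" and h: "h \<in> H - K"
  shows "g \<otimes> h \<in> K"
proof -
  have Hs: "subgroup H G" using D by (rule dihedral_subgroup)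
  have gc: "g \<in> carrier G" "h \<in> carrier G" using g h subgroup_carrier[OF Hs] by auto
  from D consider p where "split_tori H = {p}" "K = T p" | "nonsplit_tori H = {K}" by (auto simp: dihedral_def)
  then show ?thesis
  proof cases
    case 1
    then have pp: "p \<in> pairs" by (auto simp: split_tori_def)
    then obtain a b where p: "p = {a, b}" "a \<noteq> b" "a \<in> Om" "b \<in> Om" by (rule pairsE)
    then show ?thesis
      using dihedral_swap[OF D _ p(2) g] dihedral_swap[OF D _ p(2) h] 1 gc by (auto simp: T_def act_mult)
  next
    case 2
    then show ?thesis using CC_normalizer[of K g h] nonsplit_tori_one_normal[OF Hs 2] g h gc by (auto simp: nonsplit_tori_def)
  qed
qed

lemma dihedral_K_unip: assumes D: "dihedral H K" and a: "a \<in> Om" shows "K \<inter> U a = {\<one>}"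
proof -
  have K: "subgroup K G" using D by (simp add: dihedral_def)
  have "g = \<one>" if g: "g \<in> K" "g \<in> U a" for g
  proof (rule ccontr)
    assume g1: "g \<noteq> \<one>"
    then have F: "Fix g = {a}" using g by (simp add: U_def)
    from D consider p where "split_tori H = {p}" "K = T p" | "nonsplit_tori H = {K}" by (auto simp: dihedral_def)
    then show False
    proof cases
      case 1
      then have "p \<in> pairs" by (auto simp: split_tori_def)
      then show False using T_Fix[of p g] g g1 F 1 by (auto simp: pairs_def)
    next
      case 2
      then show False using CC_Fix[of K g] g g1 F by (auto simp: nonsplit_tori_def)
    qed
  qed
  then show ?thesis using subgroup_one[OF K] subgroup_one[OF U_subgroup[OF a]] by blast
qed

lemma dihedral_in_U: assumes D: "dihedral H K" and g: "g \<in> H - K"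
  obtains a where "a \<in> Om" "g \<in> U a" "g \<noteq> \<one>" "Fix g = {a}"
proof -
  have gc: "g \<in> carrier G" using g subgroup_carrier[OF dihedral_subgroup[OF D]] by blast
  obtain a where a: "Fix g = {a}" using dihedral_unip[OF D g] by (auto simp: card_1_singleton_iff)
  moreover have "a \<in> Om" using a Fix_sub by blast
  moreover have "g \<noteq> \<one>" using g D subgroup_one by (auto simp: dihedral_def)
  ultimately show ?thesis using that gc by (simp add: U_def)
qed

text \<open>The element lies in some radical, so its square lies in that radical as well as in
  \<open>K\<close>, and these meet trivially.\<close>

lemma dihedral_invol: assumes D: "dihedral H K" and g: "g \<in> H - K" shows "g \<otimes> g = \<one>"
proof -
  obtain a where a: "a \<in> Om" "g \<in> U a" using dihedral_in_U[OF D g] .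
  have "g \<otimes> g \<in> K \<inter> U a" using dihedral_prod[OF D g g] a U_subgroup by (simp add: subgroup.m_closed)
  then show ?thesis using dihedral_K_unip[OF D a(1)] by blast
qed

text \<open>An element outside \<open>K\<close> is an involution inside a radical of order
  \<open>q\<close>, so \<open>q\<close> is even by Lagrange; \<open>d * t + 1 = q\<close> then
  excludes \<open>d = 2\<close>.\<close>

lemma dihedral_even: assumes D: "dihedral H K" shows "even q \<and> d = 1"
proof -
  obtain g where g: "g \<in> H - K" using D by (auto simp: dihedral_def)
  obtain a where a: "a \<in> Om" "g \<in> U a" "g \<noteq> \<one>" using dihedral_in_U[OF D g] .
  have gc: "g \<in> carrier G" using a by (simp add: U_def)
  have gg: "g \<otimes> g = \<one>" using dihedral_invol[OF D g] .
  have "subgroup {\<one>, g} G"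
  proof (rule subgroupI)
    show "inv x \<in> {\<one>, g}" if "x \<in> {\<one>, g}" for x using that gg gc inv_equality[of g g] by auto
  qed (use gc gg in auto)
  then have "card {\<one>, g} dvd card (U a)"
    using subgroup_card_dvd[of "{\<one>, g}" "U a"] U_subgroup[OF a(1)] a subgroup_one[OF U_subgroup[OF a(1)]] by auto
  moreover have "card {\<one>, g} = 2" using a(3) by (simp add: numeral_2_eq_2)
  ultimately have "even q" using U_card[OF a(1)] by simp
  then show ?thesis using dt d12 by auto
qed

lemma reg_orbit: assumes K: "subgroup K G" and S: "S \<subseteq> Om" "card S = card K"
    and act: "\<And>g x. g \<in> K \<Longrightarrow> x \<in> S \<Longrightarrow> act g x \<in> S" and free: "\<And>x. x \<in> S \<Longrightarrow> K \<inter> T {x} = {\<one>}"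
    and x: "x \<in> S" and y: "y \<in> S"
  shows "\<exists>g\<in>K. act g x = y"
proof -
  have "card (orb K x) = card K" using orbit_stab[OF K, of x] free[OF x] x S by auto
  then have "orb K x = S" using S act x fin_Om
    by (intro card_subset_eq) (auto simp: orb_def intro: finite_subset)
  then show ?thesis using y by (auto simp: orb_def)
qed

text \<open>For \<open>d = 1\<close> the torus \<open>K\<close> is regular on these points: there
  are \<open>q - 1 = t\<close> of them off a pair, or \<open>q + 1 = c\<close> on the whole line
  when \<open>K\<close> is nonsplit. A suitable product \<open>g \<otimes> z\<close> with
  \<open>g\<close> outside \<open>K\<close> therefore takes \<open>x\<close> to \<open>y\<close>
  and, being an involution, takes \<open>y\<close> back. The case \<open>x = y\<close> is included
  on purpose.\<close>

lemma dihedral_trans: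
  assumes D: "dihedral H K" and x: "x \<in> Om - \<Union>(split_tori H)" and y: "y \<in> Om - \<Union>(split_tori H)"
  shows "\<exists>w\<in>H - K. act w x = y \<and> act w y = x"
proof -
  have Hs: "subgroup H G" and K: "subgroup K G" "K \<subset> H" using D dihedral_subgroup by (auto simp: dihedral_def)
  obtain g where g: "g \<in> H - K" using K by blast
  have gc: "g \<in> carrier G" using g subgroup_carrier[OF Hs] by blast
  have d1: "d = 1" using dihedral_even[OF D] by simp
  define S where "S = Om - \<Union>(split_tori H)"
  have Sact: "act h z \<in> S" if "h \<in> H" "z \<in> S" for h z
  proof -
    have hc: "h \<in> carrier G" using that subgroup_carrier[OF Hs] by blast
    have "act h z \<notin> \<Union>(split_tori H)"
    proof
      assume "act h z \<in> \<Union>(split_tori H)"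
      then obtain p where p: "p \<in> split_tori H" "act h z \<in> p" by blast
      have "act (inv h) ` p \<in> split_tori H" using split_tori_act[OF Hs _ p(1), of "inv h"] that Hs by (simp add: subgroup.m_inv_closed)
      moreover have "z \<in> act (inv h) ` p" using p(2) act_inv[OF hc, of z] that by (force simp: S_def)
      ultimately show False using that by (auto simp: S_def)
    qed
    then show ?thesis using act_closed hc that by (simp add: S_def)
  qed
  have "\<exists>z\<in>K. act z x = act (inv g) y"
  proof (rule reg_orbit[OF K(1), of S])
    from D consider p where "split_tori H = {p}" "K = T p" | "split_tori H = {}" "nonsplit_tori H = {K}" by (auto simp: dihedral_def)
    then have "card S = card K \<and> (\<forall>z\<in>S. K \<inter> T {z} = {\<one>})"
    proof cases
      case 1
      then have pp: "p \<in> pairs" by (auto simp: split_tori_def)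
      have "card S = q + 1 - 2" using 1 pp fin_Om card_Om finite_subset[of p Om]
        by (auto simp: S_def pairs_def card_Diff_subset)
      moreover have "T p \<inter> T {z} = {\<one>}" if "z \<in> S" for z
      proof -
        have "h = \<one>" if "h \<in> T p" "h \<in> T {z}" for h
        proof (rule ccontr)
          assume "h \<noteq> \<one>"
          then have "Fix h = p" using T_Fix pp that by blast
          moreover have "z \<in> Fix h" using that \<open>z \<in> S\<close> by (auto simp: T_def Fix_def S_def)
          ultimately show False using \<open>z \<in> S\<close> 1 by (auto simp: S_def)
        qed
        moreover have "\<one> \<in> T p" "\<one> \<in> T {z}"
          using pp pairs_sub that by (auto intro!: subgroup_one T_subgroup simp: S_def)
        ultimately show ?thesis by blast
      qed
      ultimately show ?thesis using 1 T_card[OF pp] dt d1 by auto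
    next
      case 2
      then have C: "K \<in> CC" by (auto simp: nonsplit_tori_def)
      then show ?thesis using 2 C_semireg[OF C] CC_card[OF C] card_Om dc d1 by (auto simp: S_def)
    qed
    then show "card S = card K" "\<And>z. z \<in> S \<Longrightarrow> K \<inter> T {z} = {\<one>}" by blast+
    show "S \<subseteq> Om" by (auto simp: S_def)
    show "act h z \<in> S" if "h \<in> K" "z \<in> S" for h z using Sact that K by blast
    show "x \<in> S" using x by (simp add: S_def)
    show "act (inv g) y \<in> S" using Sact[of "inv g" y] g y Hs by (simp add: S_def subgroup.m_inv_closed)
  qed
  then obtain z where z: "z \<in> K" "act z x = act (inv g) y" by blast
  define w where "w = g \<otimes> z"
  have zc: "z \<in> carrier G" using z K subgroup_carrier by blast
  have wH: "w \<in> H" using g z K Hs by (auto simp: w_def subgroup.m_closed)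
  have "w \<notin> K"
  proof
    assume "w \<in> K"
    then have "w \<otimes> inv z \<in> K" using z K by (simp add: subgroup.m_closed subgroup.m_inv_closed)
    then show False using g gc zc by (simp add: w_def m_assoc)
  qed
  then have w: "w \<in> H - K" using wH by simp
  have wc: "w \<in> carrier G" using wH subgroup_carrier[OF Hs] by blast
  have wx: "act w x = y" using z gc zc x y act_inv'[OF gc, of y] by (simp add: w_def act_mult)
  have "act w y = act (w \<otimes> w) x" using wx wc x by (simp add: act_mult)
  then have "act w y = x" using dihedral_invol[OF D w] x by (simp add: act_one)
  then show ?thesis using w wx by blast
qed

text \<open>\<open>H\<close> is the full setwise stabiliser of its pair: composed with an element of
  \<open>H\<close> that swaps the points, \<open>w\<close> lands in the torus
  \<open>T {a, b}\<close>.\<close>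

lemma dihedral_absorb: assumes D: "dihedral H K" and p: "split_tori H = {{a, b}}" "a \<noteq> b"
    and w: "w \<in> carrier G" "act w a = b" "act w b = a"
  shows "w \<in> H"
proof -
  have Hs: "subgroup H G" and K: "K \<subset> H" using D dihedral_subgroup by (auto simp: dihedral_def)
  obtain g where g: "g \<in> H - K" using K by blast
  have gc: "g \<in> carrier G" using g subgroup_carrier[OF Hs] by blast
  have "{a, b} \<in> split_tori H" using p by simp
  then have ab: "a \<in> Om" "b \<in> Om" "T {a, b} \<subseteq> H" unfolding split_tori_def pairs_def by auto
  have "g \<otimes> w \<in> T {a, b}" using dihedral_swap[OF D p g] w gc ab by (auto simp: T_def act_mult)
  then have "inv g \<otimes> (g \<otimes> w) \<in> H" using g ab Hs by (auto intro: subgroup.m_closed subgroup.m_inv_closed)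
  then show ?thesis using gc w by (simp add: m_assoc[symmetric])
qed

text \<open>Take \<open>dihedral_trans\<close> with both points equal to \<open>a\<close>: the
  element obtained fixes \<open>a\<close> and lies outside \<open>K\<close>, so it is
  unipotent.\<close>

lemma dihedral_meets_U: assumes D: "dihedral H K" and a: "a \<in> Om" "a \<notin> \<Union>(split_tori H)"
  shows "H \<inter> U a \<noteq> {\<one>}"
proof -
  obtain w where w: "w \<in> H - K" "act w a = a" using dihedral_trans[OF D, of a a] a by blast
  obtain b where b: "w \<in> U b" "w \<noteq> \<one>" "Fix w = {b}" using dihedral_in_U[OF D w(1)] .
  then have "a = b" using w a by (auto simp: Fix_def)
  then show ?thesis using w b by blast
qed

lemma dihedral_U_avoid: assumes D: "dihedral H K" and a: "a \<in> \<Union>(split_tori H)"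
  shows "H \<inter> U a = {\<one>}"
  using split_tori_U[of H a] D a by (simp add: dihedral_def)

text \<open>The product of the two lies in \<open>K\<close> and in \<open>U a\<close>, hence is
  trivial, and both are involutions. Thus one dihedral member accounts for a single nontrivial
  element of a radical.\<close>

lemma dihedral_U_le: assumes D: "dihedral H K" and a: "a \<in> Om" and g: "g \<in> H \<inter> U a - {\<one>}" and h: "h \<in> H \<inter> U a - {\<one>}"
  shows "g = h"
proof -
  have gK: "g \<in> H - K" "h \<in> H - K" using dihedral_K_unip[OF D a] g h by auto
  have c: "g \<in> carrier G" "h \<in> carrier G" using g h by (auto simp: U_def)
  have "g \<otimes> h \<in> U a" using g h U_subgroup[OF a] by (simp add: subgroup.m_closed)
  then have "g \<otimes> h = \<one>" using dihedral_prod[OF D gK] dihedral_K_unip[OF D a] by blast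
  then have "g = inv h" using c by (simp add: inv_equality)
  moreover have "h = inv h" using dihedral_invol[OF D gK(2)] c by (simp add: inv_equality)
  ultimately show ?thesis by simp
qed

text \<open>\<open>H\<close> is the full normalizer of its nonsplit torus, since it already contains
  an element of the second coset.\<close>

lemma dihedral_normalizer: assumes D: "dihedral H C" and n: "nonsplit_tori H = {C}" and w: "w \<in> carrier G" "\<forall>z\<in>C. w \<otimes> z \<otimes> inv w \<in> C"
  shows "w \<in> H"
proof (cases "w \<in> C")
  case True then show ?thesis using D by (auto simp: dihedral_def)
next
  case False
  have Hs: "subgroup H G" using D by (rule dihedral_subgroup)
  obtain g where g: "g \<in> H - C" using D by (auto simp: dihedral_def)
  have gc: "g \<in> carrier G" using g subgroup_carrier[OF Hs] by blast
  have "g \<otimes> w \<in> C" using CC_normalizer[of C g w] nonsplit_tori_one_normal[OF Hs n] n g w False gc by (auto simp: nonsplit_tori_def)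
  then have "inv g \<otimes> (g \<otimes> w) \<in> H" using g D Hs by (auto simp: dihedral_def intro: subgroup.m_closed subgroup.m_inv_closed)
  then show ?thesis using gc w by (simp add: m_assoc[symmetric])
qed

text \<open>If \<open>H'\<close> has a pair that \<open>H\<close> leaves free, then \<open>H\<close>
  contains an element swapping its two points, and \<open>H'\<close> absorbs that element. If both
  tori are nonsplit, the element from \<open>CC_common\<close> lies in both normalizers. Either way
  the intersection is nontrivial.\<close>

lemma dihedral_inter:
  assumes D: "dihedral H K" and D': "dihedral H' K'" and i: "H \<inter> H' = {\<one>}"
  shows "\<exists>p p'. split_tori H = {p} \<and> split_tori H' = {p'} \<and> p \<inter> p' \<noteq> {}"
proof -
  have split: False if D: "dihedral H K" and D': "dihedral H' K'" and i: "H \<inter> H' = {\<one>}"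
    and p': "split_tori H' = {p'}" and disj: "\<Union>(split_tori H) \<inter> p' = {}" for H K H' K' p'
  proof -
    have pp: "p' \<in> pairs" using p' by (auto simp: split_tori_def)
    then obtain x y where xy: "p' = {x, y}" "x \<noteq> y" "x \<in> Om" "y \<in> Om" by (rule pairsE)
    then obtain w where w: "w \<in> H - K" "act w x = y" "act w y = x"
      using dihedral_trans[OF D, of x y] disj by blast
    have wc: "w \<in> carrier G" using w subgroup_carrier[OF dihedral_subgroup[OF D]] by blast
    have "w \<in> H'" using dihedral_absorb[OF D' _ xy(2) wc w(2,3)] p' xy by simp
    then have "w = \<one>" using i w by blast
    then show False using w xy by (simp add: act_one)
  qed
  from D consider (s) p where "split_tori H = {p}" | (n) "split_tori H = {}" "nonsplit_tori H = {K}" by (auto simp: dihedral_def)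
  then show ?thesis
  proof cases
    case (s p)
    from D' consider (s') p' where "split_tori H' = {p'}" | (n') "split_tori H' = {}" "nonsplit_tori H' = {K'}" by (auto simp: dihedral_def)
    then show ?thesis
    proof cases
      case (s' p') then show ?thesis using split[OF D D' i, of p'] s by auto
    next
      case n' then show ?thesis using split[OF D' D _ s] i by (auto simp: Int_commute)
    qed
  next
    case n
    from D' consider (s') p' where "split_tori H' = {p'}" | (n') "split_tori H' = {}" "nonsplit_tori H' = {K'}" by (auto simp: dihedral_def)
    then show ?thesis
    proof cases
      case (s' p') then show ?thesis using split[OF D D' i, of p'] n by auto
    next
      case n'
      have "K \<in> nonsplit_tori H" "K' \<in> nonsplit_tori H'" using n n' by auto
      then have KC: "K \<in> CC" "K' \<in> CC" "K \<subseteq> H" "K' \<subseteq> H'" unfolding nonsplit_tori_def by auto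
      have "K \<noteq> K'"
      proof
        assume "K = K'"
        then have "K \<subseteq> {\<one>}" using KC i by blast
        then have "card K \<le> card {\<one>}" by (intro card_mono) auto
        then show False using CC_card[OF KC(1)] c2 by simp
      qed
      then obtain w where w: "w \<in> carrier G - {\<one>}" "\<forall>z\<in>K. w \<otimes> z \<otimes> inv w \<in> K" "\<forall>z\<in>K'. w \<otimes> z \<otimes> inv w \<in> K'"
        using CC_common[of K K'] KC dihedral_even[OF D] by blast
      have "w \<in> H" "w \<in> H'"
        using dihedral_normalizer[OF D n(2)] dihedral_normalizer[OF D' n'(2)] w by auto
      then show ?thesis using i w by blast
    qed
  qed
qed

section \<open>The minimal partition\<close>

lemma partition_isolated: assumes P: "group_partition G P" and H: "H \<in> P"
  shows "isolated H"
proof -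
  have Hs: "subgroup H G" using P H by (auto simp: group_partition_def group_cover_def)
  \<comment> \<open>For a torus \<open>K\<close> with generator \<open>g\<close>: the member
    containing \<open>g\<close> contains \<open>K\<close>, and it can only be \<open>H\<close>,
    which meets \<open>K\<close> nontrivially.\<close>
  have gen: "K \<subseteq> H" if K: "H \<inter> K \<noteq> {\<one>}" "subgroup K G" and g: "g \<in> K" "\<And>L. subgroup L G \<Longrightarrow> g \<in> L \<Longrightarrow> K \<subseteq> L" for K g
  proof -
    have "g \<in> carrier G" using g(1) K(2) subgroup_carrier by blast
    then obtain L where L: "L \<in> P" "g \<in> L" using P unfolding group_partition_def group_cover_def by blast
    then have "K \<subseteq> L" using g(2)[of L] P by (auto simp: group_partition_def group_cover_def)
    moreover have "\<one> \<in> H \<inter> K" using subgroup_one[OF Hs] subgroup_one[OF K(2)] by simp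
    ultimately have "H \<inter> L \<noteq> {\<one>}" using K(1) by blast
    then have "L = H" using P H L by (auto simp: group_partition_def)
    then show ?thesis using \<open>K \<subseteq> L\<close> by simp
  qed
  have "T p \<subseteq> H" if p: "p \<in> pairs" "H \<inter> T p \<noteq> {\<one>}" for p
  proof -
    obtain g where "g \<in> T p" "\<And>K. subgroup K G \<Longrightarrow> g \<in> K \<Longrightarrow> T p \<subseteq> K" using T_generator[OF p(1)] by metis
    then show ?thesis using gen[OF p(2) T_subgroup[OF pairs_sub[OF p(1)]]] by blast
  qed
  moreover have "C \<subseteq> H" if C: "C \<in> CC" "H \<inter> C \<noteq> {\<one>}" for C
  proof -
    obtain g where "g \<in> C" "\<And>K. subgroup K G \<Longrightarrow> g \<in> K \<Longrightarrow> C \<subseteq> K" using CC_generator[OF C(1)] by metis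
    then show ?thesis using gen[OF C(2) CC_subgroup[OF C(1)]] by blast
  qed
  ultimately show ?thesis using Hs by (simp add: isolated_def)
qed

lemma partition_eq: "group_partition G P \<Longrightarrow> H \<in> P \<Longrightarrow> K \<in> P \<Longrightarrow> g \<in> H \<Longrightarrow> g \<in> K \<Longrightarrow> g \<noteq> \<one> \<Longrightarrow> H = K"
  unfolding group_partition_def by blast

lemma CC_nontriv: assumes "C \<in> CC" obtains g where "g \<in> C" "g \<noteq> \<one>"
  using CC_generator[OF assms] by metis

lemma partition_member: assumes "group_partition G P" "g \<in> carrier G" obtains H where "H \<in> P" "g \<in> H"
  using assms unfolding group_partition_def group_cover_def by blast

text \<open>Members meet trivially, so a nontrivial \<open>K x\<close> lies in at most one of them
  and nothing is counted twice. The family \<open>K\<close> is left general to cover both kinds of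
  tori.\<close>

lemma sum_subsets:
  assumes P: "group_partition G P" and Q: "Q \<subseteq> P" and fA: "finite A"
    and nontriv: "\<And>x. x \<in> A \<Longrightarrow> \<exists>g\<in>K x. g \<noteq> \<one>"
  shows "(\<Sum>H\<in>Q. card {x \<in> A. K x \<subseteq> H}) = card {x \<in> A. \<exists>H\<in>Q. K x \<subseteq> H}"
proof -
  have "card (\<Union>H\<in>Q. {x \<in> A. K x \<subseteq> H}) = (\<Sum>H\<in>Q. card {x \<in> A. K x \<subseteq> H})"
  proof (rule card_UN_disjoint)
    show "finite Q" using P Q finite_subset by (auto simp: group_partition_def)
    show "\<forall>H\<in>Q. finite {x \<in> A. K x \<subseteq> H}" using fA by simp
    show "\<forall>H\<in>Q. \<forall>H'\<in>Q. H \<noteq> H' \<longrightarrow> {x \<in> A. K x \<subseteq> H} \<inter> {x \<in> A. K x \<subseteq> H'} = {}"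
    proof (intro ballI impI, rule ccontr)
      fix H H' assume H: "H \<in> Q" "H' \<in> Q" "H \<noteq> H'" "{x \<in> A. K x \<subseteq> H} \<inter> {x \<in> A. K x \<subseteq> H'} \<noteq> {}"
      then obtain x where x: "x \<in> A" "K x \<subseteq> H" "K x \<subseteq> H'" by blast
      obtain g where "g \<in> K x" "g \<noteq> \<one>" using nontriv[OF x(1)] by blast
      then show False using partition_eq[OF P, of H H' g] H Q x by blast
    qed
  qed
  moreover have "(\<Union>H\<in>Q. {x \<in> A. K x \<subseteq> H}) = {x \<in> A. \<exists>H\<in>Q. K x \<subseteq> H}" by blast
  ultimately show ?thesis by simp
qed

lemma sum_split_tori: assumes "group_partition G P" "Q \<subseteq> P"
  shows "(\<Sum>H\<in>Q. card (split_tori H)) = card {p \<in> pairs. \<exists>H\<in>Q. T p \<subseteq> H}"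
  unfolding split_tori_def by (rule sum_subsets[OF assms finite_pairs]) (blast elim: T_nontriv)

lemma sum_nonsplit_tori: assumes "group_partition G P" "Q \<subseteq> P"
  shows "(\<Sum>H\<in>Q. card (nonsplit_tori H)) = card {C \<in> CC. \<exists>H\<in>Q. C \<subseteq> H}"
  unfolding nonsplit_tori_def by (rule sum_subsets[OF assms finite_CC]) (blast elim: CC_nontriv)

lemma T_in_member: assumes P: "group_partition G P" and p: "p \<in> pairs" shows "\<exists>H\<in>P. T p \<subseteq> H"
proof -
  obtain g where g: "g \<in> T p" "\<And>K. subgroup K G \<Longrightarrow> g \<in> K \<Longrightarrow> T p \<subseteq> K" using T_generator[OF p] by metis
  then have "g \<in> carrier G" by (simp add: T_def)
  then obtain H where "H \<in> P" "g \<in> H" using partition_member[OF P] by metis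
  then show ?thesis using g(2)[of H] partition_isolated[OF P] by (auto simp: isolated_def)
qed

lemma CC_in_member: assumes P: "group_partition G P" and p: "C \<in> CC" shows "\<exists>H\<in>P. C \<subseteq> H"
proof -
  obtain g where g: "g \<in> C" "\<And>K. subgroup K G \<Longrightarrow> g \<in> K \<Longrightarrow> C \<subseteq> K" using CC_generator[OF p] by metis
  then have "g \<in> carrier G" using CC_sub p by blast
  then obtain H where "H \<in> P" "g \<in> H" using partition_member[OF P] by metis
  then show ?thesis using g(2)[of H] partition_isolated[OF P] by (auto simp: isolated_def)
qed

lemma U_nontriv: assumes a: "a \<in> Om" and b: "finite S" "card S < q - 1" shows "\<exists>g\<in>U a. g \<noteq> \<one> \<and> g \<notin> S"
proof (rule ccontr)
  assume "\<not> ?thesis"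
  then have "U a \<subseteq> insert \<one> S" by blast
  then have "card (U a) \<le> card (insert \<one> S)" using b by (intro card_mono) auto
  also have "\<dots> \<le> card S + 1" using card_insert_le_m1 b by (simp add: card_insert_if)
  finally show False using U_card[OF a] b by simp
qed

text \<open>
  Otherwise all unipotents lie in dihedral members, and these belong to pairwise intersecting pairs of
  points. For one such pair \<open>{a, b}\<close>, covering \<open>U a\<close> and then \<open>U b\<close> yields a pair with three elements.
\<close>

lemma exists_torus_free:
  assumes P: "group_partition G P" and bf: "\<And>H. H \<in> P \<Longrightarrow> borel_free H"
  shows "\<exists>H\<in>P. card (split_tori H) + card (nonsplit_tori H) = 0"
proof (rule ccontr)
  assume neg: "\<not> ?thesis"
  have dih: "\<exists>K. dihedral H K" if H: "H \<in> P" "g \<in> H" "g \<in> U a" "g \<noteq> \<one>" for H g a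
  proof -
    have "card (split_tori H) + card (nonsplit_tori H) = 1" using neg torus_count[OF bf[OF H(1)]] H(1) by (meson le_neq_implies_less less_one)
    moreover have "g \<in> unipotents H" using H by (auto simp: unipotents_def U_def)
    ultimately show ?thesis using dihedral_exists[OF bf[OF H(1)]] by blast
  qed
  have mem: "\<exists>H\<in>P. g \<in> H \<and> (\<exists>K. dihedral H K)" if "g \<in> U a" "g \<noteq> \<one>" for g a
  proof -
    have "g \<in> carrier G" using that by (simp add: U_def)
    then obtain H where H: "H \<in> P" "g \<in> H" using partition_member[OF P] by metis
    then show ?thesis using dih[OF H that] by blast
  qed
  have inter: "H \<inter> H' = {\<one>}" if "H \<in> P" "H' \<in> P" "H \<noteq> H'" for H H'
    using P that by (auto simp: group_partition_def)
  have pairs_meet: "p \<inter> p' \<noteq> {}" if "H \<in> P" "H' \<in> P" "H \<noteq> H'" "dihedral H K" "dihedral H' K'" "split_tori H = {p}" "split_tori H' = {p'}"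
    for H H' K K' p p'
    using dihedral_inter[OF that(4,5) inter[OF that(1-3)]] that by auto
  \<comment> \<open>Since \<open>q \<ge> 3\<close>, the radical has two nontrivial elements, and a
    dihedral member holds only one of them.\<close>
  have two: "\<exists>H\<in>P. \<exists>H'\<in>P. H \<noteq> H' \<and> H \<inter> U a \<noteq> {\<one>} \<and> H' \<inter> U a \<noteq> {\<one>} \<and> (\<exists>K. dihedral H K) \<and> (\<exists>K. dihedral H' K)"
    if a: "a \<in> Om" for a
  proof -
    obtain g where g: "g \<in> U a" "g \<noteq> \<one>" using U_nontriv[OF a, of "{}"] q3 by auto
    obtain g' where g': "g' \<in> U a" "g' \<noteq> \<one>" "g' \<noteq> g"
    proof -
      have "card {g} < q - 1" using q3 by simp
      then show ?thesis using U_nontriv[OF a, of "{g}"] that by blast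
    qed
    obtain H K where H: "H \<in> P" "g \<in> H" "dihedral H K" using mem[OF g] by blast
    obtain H' K' where H': "H' \<in> P" "g' \<in> H'" "dihedral H' K'" using mem[OF g'(1,2)] by blast
    have "H \<noteq> H'" using dihedral_U_le[OF H(3) a, of g g'] g g' H H' by blast
    then show ?thesis using H H' g g' by blast
  qed
  \<comment> \<open>There is a second dihedral member, and two dihedral members with trivial
    intersection both have split tori.\<close>
  have pair: "\<exists>p. split_tori H = {p} \<and> p \<in> pairs" if H: "H \<in> P" "dihedral H K" for H K
  proof -
    obtain a where "a \<in> Om" using other_point by blast
    then obtain H' K' where "H' \<in> P" "H \<noteq> H'" "dihedral H' K'" using two[of a] by blast
    then obtain p where "split_tori H = {p}" using dihedral_inter[OF H(2) _ inter, of H' K'] H by blast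
    then show ?thesis by (auto simp: split_tori_def)
  qed
  obtain o0 where o0: "o0 \<in> Om" using other_point by blast
  obtain D K where D: "D \<in> P" "dihedral D K" using two[OF o0] by blast
  obtain p where p: "split_tori D = {p}" "p \<in> pairs" using pair[OF D] by blast
  obtain a b where ab: "p = {a, b}" "a \<noteq> b" "a \<in> Om" "b \<in> Om" using pairsE[OF p(2)] .
  have avoid: "z \<notin> r" if "dihedral H K" "split_tori H = {r}" "H \<inter> U z \<noteq> {\<one>}" for H K r z
    using dihedral_U_avoid[OF that(1), of z] that by auto
  obtain H1 H2 K1 K2 where H: "H1 \<in> P" "H2 \<in> P" "H1 \<noteq> H2" "H1 \<inter> U a \<noteq> {\<one>}" "H2 \<inter> U a \<noteq> {\<one>}"
    "dihedral H1 K1" "dihedral H2 K2" using two[OF ab(3)] by blast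
  obtain p1 where p1: "split_tori H1 = {p1}" "p1 \<in> pairs" using pair[OF H(1,6)] by blast
  obtain p2 where p2: "split_tori H2 = {p2}" "p2 \<in> pairs" using pair[OF H(2,7)] by blast
  \<comment> \<open>A dihedral member meeting \<open>U a\<close> does not have \<open>a\<close> in
    its pair. As the pair must meet \<open>{a, b}\<close>, it contains \<open>b\<close>.\<close>
  have a12: "a \<notin> p1" "a \<notin> p2" using avoid[OF H(6) p1(1) H(4)] avoid[OF H(7) p2(1) H(5)] by auto
  then have "H1 \<noteq> D" "H2 \<noteq> D" using p1 p2 p ab by auto
  then have b12: "b \<in> p1" "b \<in> p2"
    using pairs_meet[OF H(1) D(1) _ H(6) D(2) p1(1) p(1)] pairs_meet[OF H(2) D(1) _ H(7) D(2) p2(1) p(1)] a12 ab by auto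
  obtain x1 where x1: "p1 = {b, x1}" "x1 \<noteq> b" using p1(2) b12 by (auto elim!: pairsE)
  obtain x2 where x2: "p2 = {b, x2}" "x2 \<noteq> b" using p2(2) b12 by (auto elim!: pairsE)
  have "p1 \<noteq> p2"
  proof
    assume "p1 = p2"
    then have "p1 \<in> split_tori H1" "p1 \<in> split_tori H2" using p1 p2 by auto
    then have TT: "T p1 \<subseteq> H1" "T p1 \<subseteq> H2" by (auto simp: split_tori_def)
    obtain g where "g \<in> T p1" "g \<noteq> \<one>" using T_nontriv[OF p1(2)] .
    then show False using inter[OF H(1,2,3)] TT by blast
  qed
  then have x12: "x1 \<noteq> x2" using x1 x2 by auto
  \<comment> \<open>The pair of a member meeting \<open>U b\<close> avoids \<open>b\<close>, so it
    can meet \<open>{a, b}\<close>, \<open>{b, x1}\<close> and \<open>{b, x2}\<close> only in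
    \<open>a\<close>, \<open>x1\<close> and \<open>x2\<close>.\<close>
  obtain H3 K3 where H3: "H3 \<in> P" "H3 \<inter> U b \<noteq> {\<one>}" "dihedral H3 K3" using two[OF ab(4)] by blast
  obtain p3 where p3: "split_tori H3 = {p3}" "p3 \<in> pairs" using pair[OF H3(1,3)] by blast
  have b3: "b \<notin> p3" using avoid[OF H3(3) p3(1) H3(2)] .
  then have "p3 \<noteq> p" "p3 \<noteq> p1" "p3 \<noteq> p2" using ab(1) b12 by blast+
  then have "H3 \<noteq> D" "H3 \<noteq> H1" "H3 \<noteq> H2" using p(1) p1(1) p2(1) p3(1) by auto
  then have "p3 \<inter> p \<noteq> {}" "p3 \<inter> p1 \<noteq> {}" "p3 \<inter> p2 \<noteq> {}"
    using pairs_meet[OF H3(1) D(1) _ H3(3) D(2) p3(1) p(1)] pairs_meet[OF H3(1) H(1) _ H3(3) H(6) p3(1) p1(1)]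
      pairs_meet[OF H3(1) H(2) _ H3(3) H(7) p3(1) p2(1)] by blast+
  then have "a \<in> p3" "x1 \<in> p3" "x2 \<in> p3" using b3 ab(1) x1(1) x2(1) by blast+
  then have "{a, x1, x2} \<subseteq> p3" by simp
  moreover have "a \<noteq> x1" "a \<noteq> x2" using a12 x1(1) x2(1) by blast+
  then have "card {a, x1, x2} = 3" using x12 by simp
  moreover have "card p3 = 2" using p3(2) unfolding pairs_def by blast
  moreover have "finite p3" by (rule finite_subset[OF pairs_sub[OF p3(2)] fin_Om])
  ultimately show False using card_mono[of p3 "{a, x1, x2}"] by linarith
qed

lemma count_le: fixes f :: "'z \<Rightarrow> nat" assumes "finite Q" "\<And>H. H \<in> Q \<Longrightarrow> f H \<le> 1"
  shows "(\<Sum>H\<in>Q. f H) + card {H \<in> Q. f H = 0} = card Q"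
proof -
  have "card Q = (\<Sum>H\<in>Q. 1)" by simp
  also have "\<dots> = (\<Sum>H\<in>Q. f H + (if f H = 0 then 1 else 0))"
    by (rule sum.cong[OF refl]) (use assms(2) in \<open>force simp: le_Suc_eq\<close>)
  also have "\<dots> = (\<Sum>H\<in>Q. f H) + card {H \<in> Q. f H = 0}"
    using assms(1) by (simp add: sum.distrib sum.If_cases Int_def)
  finally show ?thesis by simp
qed

lemma card_pairs_at: assumes a: "a \<in> Om" shows "card {p \<in> pairs. a \<in> p} = q"
proof -
  have "{p \<in> pairs. a \<in> p} = (\<lambda>b. {a, b}) ` (Om - {a})"
    using a by (auto elim!: pairsE intro!: pairsI)
  moreover have "inj_on (\<lambda>b. {a, b}) (Om - {a})" by (auto simp: inj_on_def doubleton_eq_iff)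
  ultimately show ?thesis using card_image card_Om fin_Om a by fastforce
qed

lemma q_squares: "card pairs + card CC = q ^ 2"
proof -
  have "2 * (card pairs + card CC) = 2 * q ^ 2"
    using two_pairs two_CC q3 by (cases q) (auto simp: power2_eq_square algebra_simps)
  then show ?thesis by simp
qed

text \<open>
  With a Borel member \<open>T {a}\<close>, a dihedral member would meet \<open>U a\<close>; so the \<open>q * (q - 1)\<close> unipotents
  outside \<open>T {a}\<close> lie in torus-free members, of order at most \<open>q\<close>.
\<close>

lemma partition_lower: assumes P: "group_partition G P" shows "q ^ 2 + 1 \<le> card P"
proof (cases "\<forall>H\<in>P. borel_free H")
  case True
  have fP: "finite P" using P by (simp add: group_partition_def)
  have "(\<Sum>H\<in>P. card (split_tori H) + card (nonsplit_tori H)) = card pairs + card CC"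
  proof -
    have "{p \<in> pairs. \<exists>H\<in>P. T p \<subseteq> H} = pairs" "{C \<in> CC. \<exists>H\<in>P. C \<subseteq> H} = CC"
      using T_in_member[OF P] CC_in_member[OF P] by blast+
    then show ?thesis using sum_split_tori[OF P order_refl] sum_nonsplit_tori[OF P order_refl] by (simp add: sum.distrib)
  qed
  moreover have "card {H \<in> P. card (split_tori H) + card (nonsplit_tori H) = 0} \<noteq> 0"
    using exists_torus_free[OF P] True fP by auto
  ultimately show ?thesis
    using count_le[OF fP, of "\<lambda>H. card (split_tori H) + card (nonsplit_tori H)"] torus_count True q_squares by fastforce
next
  case False
  then obtain B a where B: "B \<in> P" "a \<in> Om" "T {a} \<subseteq> B" using partition_isolated[OF P] by (auto simp: borel_free_def)
  have fP: "finite P" using P by (simp add: group_partition_def)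
  have proper: "H \<noteq> carrier G" "subgroup H G" if "H \<in> P" for H using P that by (auto simp: group_partition_def group_cover_def)
  have BT: "B = T {a}" using borel_maximal[OF proper(2)[OF B(1)] B(2,3)] proper(1)[OF B(1)] by simp
  define Q where "Q = P - {B}"
  have fQ: "finite Q" using fP by (simp add: Q_def)
  have QB: "H \<inter> B = {\<one>}" if "H \<in> Q" for H using P B(1) that by (auto simp: Q_def group_partition_def)
  \<comment> \<open>A second point stabiliser would share with \<open>B\<close> the radical
    \<open>U a\<close> or the torus \<open>T {a, b}\<close>.\<close>
  have bf: "borel_free H" if H: "H \<in> Q" for H
  proof -
    have HP: "H \<in> P" using H by (simp add: Q_def)
    have "\<not> T {b} \<subseteq> H" if b: "b \<in> Om" for b
    proof
      assume Tb: "T {b} \<subseteq> H"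
      show False
      proof (cases "b = a")
        case True
        obtain g where "g \<in> U a" "g \<noteq> \<one>" using U_nontriv[OF B(2), of "{}"] q3 by auto
        then show False using QB[OF H] Tb True BT U_T[OF b] by blast
      next
        case False
        obtain g where "g \<in> T {a, b}" "g \<noteq> \<one>" using T_nontriv[OF pairsI, of a b] False B b by blast
        then have "g \<in> H \<inter> B" using Tb BT by (auto simp: T_def)
        then show False using QB[OF H] \<open>g \<noteq> \<one>\<close> by blast
      qed
    qed
    then show ?thesis using partition_isolated[OF P HP] by (simp add: borel_free_def)
  qed
  have setp: "{p \<in> pairs. \<exists>H\<in>Q. T p \<subseteq> H} = pairs - {p \<in> pairs. a \<in> p}"
  proof -
    have "(\<exists>H\<in>Q. T p \<subseteq> H) \<longleftrightarrow> a \<notin> p" if p: "p \<in> pairs" for p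
    proof -
      obtain g where g: "g \<in> T p" "g \<noteq> \<one>" "Fix g = p" using T_nontriv[OF p] .
      have TB: "T p \<subseteq> B \<longleftrightarrow> a \<in> p"
        using g BT B(2) by (auto simp: T_def Fix_def)
      obtain H where H: "H \<in> P" "T p \<subseteq> H" using T_in_member[OF P p] by blast
      show ?thesis
      proof
        assume "\<exists>H\<in>Q. T p \<subseteq> H"
        then obtain H' where "H' \<in> Q" "T p \<subseteq> H'" by blast
        then show "a \<notin> p" using QB g TB by blast
      next
        assume "a \<notin> p"
        then show "\<exists>H\<in>Q. T p \<subseteq> H" using H TB by (auto simp: Q_def)
      qed
    qed
    then show ?thesis by blast
  qed
  have setc: "{C \<in> CC. \<exists>H\<in>Q. C \<subseteq> H} = CC"
  proof -
    have "\<exists>H\<in>Q. C \<subseteq> H" if C: "C \<in> CC" for C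
    proof -
      obtain g where g: "g \<in> C" "g \<noteq> \<one>" using CC_nontriv[OF C] .
      obtain H where H: "H \<in> P" "C \<subseteq> H" using CC_in_member[OF P C] by blast
      have "g \<notin> B" using CC_Fix[OF C g] BT B(2) by (auto simp: T_def Fix_def)
      then show ?thesis using H g by (auto simp: Q_def)
    qed
    then show ?thesis by blast
  qed
  have "(\<Sum>H\<in>Q. card (split_tori H) + card (nonsplit_tori H)) = card (pairs - {p \<in> pairs. a \<in> p}) + card CC"
    using sum_split_tori[OF P, of Q] sum_nonsplit_tori[OF P, of Q] setp setc by (simp add: sum.distrib Q_def)
  also have "card (pairs - {p \<in> pairs. a \<in> p}) = card pairs - q"
    using finite_pairs card_pairs_at[OF B(2)] by (subst card_Diff_subset) auto
  finally have sumQ: "(\<Sum>H\<in>Q. card (split_tori H) + card (nonsplit_tori H)) = card pairs - q + card CC" .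
  have qle: "q \<le> card pairs" using card_pairs_at[OF B(2)] card_mono[OF finite_pairs, of "{p \<in> pairs. a \<in> p}"] by auto
  define R where "R = {H \<in> Q. card (split_tori H) + card (nonsplit_tori H) = 0}"
  have fR: "finite R" using fQ by (simp add: R_def)
  have "(\<Union>b\<in>Om - {a}. U b - {\<one>}) \<subseteq> (\<Union>H\<in>R. H - {\<one>})"
  proof (rule subsetI)
    fix g assume "g \<in> (\<Union>b\<in>Om - {a}. U b - {\<one>})"
    then obtain b where b: "b \<in> Om" "b \<noteq> a" and g: "g \<in> U b" "g \<noteq> \<one>" by blast
    have gc: "g \<in> carrier G" "Fix g = {b}" using g by (auto simp: U_def)
    obtain H where H: "H \<in> P" "g \<in> H" using partition_member[OF P gc(1)] .
    have "g \<notin> B" using gc b B(2) by (auto simp: BT T_def Fix_def)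
    then have HQ: "H \<in> Q" using H by (auto simp: Q_def)
    have "card (split_tori H) + card (nonsplit_tori H) \<noteq> 1"
    proof
      assume s1: "card (split_tori H) + card (nonsplit_tori H) = 1"
      have "unipotents H \<noteq> {}" using H gc by (auto simp: unipotents_def)
      then obtain K where D: "dihedral H K" using dihedral_exists[OF bf[OF HQ] s1] by blast
      \<comment> \<open>Split tori through \<open>a\<close> lie in \<open>B\<close> and so in no
        other member; hence \<open>a\<close> is off the pair of \<open>H\<close>, as
        \<open>dihedral_meets_U\<close> requires.\<close>
      have "a \<notin> \<Union>(split_tori H)"
      proof
        assume "a \<in> \<Union>(split_tori H)"
        then obtain p where p: "p \<in> pairs" "T p \<subseteq> H" "a \<in> p" by (auto simp: split_tori_def)
        then have "T p \<subseteq> B" by (auto simp: BT T_def)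
        moreover obtain h where "h \<in> T p" "h \<noteq> \<one>" using T_nontriv[OF p(1)] .
        ultimately show False using QB[OF HQ] p by blast
      qed
      then have "H \<inter> U a \<noteq> {\<one>}" using dihedral_meets_U[OF D B(2)] by blast
      moreover have "\<one> \<in> H \<inter> U a" using subgroup_one[OF proper(2)[OF H(1)]] by (simp add: U_def)
      ultimately show False using QB[OF HQ] U_T[OF B(2)] BT by blast
    qed
    then have "H \<in> R" using torus_count[OF bf[OF HQ]] HQ by (simp add: R_def)
    then show "g \<in> (\<Union>H\<in>R. H - {\<one>})" using H g by blast
  qed
  then have "card (\<Union>b\<in>Om - {a}. U b - {\<one>}) \<le> card (\<Union>H\<in>R. H - {\<one>})"
    using fR subgroup_finite[OF proper(2)] by (intro card_mono) (auto simp: R_def Q_def)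
  also have "\<dots> \<le> (\<Sum>H\<in>R. card (H - {\<one>}))" using fR by (rule card_UN_le)
  also have "\<dots> \<le> (\<Sum>H\<in>R. q - 1)"
  proof (rule sum_mono)
    fix H assume H: "H \<in> R"
    then have iso: "isolated H" using bf by (simp add: R_def borel_free_def)
    have "nonsplit_tori H = {}" "split_tori H = {}" using H finite_split_tori finite_nonsplit_tori by (auto simp: R_def)
    then have "card H \<le> q" using torus_free_case[OF iso] by blast
    then show "card (H - {\<one>}) \<le> q - 1"
      using subgroup_one[OF isolated_subgroup[OF iso]] subgroup_finite[OF isolated_subgroup[OF iso]] by simp
  qed
  also have "card (\<Union>b\<in>Om - {a}. U b - {\<one>}) = card (Om - {a}) * (q - 1)"
    by (rule card_Union_punctured) (use fin_Om U_subgroup U_card in \<open>auto simp: U_def\<close>)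
  also have "card (Om - {a}) = q" using fin_Om card_Om B(2) by simp
  finally have "q * (q - 1) \<le> card R * (q - 1)" by simp
  then have "q \<le> card R" using q3 by simp
  moreover have "(\<Sum>H\<in>Q. card (split_tori H) + card (nonsplit_tori H)) + card R = card Q"
    unfolding R_def using torus_count[OF bf] by (rule count_le[OF fQ])
  moreover have "card P = card Q + 1" unfolding Q_def using card_Suc_Diff1[OF fP B(1)] by linarith
  ultimately show ?thesis using sumQ qle q_squares by linarith
qed

section \<open>A partition of the minimal size\<close>

lemma partition_upper: "\<exists>P. group_partition G P \<and> card P = q ^ 2 + 1"
proof -
  obtain a where a: "a \<in> Om" using other_point by blast
  define S where "S = pairs - {p \<in> pairs. a \<in> p}"
  define P where "P = insert (T {a}) (T ` S \<union> CC \<union> U ` (Om - {a}))"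
  have Sp: "p \<in> pairs" "a \<notin> p" if "p \<in> S" for p using that by (auto simp: S_def)
  have fpF: "Fix g = p" if "p \<in> S" "g \<in> T p" "g \<noteq> \<one>" for p g using T_Fix Sp that by blast
  have sg: "subgroup H G" if "H \<in> P" for H
    using that a Sp T_subgroup pairs_sub CC_subgroup U_subgroup by (auto simp: P_def)
  \<comment> \<open>The fixed points of a nontrivial element determine the member containing it,
    except among nonsplit tori, where \<open>CC_disjoint\<close> takes over.\<close>
  have key: "H = T {a} \<and> a \<in> Fix g \<or> H = T (Fix g) \<and> a \<notin> Fix g \<and> card (Fix g) = 2 \<or>
      H \<in> CC \<and> Fix g = {} \<or> (\<exists>b. b \<noteq> a \<and> H = U b \<and> Fix g = {b})"
    if H: "H \<in> P" "g \<in> H" "g \<noteq> \<one>" for H g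
  proof -
    consider "H = T {a}" | p where "p \<in> S" "H = T p" | "H \<in> CC" | b where "b \<in> Om - {a}" "H = U b"
      using H(1) unfolding P_def by blast
    then show ?thesis
    proof cases
      case 1 then show ?thesis using H a by (simp add: T_def Fix_def)
    next
      case (2 p)
      then have "Fix g = p" using fpF H by blast
      then show ?thesis using 2 Sp[OF 2(1)] by (simp add: pairs_def)
    next
      case 3 then show ?thesis using CC_Fix H by blast
    next
      case (4 b) then show ?thesis using H by (auto simp: U_def)
    qed
  qed
  have disj: "H = K" if HK: "H \<in> P" "K \<in> P" "g \<in> H" "g \<in> K" "g \<noteq> \<one>" for H K g
  proof (cases "Fix g = {}")
    case True
    then have "H \<in> CC" "K \<in> CC" using key[of H g] key[of K g] HK by auto
    then show ?thesis using CC_disjoint HK by blast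
  next
    case False
    from key[OF HK(1,3,5)] key[OF HK(2,4,5)] False show ?thesis by (elim disjE exE conjE) simp_all
  qed
  have cov: "\<Union>P = carrier G"
  proof
    show "\<Union>P \<subseteq> carrier G" using sg subgroup.subset by blast
    show "carrier G \<subseteq> \<Union>P"
    proof
      fix g assume g: "g \<in> carrier G"
      show "g \<in> \<Union>P"
      proof (cases "a \<in> Fix g")
        case True
        then have "g \<in> T {a}" using g by (simp add: T_def Fix_def)
        then show ?thesis by (simp add: P_def)
      next
        case False
        then have g1: "g \<noteq> \<one>" using Fix_one a by auto
        then have "card (Fix g) = 0 \<or> card (Fix g) = 1 \<or> card (Fix g) = 2" using Fix_le2[OF g] by linarith
        then show ?thesis
        proof (elim disjE)
          assume "card (Fix g) = 0"
          then have "Fix g = {}" using finite_Fix by simp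
          then show ?thesis using Fix_CC[OF g] by (auto simp: P_def)
        next
          assume "card (Fix g) = 1"
          then obtain b where b: "Fix g = {b}" by (auto simp: card_1_singleton_iff)
          then have "b \<in> Om - {a}" "g \<in> U b" using Fix_sub[of g] False g by (auto simp: U_def)
          then show ?thesis by (auto simp: P_def)
        next
          assume "card (Fix g) = 2"
          then have "Fix g \<in> S" "g \<in> T (Fix g)" using Fix_sub False Fix_T[OF g] by (auto simp: S_def pairs_def)
          then show ?thesis by (auto simp: P_def)
        qed
      qed
    qed
  qed
  \<comment> \<open>Properness is obtained from orders: no member is larger than a Borel
    subgroup.\<close>
  have size: "card H \<le> q * t" if "H \<in> P" for H
  proof -
    have "t \<le> q * t" "c \<le> q * t" "q \<le> q * t"
    proof -
      have "q * 2 \<le> q * t" using t2 by (intro mult_le_mono) auto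
      moreover have "c \<le> q + 1" using dc d12 by auto
      ultimately show "c \<le> q * t" using q3 by linarith
    qed (use t2 q3 in auto)
    then show ?thesis
      using that stab_card_eq[OF a] T_card Sp CC_card U_card by (auto simp: P_def)
  qed
  have proper: "H \<noteq> carrier G" if "H \<in> P" for H
    using size[OF that] card_G q3 t2 by auto
  have fP: "finite P" using finite_pairs finite_CC fin_Om by (auto simp: P_def S_def)
  have part: "group_partition G P"
    unfolding group_partition_def group_cover_def
  proof (intro conjI ballI impI)
    fix H K assume "H \<in> P" "K \<in> P" "H \<noteq> K"
    then show "H \<inter> K = {\<one>}" using disj[of H K] subgroup_one[OF sg] by blast
  qed (use fP sg proper cov in auto)
  \<comment> \<open>An upper estimate is enough, since the lower bound holds for every partition;
    injectivity of \<open>T\<close> and \<open>U\<close> is not at issue.\<close>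
  have "card P \<le> 1 + card (T ` S \<union> CC \<union> U ` (Om - {a}))" unfolding P_def by (simp add: card_insert_le_m1 card_insert_if finite_CC finite_pairs S_def fin_Om)
  also have "card (T ` S \<union> CC \<union> U ` (Om - {a})) \<le> card (T ` S) + card CC + card (U ` (Om - {a}))"
    by (meson add_le_mono card_Un_le le_refl order_trans)
  also have "card (T ` S) \<le> card S" using finite_pairs by (intro card_image_le) (simp add: S_def)
  also have "card (U ` (Om - {a})) \<le> card (Om - {a})" using fin_Om by (intro card_image_le) simp
  also have "card S = card pairs - q"
    unfolding S_def using finite_pairs card_pairs_at[OF a] by (subst card_Diff_subset) auto
  also have "card (Om - {a}) = q" using card_Om fin_Om a by simp
  finally have "card P \<le> 1 + (card pairs - q + card CC + q)" by simp
  moreover have "q \<le> card pairs" using card_pairs_at[OF a] card_mono[OF finite_pairs, of "{p \<in> pairs. a \<in> p}"] by auto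
  ultimately have "card P \<le> q ^ 2 + 1" using q_squares by linarith
  then show ?thesis using part partition_lower[OF part] by (intro exI[of _ P]) simp
qed

theorem rho_eq: "rho G = enat (q ^ 2 + 1)"
proof -
  obtain P where P: "group_partition G P" "card P = q ^ 2 + 1" using partition_upper by blast
  show ?thesis unfolding rho_def
  proof (rule antisym)
    show "Inf {enat (card P) |P. group_partition G P} \<le> enat (q ^ 2 + 1)"
      using P by (intro Inf_lower) (auto intro!: exI[of _ P])
    show "enat (q ^ 2 + 1) \<le> Inf {enat (card P) |P. group_partition G P}"
      using partition_lower by (intro Inf_greatest) (auto simp del: One_nat_def)
  qed
qed

end

section \<open>Two-by-two matrices\<close>

text \<open>The determinant of the matrix with columns \<open>v\<close> and \<open>w\<close>. For
  \<open>v \<noteq> 0\<close>, the equation \<open>cr v (A *v v) = 0\<close> says that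
  \<open>v\<close> is an eigenvector of \<open>A\<close>.\<close>

definition cr :: "'a::comm_ring_1 ^ 2 \<Rightarrow> 'a ^ 2 \<Rightarrow> 'a" where "cr v w = v$1 * w$2 - v$2 * w$1"

definition lspan :: "'a::field ^ 2 \<Rightarrow> ('a ^ 2) set" where "lspan v = range (\<lambda>c. c *s v)"

lemmas entries = vec_eq_iff forall_2 matrix_matrix_mult_def matrix_vector_mult_def sum_2 mat_def

lemma vec2_nz: "(v :: 'a::zero ^ 2) \<noteq> 0 \<longleftrightarrow> v$1 \<noteq> 0 \<or> v$2 \<noteq> 0"
  by (simp add: vec_eq_iff forall_2)

lemma cr_zero_iff: fixes v w :: "'a::field ^ 2" assumes "v \<noteq> 0" shows "cr v w = 0 \<longleftrightarrow> (\<exists>c. w = c *s v)"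
proof
  assume c: "cr v w = 0"
  show "\<exists>c. w = c *s v"
  proof (cases "v$1 = 0")
    case True
    then have "v$2 \<noteq> 0" using assms by (simp add: vec2_nz)
    then have "w = (w$2 / v$2) *s v" using c True by (simp add: cr_def vec_eq_iff forall_2)
    then show ?thesis by blast
  next
    case False
    then have "w = (w$1 / v$1) *s v" using c by (simp add: cr_def vec_eq_iff forall_2 field_simps)
    then show ?thesis by blast
  qed
qed (auto simp: cr_def)

lemma lspan_self: "v \<in> lspan v"
  unfolding lspan_def by (rule range_eqI[of _ _ 1]) simp

lemma lspan_eq_iff: fixes v w :: "'a::field ^ 2" assumes "v \<noteq> 0" "w \<noteq> 0" shows "lspan v = lspan w \<longleftrightarrow> cr v w = 0"
proof
  assume "lspan v = lspan w"
  then have "w \<in> lspan v" using lspan_self by simp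
  then show "cr v w = 0" using cr_zero_iff[OF assms(1)] by (auto simp: lspan_def)
next
  assume "cr v w = 0"
  then obtain c where c: "w = c *s v" using cr_zero_iff[OF assms(1)] by blast
  then have c0: "c \<noteq> 0" using assms by auto
  have "a *s v \<in> lspan w" for a
    unfolding lspan_def using c c0 by (intro range_eqI[of _ _ "a / c"]) (simp add: vector_smult_assoc)
  moreover have "a *s w \<in> lspan v" for a
    unfolding lspan_def using c by (intro range_eqI[of _ _ "a * c"]) (simp add: vector_smult_assoc)
  ultimately show "lspan v = lspan w" by (auto simp: lspan_def)
qed

lemma image_lspan: "(\<lambda>x. A *v x) ` lspan v = lspan (A *v v)" for A :: "'a::field^2^2"
  by (auto simp: lspan_def image_image matrix_vector_mult_scaleR vector_scalar_commute)

lemma invertible_nz: fixes A :: "'a::field^2^2" assumes "det A \<noteq> 0" "v \<noteq> 0" shows "A *v v \<noteq> 0"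
proof
  assume 0: "A *v v = 0"
  obtain B where "B ** A = mat 1" using assms(1) invertible_det_nz[of A] by (auto simp: invertible_def)
  then have "B *v (A *v v) = v" by (simp add: matrix_vector_mul_assoc)
  then show False using 0 assms(2) by simp
qed

definition points :: "('a::field ^ 2) set set" where "points = {lspan v | v. v \<noteq> 0}"

text \<open>Homogeneous coordinates have the normal forms \<open>(1, x)\<close> and
  \<open>(0, 1)\<close>.\<close>

lemma card_points: "card (points :: ('a::{field,finite} ^ 2) set set) = CARD('a) + 1"
proof -
  define f where "f x = (vector [1, x] :: 'a^2)" for x
  define e where "e = (vector [0, 1] :: 'a^2)"
  have nz: "f x \<noteq> 0" "e \<noteq> 0" for x by (simp_all add: vec2_nz f_def e_def vector_2)
  have "points = insert (lspan e) (range (\<lambda>x. lspan (f x)))"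
  proof
    show "insert (lspan e) (range (\<lambda>x. lspan (f x))) \<subseteq> points" using nz by (auto simp: points_def)
    show "points \<subseteq> insert (lspan e) (range (\<lambda>x. lspan (f x)))"
    proof
      fix L :: "('a^2) set" assume "L \<in> points"
      then obtain v where v: "v \<noteq> 0" "L = lspan v" by (auto simp: points_def)
      show "L \<in> insert (lspan e) (range (\<lambda>x. lspan (f x)))"
      proof (cases "v$1 = 0")
        case True
        then have "cr v e = 0" by (simp add: cr_def e_def vector_2)
        then show ?thesis using lspan_eq_iff[OF v(1) nz(2)] v by simp
      next
        case False
        then have "cr v (f (v$2 / v$1)) = 0" by (simp add: cr_def f_def vector_2)
        then have "L = lspan (f (v$2 / v$1))" using lspan_eq_iff[OF v(1) nz(1)] v by blast
        then show ?thesis by blast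
      qed
    qed
  qed
  moreover have "inj (\<lambda>x. lspan (f x))"
  proof (rule injI)
    fix x y assume "lspan (f x) = lspan (f y)"
    then have "cr (f x) (f y) = 0" using lspan_eq_iff[OF nz(1) nz(1)] by blast
    then show "x = y" by (simp add: cr_def f_def vector_2)
  qed
  moreover have "lspan e \<notin> range (\<lambda>x. lspan (f x))"
  proof
    assume "lspan e \<in> range (\<lambda>x. lspan (f x))"
    then obtain x where "cr e (f x) = 0" using lspan_eq_iff[OF nz(2) nz(1)] by blast
    then show False by (simp add: cr_def e_def f_def vector_2)
  qed
  moreover have "card (insert (lspan e) (range (\<lambda>x. lspan (f x)))) = Suc (card (range (\<lambda>x. lspan (f x))))"
    by (rule card_insert_disjoint[OF _ calculation(3)]) simp
  ultimately show ?thesis using card_image[of "\<lambda>x. lspan (f x)" UNIV] by simp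
qed

lemma fixes_lspan_iff: fixes A :: "'a::field^2^2" assumes "det A \<noteq> 0" "v \<noteq> 0"
  shows "(\<lambda>x. A *v x) ` lspan v = lspan v \<longleftrightarrow> cr v (A *v v) = 0"
  unfolding image_lspan using lspan_eq_iff[OF assms(2) invertible_nz[OF assms]] by auto

text \<open>\<open>cr w (A *v w)\<close> is a binary quadratic form in \<open>w\<close>. Having
  three zeros on the projective line it vanishes identically, which leaves only scalar
  \<open>A\<close>.\<close>

lemma three_fixed_scalar: fixes A :: "'a::field^2^2"
  assumes "cr a (A *v a) = 0" "cr b (A *v b) = 0" "cr v (A *v v) = 0"
    and "cr a b \<noteq> 0" "cr a v \<noteq> 0" "cr b v \<noteq> 0"
  shows "A = mat (A$1$1)"
proof -
  define D where "D = cr a b * cr a v * cr b v"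
  have D: "D \<noteq> 0" using assms by (simp add: D_def)
  define s where "s = A$2$1"
  define e where "e = A$2$2 - A$1$1"
  define f where "f = - A$1$2"
  have Q: "cr w (A *v w) = s * w$1 * w$1 + e * w$1 * w$2 + f * w$2 * w$2" for w
    by (simp add: cr_def matrix_vector_mult_def sum_2 s_def e_def f_def algebra_simps)
  \<comment> \<open>Cramer's rule for the linear system that the three zeros impose on the
    coefficients \<open>s\<close>, \<open>e\<close>, \<open>f\<close>; up to sign \<open>D\<close>
    is its determinant, a homogeneous Vandermonde.\<close>
  have "s * D = cr a (A *v a) * b$2 * v$2 * cr b v - cr b (A *v b) * a$2 * v$2 * cr a v + cr v (A *v v) * a$2 * b$2 * cr a b"
    unfolding D_def Q by (simp add: cr_def algebra_simps)
  then have s: "s = 0" using assms D by simp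
  have "f * D = cr a (A *v a) * b$1 * v$1 * cr b v - cr b (A *v b) * a$1 * v$1 * cr a v + cr v (A *v v) * a$1 * b$1 * cr a b"
    unfolding D_def Q by (simp add: cr_def algebra_simps)
  then have f: "f = 0" using assms D by simp
  have "e * D = - (cr a (A *v a) * (b$1 * b$1 * v$2 * v$2 - b$2 * b$2 * v$1 * v$1) - cr b (A *v b) * (a$1 * a$1 * v$2 * v$2 - a$2 * a$2 * v$1 * v$1)
     + cr v (A *v v) * (a$1 * a$1 * b$2 * b$2 - a$2 * a$2 * b$1 * b$1))"
    unfolding D_def Q by (simp add: cr_def algebra_simps)
  then have e: "e = 0" using assms D by simp
  show ?thesis using s e f by (simp add: entries s_def e_def f_def)
qed

text \<open>The transvection taking \<open>x\<close> to
  \<open>x + (s * cr v x) *s v\<close>.\<close>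

definition transv :: "'a::field ^ 2 \<Rightarrow> 'a \<Rightarrow> 'a ^ 2 ^ 2" where
  "transv v s = vector [vector [1 - s * v$1 * v$2, s * v$1 * v$1], vector [- s * v$2 * v$2, 1 + s * v$1 * v$2]]"

lemma det_transv: "det (transv v s) = 1"
  by (simp add: det_2 transv_def vector_2 algebra_simps)

lemma transv_mult: "transv v s ** transv v r = transv v (s + r)"
  by (simp add: entries transv_def vector_2 algebra_simps)

lemma transv_0: "transv v 0 = mat 1"
  by (simp add: entries transv_def vector_2)

lemma cr_transv: "cr w (transv v s *v w) = - s * cr v w * cr v w"
  by (simp add: cr_def matrix_vector_mult_def sum_2 transv_def vector_2 algebra_simps)

lemma transv_fix: "transv v s *v v = v"
  by (simp add: entries transv_def vector_2 algebra_simps)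

text \<open>The product of \<open>P\<close>, the diagonal matrix of \<alpha> and \<beta>, and the
  inverse of \<open>P\<close>, written out, where \<open>P\<close> has columns \<open>v\<close> and
  \<open>w\<close>; meaningful when \<open>cr v w \<noteq> 0\<close>.\<close>

definition diag :: "'a::field ^ 2 \<Rightarrow> 'a ^ 2 \<Rightarrow> 'a \<Rightarrow> 'a \<Rightarrow> 'a ^ 2 ^ 2" where
  "diag v w \<alpha> \<beta> = vector
    [vector [(\<alpha> * w$2 * v$1 - \<beta> * v$2 * w$1) / cr v w, (\<beta> * v$1 * w$1 - \<alpha> * w$1 * v$1) / cr v w],
     vector [(\<alpha> * w$2 * v$2 - \<beta> * v$2 * w$2) / cr v w, (\<beta> * v$1 * w$2 - \<alpha> * w$1 * v$2) / cr v w]]"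

lemma divide_combine: "x * a + y * b = z * d \<Longrightarrow> d \<noteq> 0 \<Longrightarrow> x / d * a + y / d * b = (z :: 'a::field)"
  by (metis add_divide_distrib nonzero_mult_div_cancel_right times_divide_eq_left)

lemma diag_v: assumes "cr v w \<noteq> 0" shows "diag v w \<alpha> \<beta> *v v = \<alpha> *s v"
proof -
  have "(\<alpha> * w$2 * v$1 - \<beta> * v$2 * w$1) * v$1 + (\<beta> * v$1 * w$1 - \<alpha> * w$1 * v$1) * v$2 = (\<alpha> * v$1) * cr v w"
    "(\<alpha> * w$2 * v$2 - \<beta> * v$2 * w$2) * v$1 + (\<beta> * v$1 * w$2 - \<alpha> * w$1 * v$2) * v$2 = (\<alpha> * v$2) * cr v w"
    by (simp_all add: cr_def algebra_simps)
  from this[THEN divide_combine, OF assms] show ?thesis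
    by (simp add: vec_eq_iff forall_2 matrix_vector_mult_def sum_2 diag_def vector_2)
qed

lemma diag_w: assumes "cr v w \<noteq> 0" shows "diag v w \<alpha> \<beta> *v w = \<beta> *s w"
proof -
  have "(\<alpha> * w$2 * v$1 - \<beta> * v$2 * w$1) * w$1 + (\<beta> * v$1 * w$1 - \<alpha> * w$1 * v$1) * w$2 = (\<beta> * w$1) * cr v w"
    "(\<alpha> * w$2 * v$2 - \<beta> * v$2 * w$2) * w$1 + (\<beta> * v$1 * w$2 - \<alpha> * w$1 * v$2) * w$2 = (\<beta> * w$2) * cr v w"
    by (simp_all add: cr_def algebra_simps)
  from this[THEN divide_combine, OF assms] show ?thesis
    by (simp add: vec_eq_iff forall_2 matrix_vector_mult_def sum_2 diag_def vector_2)
qed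

lemma basis_eq: fixes A B :: "'a::field^2^2"
  assumes "cr v w \<noteq> 0" "A *v v = B *v v" "A *v w = B *v w" shows "A = B"
proof -
  have *: "A$i$1 = B$i$1 \<and> A$i$2 = B$i$2" for i
  proof -
    have 1: "A$i$1 * v$1 + A$i$2 * v$2 = B$i$1 * v$1 + B$i$2 * v$2"
      "A$i$1 * w$1 + A$i$2 * w$2 = B$i$1 * w$1 + B$i$2 * w$2"
      using assms(2,3) by (auto simp: vec_eq_iff matrix_vector_mult_def sum_2)
    have E: "M$i$1 * cr v w = (M$i$1 * v$1 + M$i$2 * v$2) * w$2 - (M$i$1 * w$1 + M$i$2 * w$2) * v$2"
      "M$i$2 * cr v w = (M$i$1 * w$1 + M$i$2 * w$2) * v$1 - (M$i$1 * v$1 + M$i$2 * v$2) * w$1" for M :: "'a^2^2"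
      by (simp_all add: cr_def algebra_simps)
    have "A$i$1 * cr v w = B$i$1 * cr v w" "A$i$2 * cr v w = B$i$2 * cr v w"
      unfolding E 1 by simp_all
    then show ?thesis using assms(1) by simp
  qed
  show ?thesis by (simp add: vec_eq_iff forall_2 *)
qed

lemma diag_unique: assumes "cr v w \<noteq> 0" "A *v v = \<alpha> *s v" "A *v w = \<beta> *s w" shows "A = diag v w \<alpha> \<beta>"
  using basis_eq[OF assms(1)] assms diag_v[OF assms(1)] diag_w[OF assms(1)] by simp

lemma diag_mult: assumes "cr v w \<noteq> 0" shows "diag v w \<alpha> \<beta> ** diag v w \<alpha>' \<beta>' = diag v w (\<alpha> * \<alpha>') (\<beta> * \<beta>')"
  by (rule diag_unique[OF assms])
    (simp_all add: matrix_vector_mul_assoc[symmetric] diag_v[OF assms] diag_w[OF assms] vector_scalar_commute vector_smult_assoc mult.commute)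

lemma diag_scalar: assumes "cr v w \<noteq> 0" shows "diag v w \<alpha> \<alpha> = mat \<alpha>"
  by (rule diag_unique[OF assms, symmetric]) (simp_all add: entries)

lemma det_diag: assumes "cr v w \<noteq> 0" shows "det (diag v w \<alpha> \<beta>) = \<alpha> * \<beta>"
proof -
  have "(\<alpha> * w$2 * v$1 - \<beta> * v$2 * w$1) * (\<beta> * v$1 * w$2 - \<alpha> * w$1 * v$2) - (\<beta> * v$1 * w$1 - \<alpha> * w$1 * v$1) * (\<alpha> * w$2 * v$2 - \<beta> * v$2 * w$2)
    = \<alpha> * \<beta> * (cr v w * cr v w)" by (simp add: cr_def algebra_simps)
  then show ?thesis using assms by (simp add: det_2 diag_def vector_2 divide_simps)
qed

lemma diag_inj: assumes "cr v w \<noteq> 0" "diag v w \<alpha> \<beta> = diag v w \<alpha>' \<beta>'" shows "\<alpha> = \<alpha>' \<and> \<beta> = \<beta>'"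
proof -
  have nz: "v \<noteq> 0" "w \<noteq> 0" using assms(1) by (auto simp: cr_def)
  have "\<alpha> *s v = \<alpha>' *s v" "\<beta> *s w = \<beta>' *s w" using assms diag_v diag_w by metis+
  then show ?thesis using nz by (simp add: vector_mul_rcancel)
qed

section \<open>The quadratic field of an anisotropic matrix\<close>

text \<open>
  A matrix without eigenvectors is called anisotropic; the algebra \<open>alg B\<close> it generates is then a field
  with \<open>q^2\<close> elements, whose unit group is a nonsplit torus.
\<close>

definition lin :: "'a::field ^ 2 ^ 2 \<Rightarrow> 'a \<Rightarrow> 'a \<Rightarrow> 'a ^ 2 ^ 2" where
  "lin B a b = mat a + mat b ** B"

definition alg :: "'a::field ^ 2 ^ 2 \<Rightarrow> ('a ^ 2 ^ 2) set" where
  "alg B = {lin B a b | a b. True}"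

definition anis :: "'a::field ^ 2 ^ 2 \<Rightarrow> bool" where
  "anis B \<longleftrightarrow> (\<forall>v. v \<noteq> 0 \<longrightarrow> cr v (B *v v) \<noteq> 0)"

lemma lin_entries: "lin B a b $ 1 $ 1 = a + b * B$1$1" "lin B a b $ 1 $ 2 = b * B$1$2"
  "lin B a b $ 2 $ 1 = b * B$2$1" "lin B a b $ 2 $ 2 = a + b * B$2$2"
  by (simp_all add: lin_def mat_mult_left) (simp_all add: mat_def)

lemma cr_lin: "cr v (lin B a b *v v) = b * cr v (B *v v)"
  by (simp add: cr_def matrix_vector_mult_def sum_2 lin_entries algebra_simps)

lemma anis_21: assumes "anis B" shows "B$2$1 \<noteq> 0"
proof -
  have "cr (vector [1, 0]) (B *v vector [1, 0]) \<noteq> 0" using assms unfolding anis_def by (auto simp: vec2_nz vector_2)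
  then show ?thesis by (simp add: cr_def matrix_vector_mult_def sum_2 vector_2)
qed

lemma det_lin: assumes "anis B" "a \<noteq> 0 \<or> b \<noteq> 0" shows "det (lin B a b) \<noteq> 0"
proof -
  have s: "B$2$1 \<noteq> 0" using anis_21[OF assms(1)] .
  \<comment> \<open>The first column of \<open>X = lin B a b\<close>. As \<open>X\<close> commutes
    with \<open>B\<close>, the form at this vector is \<open>det X\<close> times its value
    \<open>B$2$1\<close> at the first unit vector.\<close>
  define v where "v = (vector [a + b * B$1$1, B$2$1 * b] :: 'a^2)"
  have "v \<noteq> 0" using assms(2) s by (auto simp: vec2_nz v_def vector_2)
  then have "cr v (B *v v) \<noteq> 0" using assms(1) by (simp add: anis_def)
  moreover have "B$2$1 * det (lin B a b) = cr v (B *v v)"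
    by (simp add: det_2 lin_entries v_def cr_def matrix_vector_mult_def sum_2 vector_2 algebra_simps)
  ultimately show ?thesis by auto
qed

lemma lin_inj: assumes "anis B" "lin B a b = lin B a' b'" shows "a = a' \<and> b = b'"
  using anis_21[OF assms(1)] assms(2) by (auto simp: vec_eq_iff forall_2 lin_entries)

lemma lin_mat: "lin B a 0 = mat a"
  by (simp add: lin_def)

lemma lin_add: "lin B a b + lin B a' b' = lin B (a + a') (b + b')"
  by (simp add: vec_eq_iff forall_2 lin_entries algebra_simps)

text \<open>Cayley-Hamilton expresses the square of \<open>B\<close> through its trace and
  determinant.\<close>

lemma lin_mult: "lin B a b ** lin B a' b' = lin B (a * a' - b * b' * det B) (a * b' + b * a' + b * b' * (B$1$1 + B$2$2))"
  by (simp add: vec_eq_iff forall_2 matrix_matrix_mult_def sum_2 lin_entries det_2 algebra_simps)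

lemma lin_commute: "lin B a b ** lin B a' b' = lin B a' b' ** lin B a b"
  by (simp add: lin_mult algebra_simps)

text \<open>A nonscalar two-by-two matrix has no centralizer beyond the algebra that it generates;
  \<open>B$2$1 \<noteq> 0\<close> makes the coefficients explicit.\<close>

lemma alg_commutant: assumes "anis B" "X ** B = B ** X" shows "X \<in> alg B"
proof -
  have s: "B$2$1 \<noteq> 0" using anis_21[OF assms(1)] .
  define b where "b = X$2$1 / B$2$1"
  have e: "X$1$2 * B$2$1 = B$1$2 * X$2$1" "X$2$1 * B$1$1 + X$2$2 * B$2$1 = B$2$1 * X$1$1 + B$2$2 * X$2$1"
    using assms(2) by (simp_all add: vec_eq_iff forall_2 matrix_matrix_mult_def sum_2)
  have "X = lin B (X$1$1 - b * B$1$1) b"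
    using e s by (simp add: vec_eq_iff forall_2 lin_entries b_def field_simps)
  then show ?thesis by (auto simp: alg_def)
qed

lemma lin_lin: "lin (lin B a b) a' b' = lin B (a' + b' * a) (b' * b)"
  by (simp add: vec_eq_iff forall_2 lin_entries algebra_simps)

text \<open>The reason why two different fields of this kind share only the scalars.\<close>

lemma alg_eq: assumes "A \<in> alg B" "\<nexists>c. A = mat c" shows "alg A = alg B"
proof -
  obtain a b where A: "A = lin B a b" using assms(1) by (auto simp: alg_def)
  have b: "b \<noteq> 0" using assms(2) A lin_mat by metis
  have "lin B x y \<in> alg A" for x y
  proof -
    have "lin B x y = lin A (x - y / b * a) (y / b)" using b by (simp add: A lin_lin)
    then show ?thesis unfolding alg_def by blast
  qed
  moreover have "lin A x y \<in> alg B" for x y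
    unfolding A lin_lin alg_def by blast
  ultimately show ?thesis unfolding alg_def by blast
qed

lemma anis_lin: assumes "anis B" "b \<noteq> 0" shows "anis (lin B a b)"
  using assms by (simp add: anis_def cr_lin)

section \<open>Powers and cyclic unit groups\<close>

definition mpow :: "'a::field^2^2 \<Rightarrow> nat \<Rightarrow> 'a^2^2" where "mpow A k = ((**) A ^^ k) (mat 1)"

lemma mpow_0 [simp]: "mpow A 0 = mat 1" by (simp add: mpow_def)
lemma mpow_Suc: "mpow A (Suc k) = A ** mpow A k" by (simp add: mpow_def)

lemma mpow_add: "mpow A (m + n) = mpow A m ** mpow A n"
  by (induction m) (simp_all add: mpow_Suc matrix_mul_assoc)

lemma mpow_mult: "mpow A (m * n) = mpow (mpow A m) n"
  by (induction n) (simp_all add: mpow_Suc mpow_add)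

lemma det_mpow: "det (mpow A k) = det A ^ k"
  by (induction k) (simp_all add: mpow_Suc det_mul)

text \<open>Such a set is a finite field, whose unit group is cyclic. Stated for sets of matrices,
  it serves both the scalars and the fields \<open>alg B\<close>.\<close>

lemma matrix_field_generator:
  fixes K :: "('a::{field,finite}^2^2) set"
  assumes one: "mat 1 \<in> K" and zero: "0 \<in> K"
    and add: "\<And>A B. A \<in> K \<Longrightarrow> B \<in> K \<Longrightarrow> A + B \<in> K" and neg: "\<And>A. A \<in> K \<Longrightarrow> - A \<in> K"
    and mul: "\<And>A B. A \<in> K \<Longrightarrow> B \<in> K \<Longrightarrow> A ** B \<in> K" and comm: "\<And>A B. A \<in> K \<Longrightarrow> B \<in> K \<Longrightarrow> A ** B = B ** A"
    and inv: "\<And>A. A \<in> K \<Longrightarrow> A \<noteq> 0 \<Longrightarrow> \<exists>B\<in>K. A ** B = mat 1"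
  shows "\<exists>g\<in>K. g \<noteq> 0 \<and> K - {0} = range (mpow g)"
proof -
  define R :: "('a^2^2) ring" where "R = \<lparr>carrier = K, monoid.mult = (**), one = mat 1, ring.zero = 0, add = (+)\<rparr>"
  have 1: "mat 1 \<noteq> (0 :: 'a^2^2)" by (simp add: vec_eq_iff forall_2 mat_def)
  have "abelian_group R"
  proof (rule abelian_groupI)
    show "x \<oplus>\<^bsub>R\<^esub> y \<in> carrier R" if "x \<in> carrier R" "y \<in> carrier R" for x y
      using that add by (simp add: R_def)
    show "\<zero>\<^bsub>R\<^esub> \<in> carrier R" using zero by (simp add: R_def)
    show "\<exists>y\<in>carrier R. y \<oplus>\<^bsub>R\<^esub> x = \<zero>\<^bsub>R\<^esub>" if "x \<in> carrier R" for x
      using neg[of x] that by (intro bexI[of _ "- x"]) (simp_all add: R_def)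
  qed (simp_all add: R_def add.assoc add.commute)
  moreover have "comm_monoid R"
  proof (rule comm_monoidI)
    show "x \<otimes>\<^bsub>R\<^esub> y \<in> carrier R" if "x \<in> carrier R" "y \<in> carrier R" for x y
      using that mul by (simp add: R_def)
    show "\<one>\<^bsub>R\<^esub> \<in> carrier R" using one by (simp add: R_def)
    show "x \<otimes>\<^bsub>R\<^esub> y = y \<otimes>\<^bsub>R\<^esub> x" if "x \<in> carrier R" "y \<in> carrier R" for x y
      using comm[of x y] that by (simp add: R_def)
  qed (simp_all add: R_def matrix_mul_assoc)
  ultimately have "cring R"
    by (intro cringI) (simp_all add: R_def vec_eq_iff forall_2 matrix_matrix_mult_def sum_2 algebra_simps)
  then interpret R: cring R .
  interpret F: field R
  proof (rule R.cring_fieldI)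
    have "A \<in> Units R \<longleftrightarrow> A \<in> K - {0}" for A
    proof
      assume "A \<in> Units R"
      then obtain B where "A \<in> K" "B \<in> K" "A ** B = mat 1" by (auto simp: Units_def R_def)
      then show "A \<in> K - {0}" using 1 by auto
    next
      assume A: "A \<in> K - {0}"
      then obtain B where "B \<in> K" "A ** B = mat 1" using inv by blast
      then show "A \<in> Units R" using A comm[of A B] by (auto simp: Units_def R_def)
    qed
    then show "Units R = carrier R - {\<zero>\<^bsub>R\<^esub>}" by (auto simp: R_def)
  qed
  have pw: "a [^]\<^bsub>R\<^esub> (i::nat) = mpow a i" if "a \<in> K" for a i
  proof (induction i)
    case (Suc i)
    have "mpow a i \<in> K" by (induction i) (auto simp: mpow_Suc one mul that)
    then show ?case using Suc comm[of a "mpow a i"] that by (simp add: mpow_Suc) (simp add: R_def)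
  qed (simp add: R_def)
  obtain a where a: "a \<in> carrier (mult_of R)" "carrier (mult_of R) = {a[^]\<^bsub>R\<^esub>i | i::nat . i \<in> UNIV}"
    using F.finite_field_mult_group_has_gen by (auto simp: R_def)
  then have "a \<in> K" "a \<noteq> 0" "K - {0} = {a[^]\<^bsub>R\<^esub>i | i::nat . i \<in> UNIV}" by (auto simp: R_def)
  then show ?thesis using pw by (intro bexI[of _ a]) auto
qed

text \<open>The base field is embedded as the scalar matrices, to which
  \<open>matrix_field_generator\<close> applies.\<close>

lemma field_generator: "\<exists>g::'a::{field,finite}. g \<noteq> 0 \<and> (\<forall>x. x \<noteq> 0 \<longrightarrow> (\<exists>k::nat. x = g ^ k))"
proof -
  let ?K = "range mat :: ('a^2^2) set"
  have m: "mat x = (mat y :: 'a^2^2) \<longleftrightarrow> x = y" for x y by (auto simp: vec_eq_iff forall_2 mat_def)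
  have m0: "(0 :: 'a^2^2) = mat 0" by simp
  have "\<exists>g\<in>?K. g \<noteq> 0 \<and> ?K - {0} = range (mpow g)"
  proof (rule matrix_field_generator)
    show "0 \<in> ?K" unfolding m0 by blast
    show "A + B \<in> ?K" if AB: "A \<in> ?K" "B \<in> ?K" for A B
    proof -
      obtain a b where "A = mat a" "B = mat b" using AB by blast
      then have "A + B = mat (a + b)" by (simp add: vec_eq_iff mat_def)
      then show ?thesis by blast
    qed
    show "- A \<in> ?K" if A: "A \<in> ?K" for A
    proof -
      obtain a where "A = mat a" using A by blast
      then have "- A = mat (- a)" by (simp add: vec_eq_iff mat_def)
      then show ?thesis by blast
    qed
    show "\<exists>B\<in>?K. A ** B = mat 1" if A: "A \<in> ?K" "A \<noteq> 0" for A
    proof -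
      obtain a where "A = mat a" using A by blast
      moreover from this have "a \<noteq> 0" using A by auto
      ultimately have "A ** mat (1 / a) = mat 1" by (simp add: mat_mult_mat)
      then show ?thesis by blast
    qed
  qed (auto simp: mat_mult_mat mult.commute)
  then obtain g where g: "mat g \<noteq> (0 :: 'a^2^2)" "?K - {0} = range (mpow (mat g))" by blast
  have pw: "mpow (mat g) k = (mat (g ^ k) :: 'a^2^2)" for k
    by (induction k) (simp_all add: mpow_Suc mat_mult_mat)
  have "\<exists>k. x = g ^ k" if "x \<noteq> 0" for x
  proof -
    have "mat x \<in> ?K - {0}" using that m[of x 0] by simp
    then obtain k where "(mat x :: 'a^2^2) = mat (g ^ k)" unfolding g(2) using pw by auto
    then show ?thesis using m by blast
  qed
  moreover have "g \<noteq> 0" using g m m0 by auto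
  ultimately show ?thesis by blast
qed

lemma alg_det: assumes "anis B" "A \<in> alg B" "A \<noteq> 0" shows "det A \<noteq> 0"
proof -
  obtain a b where A: "A = lin B a b" using assms(2) by (auto simp: alg_def)
  then have "a \<noteq> 0 \<or> b \<noteq> 0" using assms(3) by (auto simp: lin_mat)
  then show ?thesis using det_lin[OF assms(1)] A by simp
qed

lemma alg_mult: "A \<in> alg B \<Longrightarrow> A' \<in> alg B \<Longrightarrow> A ** A' \<in> alg B"
  unfolding alg_def using lin_mult[of B] by blast

lemma alg_commute: "A \<in> alg B \<Longrightarrow> A' \<in> alg B \<Longrightarrow> A ** A' = A' ** A"
  by (auto simp: alg_def intro: lin_commute)

lemma mat_in_alg: "mat a \<in> alg B"
  using lin_mat[of B a] by (auto simp: alg_def) metis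

lemma self_in_alg: "B \<in> alg B"
proof -
  have "B = lin B 0 1" by (simp add: lin_def)
  then show ?thesis unfolding alg_def by blast
qed

text \<open>The inverse commutes with \<open>B\<close> because \<open>A\<close> does, so it lies in
  the centralizer \<open>alg B\<close>.\<close>

lemma alg_inverse: assumes "anis B" "A \<in> alg B" "A \<noteq> 0" shows "\<exists>A'\<in>alg B. A ** A' = mat 1"
proof -
  obtain A' where A': "A ** A' = mat 1" "A' ** A = mat 1"
    using alg_det[OF assms] invertible_det_nz[of A] by (auto simp: invertible_def)
  have "A' ** B = A' ** (B ** A) ** A'" by (simp add: matrix_mul_assoc[symmetric] A')
  also have "\<dots> = A' ** (A ** B) ** A'" using alg_commute[OF assms(2) self_in_alg] by simp
  also have "\<dots> = B ** A'" by (simp add: matrix_mul_assoc A')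
  finally have "A' \<in> alg B" using alg_commutant[OF assms(1)] by blast
  then show ?thesis using A' by blast
qed

lemma alg_generator: fixes B :: "'a::{field,finite}^2^2" assumes "anis B"
  shows "\<exists>g\<in>alg B. g \<noteq> 0 \<and> alg B - {0} = range (mpow g)"
proof (rule matrix_field_generator)
  show "0 \<in> alg B" using mat_in_alg[of 0 B] by simp
  show "A + A' \<in> alg B" if "A \<in> alg B" "A' \<in> alg B" for A A'
    using that lin_add[of B] unfolding alg_def by blast
  show "- A \<in> alg B" if "A \<in> alg B" for A
  proof -
    have "- lin B a b = lin B (- a) (- b)" for a b by (simp add: vec_eq_iff forall_2 lin_entries)
    then show ?thesis using that unfolding alg_def by blast
  qed
qed (use alg_mult alg_commute alg_inverse[OF assms] mat_in_alg in auto)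

lemma card_alg: fixes B :: "'a::{field,finite}^2^2" assumes "anis B" shows "card (alg B) = CARD('a) ^ 2"
proof -
  have "alg B = (\<lambda>(a, b). lin B a b) ` UNIV" by (auto simp: alg_def)
  moreover have "inj (\<lambda>(a, b). lin B a b)" using lin_inj[OF assms] by (auto simp: inj_on_def)
  ultimately have "card (alg B) = card (UNIV :: ('a \<times> 'a) set)" using card_image by metis
  then show ?thesis by (simp add: power2_eq_square)
qed

section \<open>Squares and norms in finite fields\<close>

lemma card_squares: "CARD('a::{field,finite}) + 1 \<le> 2 * card (range (\<lambda>x::'a. x * x))"
proof -
  let ?S = "range (\<lambda>x::'a. x * x)"
  have "UNIV - {0} = (\<Union>y\<in>?S - {0}. {x. x * x = y})" by auto
  then have "card (UNIV - {0 :: 'a}) = card (\<Union>y\<in>?S - {0}. {x. x * x = y})" by simp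
  \<comment> \<open>Squaring is at most two-to-one on nonzero elements; zero is one further
    square.\<close>
  also have "\<dots> \<le> (\<Sum>y\<in>?S - {0}. card {x. x * x = y})"
    by (rule card_UN_le) simp
  also have "\<dots> \<le> (\<Sum>y\<in>?S - {0}. 2)"
  proof (rule sum_mono)
    fix y assume "y \<in> ?S - {0}"
    then obtain z where "y = z * z" by blast
    then have "{x. x * x = y} \<subseteq> {z, - z}" by (auto simp: square_eq_iff)
    then have "card {x. x * x = y} \<le> card {z, - z}" by (intro card_mono) auto
    also have "\<dots> \<le> 2" by (simp add: card_insert_if)
    finally show "card {x. x * x = y} \<le> 2" .
  qed
  also have "\<dots> = 2 * (card ?S - 1)"
  proof -
    have "0 \<in> ?S" by (rule range_eqI[of _ _ 0]) simp
    then show ?thesis by (simp add: card_Diff_singleton)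
  qed
  finally have 1: "CARD('a) - 1 \<le> 2 * (card ?S - 1)" by (simp add: card_Diff_singleton)
  have "card ?S \<ge> 1" by (simp add: Suc_le_eq card_gt_0_iff)
  moreover have "CARD('a) \<ge> 1" by simp
  ultimately show ?thesis using 1 by linarith
qed

lemma char2_sqrt: assumes "(1::'a::{field,finite}) + 1 = 0" shows "\<exists>y. y * y = (x :: 'a)"
proof -
  have "inj (\<lambda>x::'a. x * x)"
  proof (rule injI)
    fix x y :: 'a assume "x * x = y * y"
    then have "x = y \<or> x = - y" by (simp add: square_eq_iff)
    moreover have "- y = y" using assms by (metis add_eq_0_iff mult_minus1 mult_1)
    ultimately show "x = y" by auto
  qed
  then have "surj (\<lambda>x::'a. x * x)" by (rule finite_UNIV_inj_surj[OF finite])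
  then show ?thesis by (metis surjD)
qed

text \<open>In any other characteristic squaring is exactly two-to-one on the nonzero elements, so
  these are even in number and the field has odd size.\<close>

lemma even_char2: assumes "even (CARD('a::{field,finite}))" shows "(1::'a) + 1 = 0"
proof (rule ccontr)
  assume nz: "(1::'a) + 1 \<noteq> 0"
  let ?S = "range (\<lambda>x::'a. x * x)"
  have "UNIV - {0} = (\<Union>y\<in>?S - {0}. {x. x * x = y})" by auto
  then have "card (UNIV - {0 :: 'a}) = card (\<Union>y\<in>?S - {0}. {x. x * x = y})" by simp
  also have "\<dots> = (\<Sum>y\<in>?S - {0}. card {x. x * x = y})" by (rule card_UN_disjoint) auto
  also have "\<dots> = (\<Sum>y\<in>?S - {0}. 2)"
  proof (rule sum.cong[OF refl])
    fix y assume "y \<in> ?S - {0}"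
    then obtain z where z: "y = z * z" "z \<noteq> 0" by auto
    then have "{x. x * x = y} = {z, - z}" by (auto simp: square_eq_iff)
    moreover have "z \<noteq> - z"
    proof
      assume "z = - z"
      then have "z * (1 + 1) = 0" by (simp only: distrib_left mult_1_right eq_neg_iff_add_eq_0)
      then show False using nz z by simp
    qed
    ultimately show "card {x. x * x = y} = 2" by simp
  qed
  finally have "card (UNIV - {0 :: 'a}) = 2 * card (?S - {0})" by simp
  moreover have "CARD('a) = Suc (card (UNIV - {0 :: 'a}))" using card_Suc_Diff1[of UNIV "0::'a"] by simp
  ultimately obtain n where n: "CARD('a) = Suc (2 * n)" by metis
  show False using assms unfolding n by simp
qed

text \<open>On \<open>alg B\<close> the determinant is the norm to the base field. In characteristic
  2 scalars already attain every norm; otherwise a diagonal form of the norm and the pigeonhole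
  principle do.\<close>

lemma alg_det_surj: fixes B :: "'a::{field,finite}^2^2" assumes B: "anis B" shows "\<exists>A\<in>alg B. det A = x"
proof (cases "(1::'a) + 1 = 0")
  case True
  then obtain y where "y * y = x" using char2_sqrt by blast
  then have "det (mat y :: 'a^2^2) = x" by (simp add: det_2 mat_def)
  then show ?thesis using mat_in_alg by blast
next
  case False
  \<comment> \<open>Half the trace of \<open>B\<close>. Shifting by it makes the generator traceless
    and the norm form \<open>a * a + b * b * e\<close>.\<close>
  define h where "h = (B$1$1 + B$2$2) / (1 + 1)"
  define e where "e = det (lin B (- h) 1)"
  have e: "e \<noteq> 0" unfolding e_def by (rule det_lin[OF B]) simp
  have hh: "B$2$2 - h = - (B$1$1 - h)" using False by (simp add: h_def field_simps)
  have norm: "det (lin B (a - b * h) b) = a * a + b * b * e" for a b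
  proof -
    have u: "B$2$2 = h - (B$1$1 - h)" using hh by (simp add: algebra_simps)
    show ?thesis unfolding e_def det_2 lin_entries u by (simp add: algebra_simps)
  qed
  let ?S = "range (\<lambda>x::'a. x * x)"
  let ?S' = "(\<lambda>y. x - y * e) ` ?S"
  have "card ?S' = card ?S" using e by (intro card_image) (auto simp: inj_on_def)
  \<comment> \<open>Each of the two sets contains more than half of the field.\<close>
  have "?S \<inter> ?S' \<noteq> {}"
  proof
    assume "?S \<inter> ?S' = {}"
    then have "card (?S \<union> ?S') = card ?S + card ?S'" by (intro card_Un_disjoint) auto
    moreover have "card (?S \<union> ?S') \<le> CARD('a)" by (rule card_mono) auto
    ultimately show False using card_squares[where 'a = 'a] \<open>card ?S' = card ?S\<close> by linarith
  qed
  then obtain a b where "a * a = x - (b * b) * e" by blast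
  then have "det (lin B (a - b * h) b) = x" by (simp add: norm)
  then show ?thesis unfolding alg_def by blast
qed

text \<open>Multiplication by an element of norm \<open>x\<close> maps the fibre over 1 onto the
  fibre over \<open>x\<close>, so the \<open>q^2 - 1\<close> units split evenly over
  \<open>q - 1\<close> norms.\<close>

lemma card_norm_one: fixes B :: "'a::{field,finite}^2^2" assumes B: "anis B"
  shows "card {A \<in> alg B. det A = 1} = CARD('a) + 1"
proof -
  let ?f = "\<lambda>x. {A \<in> alg B. det A = x}"
  have fib: "card (?f x) = card (?f 1)" if x: "x \<noteq> 0" for x
  proof -
    obtain X where X: "X \<in> alg B" "det X = x" using alg_det_surj[OF B] by blast
    have X0: "X \<noteq> 0" using X x by (auto simp: det_2)
    obtain Y where Y: "Y \<in> alg B" "X ** Y = mat 1" using alg_inverse[OF B X(1) X0] by blast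
    have Y': "Y ** X = mat 1" using Y alg_commute X by metis
    have dY: "det Y * x = 1" using Y' X det_mul[of Y X] by simp
    have "bij_betw (\<lambda>A. X ** A) (?f 1) (?f x)"
    proof (rule bij_betwI[where g = "\<lambda>A. Y ** A"])
      show "(\<lambda>A. X ** A) \<in> ?f 1 \<rightarrow> ?f x" using alg_mult[OF X(1)] X(2) by (simp add: det_mul)
      show "(\<lambda>A. Y ** A) \<in> ?f x \<rightarrow> ?f 1" using alg_mult[OF Y(1)] dY by (simp add: det_mul)
      show "Y ** (X ** A) = A" for A by (simp add: matrix_mul_assoc Y')
      show "X ** (Y ** A) = A" for A by (simp add: matrix_mul_assoc Y(2))
    qed
    then show ?thesis by (rule bij_betw_same_card[symmetric])
  qed
  have d0: "det (0 :: 'a^2^2) = 0" by (simp add: det_2)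
  have "alg B - {0} = (\<Union>x\<in>UNIV - {0}. ?f x)"
  proof (rule Set.set_eqI)
    fix A
    have "A \<noteq> 0 \<longleftrightarrow> det A \<noteq> 0" if "A \<in> alg B" using alg_det[OF B that] d0 by metis
    then show "A \<in> alg B - {0} \<longleftrightarrow> A \<in> (\<Union>x\<in>UNIV - {0}. ?f x)" by simp blast
  qed
  then have "card (alg B - {0}) = card (\<Union>x\<in>UNIV - {0}. ?f x)" by (rule arg_cong)
  also have "\<dots> = (\<Sum>x\<in>UNIV - {0::'a}. card (?f x))" by (rule card_UN_disjoint) auto
  also have "\<dots> = (\<Sum>x\<in>UNIV - {0::'a}. card (?f 1))" by (rule sum.cong[OF refl], rule fib) simp
  also have "\<dots> = (CARD('a) - 1) * card (?f 1)" by (simp add: card_Diff_singleton)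
  finally have "(CARD('a) - 1) * card (?f 1) = CARD('a) ^ 2 - 1"
    using card_alg[OF B] mat_in_alg[of 0 B] by (simp add: card_Diff_singleton)
  also have "\<dots> = (CARD('a) - 1) * (CARD('a) + 1)" by (simp add: power2_eq_square algebra_simps)
  finally have "(CARD('a) - 1) * card (?f 1) = (CARD('a) - 1) * (CARD('a) + 1)" .
  moreover have "CARD('a) - 1 \<noteq> 0"
  proof -
    have "card {0, 1 :: 'a} \<le> CARD('a)" by (rule card_mono) auto
    then show ?thesis by simp
  qed
  ultimately show ?thesis by (subst (asm) mult_left_cancel) auto
qed

section \<open>Conjugation, commutators and the field automorphism\<close>

lemma trace_conj: assumes "X ** X' = mat 1" "X' ** X = mat 1" shows "trace (X ** A ** X') = trace (A :: 'a::field^2^2)"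
  using trace_mul_sym[of "X ** A" X'] by (simp add: matrix_mul_assoc assms)

lemma trace_2: "trace (A :: 'a::comm_ring_1^2^2) = A$1$1 + A$2$2"
  by (simp add: trace_def sum_2)

text \<open>\<open>A'\<close> is conjugate to \<open>A\<close>, so it has the same trace and
  determinant and is a root of the same quadratic polynomial over a field. The roots of that
  polynomial are \<open>A\<close> and its Galois conjugate \<open>mat (trace A) - A\<close>.\<close>

lemma alg_conjugate: assumes A: "anis A" and A': "A' \<in> alg A" and X: "det X \<noteq> 0" "X ** A = A' ** X"
  shows "A' = A \<or> A' = mat (trace A) - A"
proof -
  obtain X' where X': "X ** X' = mat 1" "X' ** X = mat 1" using X invertible_det_nz[of X] by (auto simp: invertible_def)
  have eq: "A' = X ** A ** X'" using X(2) X' by (simp add: matrix_mul_assoc[symmetric])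
  have tr: "trace A' = trace A" unfolding eq by (rule trace_conj[OF X'])
  have "det A' * det X = det A * det X" using X(2) det_mul[of X A] det_mul[of A' X] by (simp add: mult.commute)
  then have dt: "det A' = det A" using X(1) by simp
  obtain a b where ab: "A' = lin A a b" using A' by (auto simp: alg_def)
  have 1: "2 * a + b * trace A = trace A" using tr by (simp add: ab trace_2 lin_entries algebra_simps)
  have 2: "a * a + a * b * trace A + b * b * det A = det A" using dt by (simp add: ab trace_2 det_2 lin_entries algebra_simps)
  have "a = 0 \<and> b = 1 \<or> a = trace A \<and> b = - 1"
  proof (cases "a = 0 \<and> b = 1")
    case False
    then have nz: "det (lin A a (b - 1)) \<noteq> 0" by (intro det_lin[OF A]) auto
    \<comment> \<open>The two factors are the differences of \<open>A'\<close> from the two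
      roots.\<close>
    have "lin A a (b - 1) ** lin A (a - trace A) (b + 1) = 0"
    proof -
      have "a * (a - trace A) - (b - 1) * (b + 1) * det A =
          a * (2 * a + b * trace A - trace A) - (a * a + a * b * trace A + b * b * det A - det A)"
        by (simp add: algebra_simps)
      moreover have "a * (b + 1) + (b - 1) * (a - trace A) + (b - 1) * (b + 1) * trace A = b * (2 * a + b * trace A - trace A)"
        by (simp add: algebra_simps)
      ultimately have "a * (a - trace A) - (b - 1) * (b + 1) * det A = 0"
        "a * (b + 1) + (b - 1) * (a - trace A) + (b - 1) * (b + 1) * trace A = 0"
        using 1 2 by simp_all
      then show ?thesis unfolding lin_mult by (simp add: trace_2 lin_mat)
    qed
    then have "det (lin A (a - trace A) (b + 1)) = 0" using nz det_mul[of "lin A a (b - 1)" "lin A (a - trace A) (b + 1)"]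
      by (simp add: det_2)
    then have "a - trace A = 0 \<and> b + 1 = 0" using det_lin[OF A] by blast
    then show ?thesis by (simp add: eq_neg_iff_add_eq_0)
  qed simp
  then show ?thesis by (auto simp: ab vec_eq_iff forall_2 lin_entries mat_def)
qed

text \<open>Follows from Cayley-Hamilton for \<open>A\<close>. An invertible commutator therefore
  acts by conjugation on \<open>alg A\<close> as the field automorphism exchanging the two
  roots.\<close>

lemma commutator_semi:
  fixes A B :: "'a::field^2^2"
  shows "(A ** B - B ** A) ** A = (mat (trace A) - A) ** (A ** B - B ** A)"
  by (simp add: vec_eq_iff forall_2 matrix_matrix_mult_def sum_2 mat_def trace_2 algebra_simps)

text \<open>By \<open>commutator_semi\<close> the kernel of the commutator is stable under
  \<open>A\<close>. An anisotropic \<open>A\<close> has no invariant line, so a nonzero kernel would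
  be everything, and \<open>B\<close> would commute with \<open>A\<close>.\<close>

lemma commutator_det: assumes A: "anis A" and B: "B \<notin> alg A" shows "det (A ** B - B ** A) \<noteq> 0"
proof
  define N where "N = A ** B - B ** A"
  assume "det (A ** B - B ** A) = 0"
  then have d: "det N = 0" by (simp add: N_def)
  have "N \<noteq> 0" using alg_commutant[OF A, of B] B by (auto simp: N_def)
  have NA: "N ** A = (mat (trace A) - A) ** N" unfolding N_def by (rule commutator_semi)
  obtain v where v: "v \<noteq> 0" "N *v v = 0"
  proof (cases "N$1$1 = 0 \<and> N$1$2 = 0")
    case True
    then have "\<not> (N$2$1 = 0 \<and> N$2$2 = 0)" using \<open>N \<noteq> 0\<close> by (auto simp: vec_eq_iff forall_2)
    then have "vector [N$2$2, - N$2$1] \<noteq> (0 :: 'a^2)" by (auto simp: vec2_nz vector_2)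
    moreover have "N *v vector [N$2$2, - N$2$1] = 0"
      using True by (simp add: vec_eq_iff forall_2 matrix_vector_mult_def sum_2 vector_2)
    ultimately show ?thesis using that by blast
  next
    case False
    then have "vector [N$1$2, - N$1$1] \<noteq> (0 :: 'a^2)" by (auto simp: vec2_nz vector_2)
    moreover have "N *v vector [N$1$2, - N$1$1] = 0"
      using d by (simp add: vec_eq_iff forall_2 matrix_vector_mult_def sum_2 vector_2 det_2 algebra_simps)
    ultimately show ?thesis using that by blast
  qed
  have "N *v (A *v v) = (mat (trace A) - A) *v (N *v v)" by (simp add: matrix_vector_mul_assoc NA)
  then have "N *v (A *v v) = 0" using v by simp
  moreover have "cr v (A *v v) \<noteq> 0" using A v by (simp add: anis_def)
  ultimately have "N = 0" using basis_eq[of v "A *v v" N 0] v by simp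
  then show False using \<open>N \<noteq> 0\<close> by simp
qed

text \<open>With trace zero in characteristic 2 the mixed term of the form
  \<open>cr v (A *v v)\<close> disappears, and square roots of the off-diagonal entries give a zero
  of it.\<close>

lemma anis_trace: fixes A :: "'a::{field,finite}^2^2" assumes c: "(1::'a) + 1 = 0" and A: "anis A" shows "trace A \<noteq> 0"
proof
  assume "trace A = 0"
  then have u: "A$2$2 = - A$1$1" by (simp add: trace_2 eq_neg_iff_add_eq_0 add.commute)
  have neg: "- x = x" for x :: 'a using c by (metis add_eq_0_iff mult_minus1 mult_1)
  obtain x y where xy: "x * x = A$1$2" "y * y = A$2$1" using char2_sqrt[OF c] by metis
  have "A$2$1 \<noteq> 0" using anis_21[OF A] .
  then have "vector [x, y] \<noteq> (0 :: 'a^2)" using xy by (auto simp: vec2_nz vector_2)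
  moreover have "cr (vector [x, y]) (A *v vector [x, y]) = 0"
  proof -
    have "cr (vector [x, y]) (A *v vector [x, y]) = (x * x) * A$2$1 - (y * y) * A$1$2 + x * y * (A$2$2 - A$1$1)"
      by (simp add: cr_def matrix_vector_mult_def sum_2 vector_2 algebra_simps)
    also have "\<dots> = 0" unfolding xy using neg[of "A$1$1"] u by simp
    finally show ?thesis .
  qed
  ultimately show False using A by (simp add: anis_def)
qed

lemma conj_flip: fixes A X :: "'a::field^2^2"
  assumes "X ** A = (mat s - A) ** X" shows "X ** (mat s - A) = A ** X"
proof -
  have "X ** (mat s - A) + X ** A = (mat s - A) ** X + A ** X"
    by (simp add: vec_eq_iff forall_2 matrix_matrix_mult_def sum_2 mat_def algebra_simps)
  then show ?thesis using assms by simp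
qed

section \<open>The projective groups\<close>

definition scal where "scal M = scalar_matrices \<inter> carrier M"

text \<open>Collects what differs between \<open>GL\<close> and \<open>SL\<close>: the orders of
  both kinds of tori and their generators. Generators are taken modulo scalars, since the diagonal
  matrices of \<open>GL\<close> form no cyclic group themselves.\<close>

locale matrix_quotient =
  fixes M :: "('a::{field,finite} ^ 2 ^ 2) monoid" and t c d :: nat
  assumes M_cases: "M = GL \<or> M = SL"
    and split_card: "\<And>v w. cr v w \<noteq> 0 \<Longrightarrow>
      card {A \<in> carrier M. cr v (A *v v) = 0 \<and> cr w (A *v w) = 0} = t * card (scal M)"
    and split_gen: "\<And>v w. cr v w \<noteq> 0 \<Longrightarrow>
      \<exists>g \<in> {A \<in> carrier M. cr v (A *v v) = 0 \<and> cr w (A *v w) = 0}.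
      \<forall>A \<in> {A \<in> carrier M. cr v (A *v v) = 0 \<and> cr w (A *v w) = 0}. \<exists>k x. A = mat x ** mpow g k"
    and alg_card: "\<And>B. anis B \<Longrightarrow> card (alg B \<inter> carrier M) = c * card (scal M)"
    and alg_gen: "\<And>B. anis B \<Longrightarrow> \<exists>g \<in> alg B \<inter> carrier M. \<forall>A \<in> alg B \<inter> carrier M. \<exists>k x. A = mat x ** mpow g k"
    and q3: "CARD('a) \<ge> 3" and dt: "d * t + 1 = CARD('a)" and dc: "d * c = CARD('a) + 1"
    and d12: "d = 1 \<or> d = 2" and dt3: "d = 2 \<Longrightarrow> t \<ge> 3"
begin

lemma mult_M: "monoid.mult M = (**)" and one_M: "one M = mat 1"
  using M_cases by (auto simp: SL_def GL_def)

lemma carrier_det: "A \<in> carrier M \<Longrightarrow> det A \<noteq> 0"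
  using M_cases by (auto simp: SL_def GL_def invertible_det_nz)

lemma det_one_carrier: "det A = 1 \<Longrightarrow> A \<in> carrier M"
  using M_cases by (auto simp: SL_def GL_def invertible_det_nz)

lemma det_eq_carrier: "A \<in> carrier M \<Longrightarrow> det B = det A \<Longrightarrow> B \<in> carrier M"
  using M_cases by (auto simp: SL_def GL_def invertible_det_nz)

sublocale M: group M
  using M_cases group_GL group_SL by auto

lemma M_closed: "A \<in> carrier M \<Longrightarrow> B \<in> carrier M \<Longrightarrow> A ** B \<in> carrier M"
  using M.m_closed by (simp add: mult_M)

lemma mat1_M: "mat 1 \<in> carrier M"
  using M.one_closed by (simp add: one_M)

lemma scal_normal: "scal M \<lhd> M"
  unfolding scal_def by (rule scalar_normal[OF M.group_axioms mult_M one_M])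

lemma scal_subgroup: "subgroup (scal M) M"
  using scal_normal by (rule normal_imp_subgroup)

lemma scal_iff: "A \<in> scal M \<longleftrightarrow> A \<in> carrier M \<and> (\<exists>x. A = mat x)"
  by (auto simp: scal_def scalar_matrices_def)

lemma mat1_scal: "mat 1 \<in> scal M"
  using mat1_M by (auto simp: scal_iff)

section \<open>Cosets modulo scalars\<close>

definition Gq where "Gq = M Mod scal M"

abbreviation Gq_mult (infixl "\<cdot>" 70) where "Gq_mult \<equiv> monoid.mult Gq"

sublocale Gq: group Gq
  unfolding Gq_def by (rule normal.factorgroup_is_group[OF scal_normal])

definition proj where "proj A = scal M #>\<^bsub>M\<^esub> A"

lemma proj_iff: "B \<in> proj A \<longleftrightarrow> (\<exists>z\<in>scal M. B = z ** A)"
  by (auto simp: proj_def r_coset_def mult_M)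

lemma proj_self: "A \<in> proj A"
  unfolding proj_iff using mat1_M by (intro bexI[of _ "mat 1"]) (auto simp: scal_iff)

lemma carrier_Gq: "carrier Gq = proj ` carrier M"
  by (auto simp: Gq_def FactGroup_def RCOSETS_def proj_def)

lemma proj_carrier: "A \<in> carrier M \<Longrightarrow> proj A \<in> carrier Gq"
  by (simp add: carrier_Gq)

lemma proj_eq_iff: assumes A: "A \<in> carrier M" and B: "B \<in> carrier M"
  shows "proj A = proj B \<longleftrightarrow> (\<exists>x. A = mat x ** B)"
proof
  assume "proj A = proj B"
  then have "A \<in> proj B" using proj_self by blast
  then show "\<exists>x. A = mat x ** B" by (auto simp: proj_iff scal_iff)
next
  assume "\<exists>x. A = mat x ** B"
  then obtain x where x: "A = mat x ** B" by blast
  \<comment> \<open>The scalar is a quotient of two elements of \<open>M\<close>; this puts it into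
    \<open>M\<close> also when \<open>M\<close> is \<open>SL\<close>.\<close>
  have "mat x = A ** inv\<^bsub>M\<^esub> B" using M.r_inv[OF B] by (simp add: x mult_M one_M matrix_mul_assoc[symmetric])
  then have "mat x \<in> carrier M" using M_closed A M.inv_closed[OF B] by simp
  then have "mat x \<in> scal M" by (auto simp: scal_iff)
  then have "A \<in> scal M #>\<^bsub>M\<^esub> B" unfolding proj_def[symmetric] proj_iff using x by blast
  then show "proj A = proj B" unfolding proj_def using M.repr_independence[OF _ B scal_subgroup] by simp
qed

lemma proj_mult: "A \<in> carrier M \<Longrightarrow> B \<in> carrier M \<Longrightarrow> proj A \<cdot> proj B = proj (A ** B)"
  unfolding proj_def using normal.rcos_sum[OF scal_normal] by (simp add: Gq_def FactGroup_def mult_M)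

lemma proj_one: "\<one>\<^bsub>Gq\<^esub> = proj (mat 1)"
  unfolding proj_def using M.coset_join2[OF mat1_M scal_subgroup mat1_scal] by (simp add: Gq_def FactGroup_def)

lemma proj_one_iff: "A \<in> carrier M \<Longrightarrow> proj A = \<one>\<^bsub>Gq\<^esub> \<longleftrightarrow> (\<exists>x. A = mat x)"
  unfolding proj_one using proj_eq_iff[OF _ mat1_M] by simp

lemma mpow_M: "A \<in> carrier M \<Longrightarrow> mpow A k \<in> carrier M"
  by (induction k) (auto simp: mpow_Suc mat1_M M_closed)

lemma proj_pow: assumes "A \<in> carrier M" shows "proj A [^]\<^bsub>Gq\<^esub> (k::nat) = proj (mpow A k)"
proof (induction k)
  case 0 then show ?case by (simp add: proj_one)
next
  case (Suc k)
  have "mpow A k ** A = mpow A (Suc k)" using mpow_add[of A k 1] by (simp add: mpow_Suc)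
  then show ?case using Suc proj_mult[OF mpow_M[OF assms] assms] by simp
qed

text \<open>\<open>S\<close> is a union of cosets, each of size
  \<open>card (scal M)\<close>.\<close>

lemma card_proj_image:
  assumes S: "S \<subseteq> carrier M" and closed: "\<And>A x. A \<in> S \<Longrightarrow> mat x \<in> carrier M \<Longrightarrow> mat x ** A \<in> S"
  shows "card (proj ` S) * card (scal M) = card S"
proof -
  have "proj A \<subseteq> S" if "A \<in> S" for A using closed[OF that] by (auto simp: proj_iff scal_iff)
  then have "S = \<Union>(proj ` S)" using proj_self by blast
  then have "card S = card (\<Union>(proj ` S))" by (rule arg_cong)
  also have "\<dots> = (\<Sum>X\<in>proj ` S. card X)"
  proof (rule card_Union_disjoint)
    have "proj ` S \<subseteq> rcosets\<^bsub>M\<^esub> scal M" using S by (auto simp: RCOSETS_def proj_def)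
    then show "pairwise disjnt (proj ` S)" using M.rcos_disjoint[OF scal_subgroup] by (meson pairwise_subset)
  qed simp
  also have "\<dots> = (\<Sum>X\<in>proj ` S. card (scal M))"
  proof (rule sum.cong[OF refl])
    fix X assume "X \<in> proj ` S"
    then have "X \<in> rcosets\<^bsub>M\<^esub> scal M" using S by (auto simp: RCOSETS_def proj_def)
    then show "card X = card (scal M)"
      using M.card_rcosets_equal[of X "scal M"] subgroup.subset[OF scal_subgroup] by simp
  qed
  finally show ?thesis by simp
qed

lemma card_scal_pos: "card (scal M) \<noteq> 0"
  using mat1_scal by (auto simp: card_eq_0_iff)

lemma c_ge2: "c \<ge> 2"
  using q3 dc d12 by auto

text \<open>All representatives are used at once, which avoids a choice; on a line they agree, so
  the union is again a single line.\<close>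

definition act :: "('a^2^2) set \<Rightarrow> ('a^2) set \<Rightarrow> ('a^2) set" where
  "act X L = (\<Union>A\<in>X. (\<lambda>v. A *v v) ` L)"

lemma act_proj: assumes A: "A \<in> carrier M" and v: "v \<noteq> 0" shows "act (proj A) (lspan v) = lspan (A *v v)"
proof -
  have "(\<lambda>u. B *v u) ` lspan v = lspan (A *v v)" if B: "B \<in> proj A" for B
  proof -
    obtain z where z: "z \<in> scal M" "B = z ** A" using B by (auto simp: proj_iff)
    then obtain x where x: "B = mat x ** A" "mat x \<in> carrier M" by (auto simp: scal_iff)
    have BM: "B \<in> carrier M" using x A M_closed by simp
    have "B *v v = x *s (A *v v)" unfolding x by (simp add: matrix_vector_mul_assoc[symmetric]) (simp add: entries)
    then have "cr (A *v v) (B *v v) = 0" by (simp add: cr_def)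
    then show ?thesis
      using lspan_eq_iff[of "A *v v" "B *v v"] invertible_nz[OF carrier_det v] A BM by (simp add: image_lspan)
  qed
  then show ?thesis unfolding act_def using proj_self[of A] by blast
qed

lemma act_fix_iff: assumes A: "A \<in> carrier M" and v: "v \<noteq> 0"
  shows "act (proj A) (lspan v) = lspan v \<longleftrightarrow> cr v (A *v v) = 0"
  using fixes_lspan_iff[OF carrier_det[OF A] v] by (simp add: act_proj[OF A v] image_lspan)

section \<open>Tori of the quotient group\<close>

definition CC where "CC = {proj ` (alg B \<inter> carrier M) | B. anis B}"

lemma mat_mult_fix: fixes v :: "'a^2" shows "cr v (A *v v) = 0 \<Longrightarrow> cr v ((mat x ** A) *v v) = 0"
proof -
  have "cr v ((mat x ** A) *v v) = x * cr v (A *v v)"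
    by (simp add: matrix_vector_mul_assoc[symmetric]) (simp add: entries cr_def algebra_simps)
  then show "cr v (A *v v) = 0 \<Longrightarrow> ?thesis" by simp
qed

lemma fix_mult: fixes v :: "'a^2" assumes "v \<noteq> 0" "cr v (A *v v) = 0" "cr v (B *v v) = 0" shows "cr v ((A ** B) *v v) = 0"
proof -
  obtain x where x: "B *v v = x *s v" using assms(3) cr_zero_iff[OF assms(1)] by blast
  have "(A ** B) *v v = A *v (B *v v)" by (simp only: matrix_vector_mul_assoc)
  also have "\<dots> = x *s (A *v v)" by (simp only: x vector_scalar_commute)
  finally have "(A ** B) *v v = x *s (A *v v)" .
  then show ?thesis using assms(2) by (simp add: cr_def)
qed

lemma cyclic_image:
  assumes g: "g \<in> S" "S \<subseteq> carrier M" and mul: "\<And>A B. A \<in> S \<Longrightarrow> B \<in> S \<Longrightarrow> A ** B \<in> S" and one: "mat 1 \<in> S"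
    and gen: "\<forall>A\<in>S. \<exists>k x. A = mat x ** mpow g k"
  shows "proj ` S = range (\<lambda>k::nat. proj g [^]\<^bsub>Gq\<^esub> k)"
proof -
  have gM: "g \<in> carrier M" using g by blast
  have pw: "mpow g k \<in> S" for k by (induction k) (auto simp: mpow_Suc one mul g)
  show ?thesis unfolding proj_pow[OF gM]
  proof
    show "proj ` S \<subseteq> range (\<lambda>k. proj (mpow g k))"
    proof
      fix X assume "X \<in> proj ` S"
      then obtain A where A: "A \<in> S" "X = proj A" by blast
      then obtain k x where "A = mat x ** mpow g k" using gen by blast
      then have "proj A = proj (mpow g k)" using proj_eq_iff[of A "mpow g k"] A g mpow_M[OF gM] by blast
      then show "X \<in> range (\<lambda>k. proj (mpow g k))" using A by blast
    qed
    show "range (\<lambda>k. proj (mpow g k)) \<subseteq> proj ` S" using pw by blast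
  qed
qed

lemma CC_mem_iff: assumes "anis B" "A \<in> carrier M" shows "proj A \<in> proj ` (alg B \<inter> carrier M) \<longleftrightarrow> A \<in> alg B"
proof
  assume "proj A \<in> proj ` (alg B \<inter> carrier M)"
  then obtain A' where A': "A' \<in> alg B" "A' \<in> carrier M" "proj A = proj A'" by blast
  then obtain x where "A = mat x ** A'" using proj_eq_iff assms by blast
  then show "A \<in> alg B" using alg_mult[OF mat_in_alg A'(1)] by simp
qed (use assms in blast)

lemma alg_M_subgroup: assumes B: "anis B" shows "subgroup (proj ` (alg B \<inter> carrier M)) Gq"
proof (rule Gq.subgroupI)
  show "proj ` (alg B \<inter> carrier M) \<subseteq> carrier Gq" by (auto simp: carrier_Gq)
  show "proj ` (alg B \<inter> carrier M) \<noteq> {}" using mat1_M mat_in_alg by blast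
  show "X \<cdot> Y \<in> proj ` (alg B \<inter> carrier M)"
    if X: "X \<in> proj ` (alg B \<inter> carrier M)" "Y \<in> proj ` (alg B \<inter> carrier M)" for X Y
  proof -
    obtain A A' where A: "A \<in> alg B \<inter> carrier M" "X = proj A" "A' \<in> alg B \<inter> carrier M" "Y = proj A'" using X by blast
    then have "X \<cdot> Y = proj (A ** A')" by (simp add: proj_mult)
    moreover have "A ** A' \<in> alg B \<inter> carrier M" using A alg_mult M_closed by blast
    ultimately show ?thesis by blast
  qed
  show "inv\<^bsub>Gq\<^esub> X \<in> proj ` (alg B \<inter> carrier M)" if X: "X \<in> proj ` (alg B \<inter> carrier M)" for X
  proof -
    obtain A where A: "A \<in> alg B" "A \<in> carrier M" "X = proj A" using X by blast
    have "A \<noteq> 0" using carrier_det[OF A(2)] by (auto simp: det_2)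
    then obtain A' where A': "A' \<in> alg B" "A ** A' = mat 1" using alg_inverse[OF B A(1)] by blast
    then have AA: "A' ** A = mat 1" using alg_commute A by metis
    have "A' = A' ** (A ** inv\<^bsub>M\<^esub> A)" using M.r_inv[OF A(2)] by (simp add: mult_M one_M)
    also have "\<dots> = inv\<^bsub>M\<^esub> A" by (simp add: matrix_mul_assoc AA)
    finally have A'M: "A' \<in> carrier M" using A by simp
    have "proj A' \<cdot> X = \<one>\<^bsub>Gq\<^esub>" using A A'M by (simp add: proj_mult AA proj_one)
    then have "inv\<^bsub>Gq\<^esub> X = proj A'" using A A'M by (intro Gq.inv_equality) (auto simp: proj_carrier)
    then show ?thesis using A' A'M by blast
  qed
qed

text \<open>Restriction to determinant 1 could a priori leave only scalars of the field;
  \<open>c \<ge> 2\<close> prevents this, and any nonscalar element generates the same field as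
  \<open>B\<close>.\<close>

lemma alg_nonscalar: assumes B: "anis B" obtains A where "A \<in> alg B" "A \<in> carrier M" "\<nexists>x. A = mat x" "anis A" "alg A = alg B"
proof -
  have "\<not> alg B \<inter> carrier M \<subseteq> scal M"
  proof
    assume "alg B \<inter> carrier M \<subseteq> scal M"
    then have "card (alg B \<inter> carrier M) \<le> card (scal M)" by (intro card_mono) auto
    then show False using alg_card[OF B] c_ge2 card_scal_pos by simp
  qed
  then obtain A where A0: "A \<in> alg B" "A \<in> carrier M" "A \<notin> scal M" by blast
  then have A: "A \<in> alg B" "A \<in> carrier M" "\<nexists>x. A = mat x" using scal_iff by blast+
  obtain a b where ab: "A = lin B a b" using A(1) by (auto simp: alg_def)
  then have "b \<noteq> 0" using A(3) lin_mat by metis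
  then have "anis A" using anis_lin[OF B] ab by simp
  then show ?thesis using that A alg_eq[OF A(1) A(3)] by blast
qed

text \<open>Conjugation by \<open>X\<close> takes \<open>A\<close> to a root of its polynomial
  within the field. The root \<open>A\<close> itself would place \<open>X\<close> in the centralizer
  \<open>alg B\<close>, so it is the other one.\<close>

lemma normalizes_cases:
  assumes B: "anis B" and X: "X \<in> carrier M" "X \<notin> alg B" and A: "A \<in> alg B" "A \<in> carrier M" "anis A" "alg A = alg B"
    and n: "\<forall>z\<in>proj ` (alg B \<inter> carrier M). proj X \<cdot> z \<cdot> inv\<^bsub>Gq\<^esub> proj X \<in> proj ` (alg B \<inter> carrier M)"
  shows "X ** A = (mat (trace A) - A) ** X"
proof -
  obtain A' where A': "A' \<in> alg B" "A' \<in> carrier M" "proj X \<cdot> proj A \<cdot> inv\<^bsub>Gq\<^esub> proj X = proj A'"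
    using n A by blast
  have c: "proj X \<in> carrier Gq" "proj A \<in> carrier Gq" "proj A' \<in> carrier Gq" using X A A' by (auto simp: proj_carrier)
  then have "proj X \<cdot> proj A = proj A' \<cdot> proj X"
    using A'(3) Gq.inv_solve_right'[of "proj A'" "proj X \<cdot> proj A" "proj X"] by simp
  then have "proj (X ** A) = proj (A' ** X)" using X A A' by (simp add: proj_mult)
  then obtain x where x: "X ** A = mat x ** (A' ** X)"
    using proj_eq_iff[OF M_closed[OF X(1) A(2)] M_closed[OF A'(2) X(1)]] by blast
  \<comment> \<open>Equality in the quotient leaves a scalar factor, which the field
    absorbs.\<close>
  define A'' where "A'' = mat x ** A'"
  have "A'' \<in> alg A" using alg_mult[OF mat_in_alg A'(1)] A(4) by (simp add: A''_def)
  moreover have XA: "X ** A = A'' ** X" using x by (simp add: A''_def matrix_mul_assoc)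
  ultimately have "A'' = A \<or> A'' = mat (trace A) - A" using alg_conjugate[OF A(3)] carrier_det[OF X(1)] by blast
  moreover have "A'' \<noteq> A" using alg_commutant[OF A(3), of X] XA X(2) A(4) by auto
  ultimately show ?thesis using XA by simp
qed

lemma semi_normalizes:
  assumes B: "anis B" and W: "W \<in> carrier M" "W ** B = (mat (trace B) - B) ** W"
  shows "\<forall>z\<in>proj ` (alg B \<inter> carrier M). proj W \<cdot> z \<cdot> inv\<^bsub>Gq\<^esub> proj W \<in> proj ` (alg B \<inter> carrier M)"
proof
  fix z assume "z \<in> proj ` (alg B \<inter> carrier M)"
  then obtain A where A: "A \<in> alg B" "A \<in> carrier M" "z = proj A" by blast
  obtain a b where ab: "A = lin B a b" using A(1) by (auto simp: alg_def)
  \<comment> \<open>The Galois conjugate of \<open>A\<close>; it has the same determinant and hence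
    stays in \<open>M\<close>.\<close>
  define A' where "A' = lin B (a + b * trace B) (- b)"
  have "mat b ** (W ** B) = mat b ** ((mat (trace B) - B) ** W)" using W by simp
  moreover have "W ** A = mat a ** W + mat b ** (W ** B)"
    by (simp add: ab vec_eq_iff forall_2 matrix_matrix_mult_def sum_2 lin_entries mat_def algebra_simps)
  moreover have "A' ** W = mat a ** W + mat b ** ((mat (trace B) - B) ** W)"
    by (simp add: A'_def vec_eq_iff forall_2 matrix_matrix_mult_def sum_2 lin_entries mat_def algebra_simps)
  ultimately have WA: "W ** A = A' ** W" by simp
  have "det A' * det W = det A * det W" using WA det_mul[of W A] det_mul[of A' W] by (simp add: mult.commute)
  then have "det A' = det A" using carrier_det[OF W(1)] by simp
  then have A'M: "A' \<in> carrier M" using det_eq_carrier A by blast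
  have "proj W \<cdot> proj A = proj A' \<cdot> proj W" using WA W A A'M by (simp add: proj_mult)
  then have "proj W \<cdot> z \<cdot> inv\<^bsub>Gq\<^esub> proj W = proj A'"
    using A W A'M Gq.inv_solve_right'[of "proj A'" "proj W \<cdot> proj A" "proj W"] by (simp add: proj_carrier)
  moreover have "A' \<in> alg B" unfolding A'_def alg_def by blast
  ultimately show "proj W \<cdot> z \<cdot> inv\<^bsub>Gq\<^esub> proj W \<in> proj ` (alg B \<inter> carrier M)" using A'M by blast
qed

lemma pointsE: assumes "L \<in> points" obtains v where "v \<noteq> 0" "L = lspan v"
  using assms by (auto simp: points_def)

lemma GqE: assumes "X \<in> carrier Gq" obtains A where "A \<in> carrier M" "X = proj A"
  using assms by (auto simp: carrier_Gq)

lemma two_point_stab: assumes v: "v \<noteq> 0" and w: "w \<noteq> 0"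
  shows "{X \<in> carrier Gq. act X (lspan v) = lspan v \<and> act X (lspan w) = lspan w} =
    proj ` {A \<in> carrier M. cr v (A *v v) = 0 \<and> cr w (A *v w) = 0}"
  using act_fix_iff[OF _ v] act_fix_iff[OF _ w] by (auto simp: carrier_Gq)

text \<open>The transvections along \<open>v\<close> have determinant 1, form a copy of the additive
  group of the field and stay distinct modulo scalars.\<close>

lemma unipotent_subgroup:
  assumes v: "v \<noteq> 0"
  shows "\<exists>V. subgroup V Gq \<and> card V = CARD('a) \<and> (\<forall>X\<in>V - {\<one>\<^bsub>Gq\<^esub>}. {L \<in> points. act X L = L} = {lspan v})"
proof -
  define V where "V = range (\<lambda>s. proj (transv v s))"
  have tM: "transv v s \<in> carrier M" for s using det_one_carrier det_transv by blast
  have mul: "proj (transv v s) \<cdot> proj (transv v r) = proj (transv v (s + r))" for s r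
    by (simp add: proj_mult tM transv_mult)
  have "subgroup V Gq"
  proof (rule Gq.subgroupI)
    show "V \<subseteq> carrier Gq" using tM by (auto simp: V_def proj_carrier)
    show "V \<noteq> {}" by (simp add: V_def)
    show "X \<cdot> Y \<in> V" if "X \<in> V" "Y \<in> V" for X Y using that mul by (auto simp: V_def)
    show "inv\<^bsub>Gq\<^esub> X \<in> V" if X: "X \<in> V" for X
    proof -
      obtain s where s: "X = proj (transv v s)" using X by (auto simp: V_def)
      have "proj (transv v (- s)) \<cdot> X = \<one>\<^bsub>Gq\<^esub>" by (simp add: s mul transv_0 proj_one)
      then have "inv\<^bsub>Gq\<^esub> X = proj (transv v (- s))" using tM s by (intro Gq.inv_equality) (auto simp: proj_carrier)
      then show ?thesis by (simp add: V_def)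
    qed
  qed
  moreover have "inj (\<lambda>s. proj (transv v s))"
  proof (rule injI)
    fix s r assume "proj (transv v s) = proj (transv v r)"
    then obtain x where x: "transv v s = mat x ** transv v r" using proj_eq_iff[OF tM tM] by blast
    have "v = (mat x ** transv v r) *v v" using transv_fix[of v s] x by simp
    also have "\<dots> = mat x *v (transv v r *v v)" by (simp only: matrix_vector_mul_assoc)
    also have "\<dots> = x *s v" unfolding transv_fix by (simp add: entries)
    finally have "x = 1" using v by (metis vector_mul_rcancel vector_smult_lid)
    then have "transv v s $ 1 $ 2 = transv v r $ 1 $ 2" "transv v s $ 2 $ 1 = transv v r $ 2 $ 1" using x by simp_all
    then show "s = r" using v by (auto simp: transv_def vector_2 vec2_nz)
  qed
  then have "card V = CARD('a)" unfolding V_def by (rule card_image)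
  moreover have "{L \<in> points. act X L = L} = {lspan v}" if X: "X \<in> V - {\<one>\<^bsub>Gq\<^esub>}" for X
  proof -
    obtain s where s: "X = proj (transv v s)" using X by (auto simp: V_def)
    have s0: "s \<noteq> 0" using X s by (auto simp: proj_one transv_0)
    have "act X (lspan w) = lspan w \<longleftrightarrow> lspan w = lspan v" if w: "w \<noteq> 0" for w
      using act_fix_iff[OF tM w, of s] lspan_eq_iff[OF v w] s s0 by (auto simp: cr_transv)
    moreover have "lspan v \<in> points" using v by (auto simp: points_def)
    ultimately show ?thesis unfolding points_def using v by blast
  qed
  ultimately show ?thesis by blast
qed

lemma stab_set_facts:
  assumes v: "v \<noteq> 0" and w: "w \<noteq> 0" and vw: "cr v w \<noteq> 0"
  shows "card {X \<in> carrier Gq. act X (lspan v) = lspan v \<and> act X (lspan w) = lspan w} = t"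
    and "\<exists>g\<in>carrier Gq. {X \<in> carrier Gq. act X (lspan v) = lspan v \<and> act X (lspan w) = lspan w} =
      range (\<lambda>k::nat. g [^]\<^bsub>Gq\<^esub> k)"
proof -
  let ?S = "{A \<in> carrier M. cr v (A *v v) = 0 \<and> cr w (A *v w) = 0}"
  have "card (proj ` ?S) * card (scal M) = card ?S"
    by (rule card_proj_image) (auto intro: M_closed mat_mult_fix)
  then show "card {X \<in> carrier Gq. act X (lspan v) = lspan v \<and> act X (lspan w) = lspan w} = t"
    using split_card[OF vw] card_scal_pos by (simp add: two_point_stab[OF v w])
  obtain g where g: "g \<in> ?S" "\<forall>A\<in>?S. \<exists>k x. A = mat x ** mpow g k" using split_gen[OF vw] by blast
  have "proj ` ?S = range (\<lambda>k::nat. proj g [^]\<^bsub>Gq\<^esub> k)"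
  proof (rule cyclic_image[OF g(1) _ _ _ g(2)])
    show "A ** B \<in> ?S" if "A \<in> ?S" "B \<in> ?S" for A B
      using that M_closed fix_mult[OF v] fix_mult[OF w] by simp
    show "mat 1 \<in> ?S" using mat1_M by (simp add: cr_def)
  qed blast
  then show "\<exists>g\<in>carrier Gq. {X \<in> carrier Gq. act X (lspan v) = lspan v \<and> act X (lspan w) = lspan w} =
      range (\<lambda>k::nat. g [^]\<^bsub>Gq\<^esub> k)"
    unfolding two_point_stab[OF v w] using g(1) proj_carrier by blast
qed

text \<open>Fixing no line means being anisotropic. Such an \<open>A\<close> lies in its own field,
  and conversely every nonscalar element of such a field is anisotropic.\<close>

lemma CC_fixed_point_free: assumes A: "A \<in> carrier M" and n1: "\<nexists>x. A = mat x"
  shows "(\<exists>C\<in>CC. proj A \<in> C) \<longleftrightarrow> {L \<in> points. act (proj A) L = L} = {}"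
proof -
  have "{L \<in> points. act (proj A) L = L} = {} \<longleftrightarrow> anis A"
  proof -
    have "{L \<in> points. act (proj A) L = L} = {} \<longleftrightarrow> (\<forall>v. v \<noteq> 0 \<longrightarrow> act (proj A) (lspan v) \<noteq> lspan v)"
      unfolding points_def by blast
    then show ?thesis using act_fix_iff[OF A] by (simp add: anis_def)
  qed
  also have "\<dots> \<longleftrightarrow> (\<exists>B. anis B \<and> A \<in> alg B)"
  proof
    assume "\<exists>B. anis B \<and> A \<in> alg B"
    then obtain B a b where B: "anis B" "A = lin B a b" by (auto simp: alg_def)
    then have "b \<noteq> 0" using n1 lin_mat by metis
    then show "anis A" using anis_lin B by blast
  qed (use self_in_alg in blast)
  also have "\<dots> \<longleftrightarrow> (\<exists>C\<in>CC. proj A \<in> C)" using CC_mem_iff[OF _ A] by (auto simp: CC_def)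
  finally show ?thesis by blast
qed

lemma CC_inter: assumes B: "anis B" "anis B'" and ne: "alg B \<noteq> alg B'"
  shows "proj ` (alg B \<inter> carrier M) \<inter> proj ` (alg B' \<inter> carrier M) = {\<one>\<^bsub>Gq\<^esub>}"
proof -
  have "X = \<one>\<^bsub>Gq\<^esub>" if X: "X \<in> proj ` (alg B \<inter> carrier M)" "X \<in> proj ` (alg B' \<inter> carrier M)" for X
  proof (rule ccontr)
    assume X1: "X \<noteq> \<one>\<^bsub>Gq\<^esub>"
    obtain A where A: "A \<in> alg B" "A \<in> carrier M" "X = proj A" using X by blast
    then have A': "A \<in> alg B'" using X(2) CC_mem_iff[OF B(2)] by blast
    have "\<nexists>x. A = mat x" using X1 A proj_one_iff by blast
    then show False using alg_eq[OF A(1)] alg_eq[OF A'] ne by simp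
  qed
  moreover have "\<one>\<^bsub>Gq\<^esub> \<in> proj ` (alg B \<inter> carrier M)" for B
    unfolding proj_one using mat1_M mat_in_alg by blast
  ultimately show ?thesis by blast
qed

text \<open>Representatives of \<open>X\<close> and \<open>Y\<close> both induce the nontrivial
  automorphism of the field, which has order 2; their product centralizes the field and so belongs
  to it.\<close>

lemma CC_product:
  assumes B: "anis B" and X: "X \<in> carrier Gq - proj ` (alg B \<inter> carrier M)" and Y: "Y \<in> carrier Gq - proj ` (alg B \<inter> carrier M)"
    and nX: "\<forall>z\<in>proj ` (alg B \<inter> carrier M). X \<cdot> z \<cdot> inv\<^bsub>Gq\<^esub> X \<in> proj ` (alg B \<inter> carrier M)"
    and nY: "\<forall>z\<in>proj ` (alg B \<inter> carrier M). Y \<cdot> z \<cdot> inv\<^bsub>Gq\<^esub> Y \<in> proj ` (alg B \<inter> carrier M)"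
  shows "X \<cdot> Y \<in> proj ` (alg B \<inter> carrier M)"
proof -
  obtain P where P: "P \<in> carrier M" "X = proj P" using X GqE by blast
  obtain Q where Q: "Q \<in> carrier M" "Y = proj Q" using Y GqE by blast
  obtain A where A: "A \<in> alg B" "A \<in> carrier M" "anis A" "alg A = alg B" using alg_nonscalar[OF B] by metis
  have "P \<notin> alg B" "Q \<notin> alg B" using X Y P Q by auto
  then have "P ** A = (mat (trace A) - A) ** P" "Q ** A = (mat (trace A) - A) ** Q"
    using normalizes_cases[OF B _ _ A] P Q nX nY by auto
  then have "(P ** Q) ** A = A ** (P ** Q)"
    using conj_flip[of P A "trace A"] by (metis matrix_mul_assoc)
  then have "P ** Q \<in> alg B" using alg_commutant[OF A(3)] A(4) by blast
  moreover have "P ** Q \<in> carrier M" using M_closed P Q by blast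
  ultimately show ?thesis using P Q proj_mult by auto
qed

text \<open>The commutator of \<open>B\<close> and \<open>B'\<close> induces the field automorphism
  on \<open>alg B\<close>. In characteristic 2 it equals the commutator taken in the other order, so
  it does the same on \<open>alg B'\<close>.\<close>

lemma CC_common_normalizer:
  assumes ev: "even CARD('a)" and B: "anis B" "anis B'" and ne: "alg B \<noteq> alg B'"
  shows "\<exists>W\<in>carrier Gq - {\<one>\<^bsub>Gq\<^esub>}.
    (\<forall>z\<in>proj ` (alg B \<inter> carrier M). W \<cdot> z \<cdot> inv\<^bsub>Gq\<^esub> W \<in> proj ` (alg B \<inter> carrier M)) \<and>
    (\<forall>z\<in>proj ` (alg B' \<inter> carrier M). W \<cdot> z \<cdot> inv\<^bsub>Gq\<^esub> W \<in> proj ` (alg B' \<inter> carrier M))"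
proof -
  have c2: "(1::'a) + 1 = 0" using even_char2[OF ev] .
  have neg: "- x = x" for x :: 'a using c2 by (metis add_eq_0_iff mult_minus1 mult_1)
  define N where "N = B ** B' - B' ** B"
  have "\<nexists>x. B' = mat x"
  proof
    assume "\<exists>x. B' = mat x"
    then have "B'$2$1 = 0" by (auto simp: mat_def)
    then show False using anis_21[OF B(2)] by simp
  qed
  then have "B' \<notin> alg B" using alg_eq ne by metis
  then have dN: "det N \<noteq> 0" using commutator_det[OF B(1)] by (simp add: N_def)
  \<comment> \<open>Scaling by a square root makes the determinant 1, so that the element is
    available in \<open>SL\<close> too.\<close>
  obtain x where x: "x * x = 1 / det N" using char2_sqrt[OF c2] by blast
  define W where "W = mat x ** N"
  have "det W = x * x * det N" by (simp add: W_def det_2 mat_mult_left algebra_simps)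
  then have dW: "det W = 1" using x dN by simp
  then have WM: "W \<in> carrier M" using det_one_carrier by blast
  have WB: "W ** B = (mat (trace B) - B) ** W"
  proof -
    have "W ** B = mat x ** (N ** B)" by (simp add: W_def matrix_mul_assoc)
    also have "\<dots> = mat x ** ((mat (trace B) - B) ** N)" unfolding N_def commutator_semi ..
    also have "\<dots> = (mat (trace B) - B) ** W"
      by (simp only: W_def matrix_mul_assoc mat_mult_commute[of x "mat (trace B) - B"])
    finally show ?thesis .
  qed
  have N': "N = B' ** B - B ** B'"
  proof -
    have "- P = P" for P :: "'a^2^2" using neg by (simp add: vec_eq_iff)
    then have "N = - (B ** B' - B' ** B)" by (simp only: N_def)
    then show ?thesis by (simp only: minus_diff_eq)
  qed
  have WB': "W ** B' = (mat (trace B') - B') ** W"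
  proof -
    have "W ** B' = mat x ** (N ** B')" by (simp add: W_def matrix_mul_assoc)
    also have "\<dots> = mat x ** ((mat (trace B') - B') ** N)" unfolding N' commutator_semi ..
    also have "\<dots> = (mat (trace B') - B') ** W"
      by (simp only: W_def matrix_mul_assoc mat_mult_commute[of x "mat (trace B') - B'"])
    finally show ?thesis .
  qed
  \<comment> \<open>A scalar \<open>W\<close> would make \<open>B\<close> its own conjugate, and its
    trace would be twice an entry, that is zero.\<close>
  have "proj W \<noteq> \<one>\<^bsub>Gq\<^esub>"
  proof
    assume "proj W = \<one>\<^bsub>Gq\<^esub>"
    then obtain y where y: "W = mat y" using proj_one_iff[OF WM] by blast
    then have "y \<noteq> 0" using dW by (auto simp: det_2)
    have "(mat y ** B) $ 1 $ 1 = (mat y ** (mat (trace B) - B)) $ 1 $ 1"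
      using WB y mat_mult_commute[of y "mat (trace B) - B"] by simp
    then have "B$1$1 = trace B - B$1$1" using \<open>y \<noteq> 0\<close> by (simp add: mat_mult_left) (simp add: mat_def)
    then have "trace B = B$1$1 * (1 + 1)" by (simp add: algebra_simps)
    then show False using anis_trace[OF c2 B(1)] c2 by simp
  qed
  then show ?thesis
    using semi_normalizes[OF B(1) WM WB] semi_normalizes[OF B(2) WM WB'] WM by (intro bexI[of _ "proj W"]) (auto simp: proj_carrier)
qed

lemma line_action_Gq: "line_action Gq act points CC CARD('a) t c d"
proof (intro line_action.intro line_action_axioms.intro)
  show "group Gq" by (rule Gq.group_axioms)
  show "finite (carrier Gq)" by (simp add: carrier_Gq)
  show "act g x \<in> points" if g: "g \<in> carrier Gq" and x: "x \<in> points" for g x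
  proof -
    obtain A where A: "A \<in> carrier M" "g = proj A" using GqE[OF g] .
    obtain v where v: "v \<noteq> 0" "x = lspan v" using pointsE[OF x] .
    show ?thesis using A v act_proj[OF A(1) v(1)] invertible_nz[OF carrier_det[OF A(1)] v(1)] by (auto simp: points_def)
  qed
  show "act \<one>\<^bsub>Gq\<^esub> x = x" if x: "x \<in> points" for x
  proof -
    obtain v where v: "v \<noteq> 0" "x = lspan v" using pointsE[OF x] .
    show ?thesis using act_proj[OF mat1_M v(1)] by (simp add: proj_one v(2))
  qed
  show "act (g \<cdot> h) x = act g (act h x)" if g: "g \<in> carrier Gq" "h \<in> carrier Gq" and x: "x \<in> points" for g h x
  proof -
    obtain A where A: "A \<in> carrier M" "g = proj A" using GqE[OF g(1)] .
    obtain B where B: "B \<in> carrier M" "h = proj B" using GqE[OF g(2)] .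
    obtain v where v: "v \<noteq> 0" "x = lspan v" using pointsE[OF x] .
    have "B *v v \<noteq> 0" using invertible_nz[OF carrier_det[OF B(1)] v(1)] .
    then show ?thesis
      using act_proj[OF M_closed[OF A(1) B(1)] v(1)] act_proj[OF B(1) v(1)] act_proj[OF A(1), of "B *v v"]
      by (simp add: A B v(2) proj_mult matrix_vector_mul_assoc)
  qed
  show "card (points :: ('a^2) set set) = CARD('a) + 1" by (rule card_points)
  show "g = \<one>\<^bsub>Gq\<^esub>" if g: "g \<in> carrier Gq" and abc: "{x, y, z} \<subseteq> points" "x \<noteq> y" "x \<noteq> z" "y \<noteq> z"
    and f: "act g x = x" "act g y = y" "act g z = z" for g x y z
  proof -
    obtain A where A: "A \<in> carrier M" "g = proj A" using GqE[OF g] .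
    obtain u where u: "u \<noteq> 0" "x = lspan u" using abc(1) by (auto elim: pointsE)
    obtain v where v: "v \<noteq> 0" "y = lspan v" using abc(1) by (auto elim: pointsE)
    obtain w where w: "w \<noteq> 0" "z = lspan w" using abc(1) by (auto elim: pointsE)
    have "cr u (A *v u) = 0" "cr v (A *v v) = 0" "cr w (A *v w) = 0"
      using f unfolding A(2) u(2) v(2) w(2)
      by (simp_all only: act_fix_iff[OF A(1) u(1)] act_fix_iff[OF A(1) v(1)] act_fix_iff[OF A(1) w(1)])
    moreover have "cr u v \<noteq> 0" "cr u w \<noteq> 0" "cr v w \<noteq> 0"
      using abc(2-4) unfolding u(2) v(2) w(2)
      by (simp_all only: lspan_eq_iff[OF u(1) v(1)] lspan_eq_iff[OF u(1) w(1)] lspan_eq_iff[OF v(1) w(1)] not_False_eq_True)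
    ultimately have "A = mat (A$1$1)" by (rule three_fixed_scalar)
    then show ?thesis using proj_one_iff[OF A(1)] A by blast
  qed
  show "\<exists>V. subgroup V Gq \<and> card V = CARD('a) \<and> (\<forall>g\<in>V - {\<one>\<^bsub>Gq\<^esub>}. {x \<in> points. act g x = x} = {a})"
    if a: "a \<in> points" for a
  proof -
    obtain v where v: "v \<noteq> 0" "a = lspan v" using pointsE[OF a] .
    show ?thesis using unipotent_subgroup[OF v(1)] unfolding v(2) .
  qed
  show "\<exists>g\<in>carrier Gq. {h \<in> carrier Gq. act h a = a \<and> act h b = b} = range (\<lambda>k::nat. g [^]\<^bsub>Gq\<^esub> k)"
    if ab: "a \<in> points" "b \<in> points" "a \<noteq> b" for a b
  proof -
    obtain v where v: "v \<noteq> 0" "a = lspan v" using pointsE[OF ab(1)] .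
    obtain w where w: "w \<noteq> 0" "b = lspan w" using pointsE[OF ab(2)] .
    have "cr v w \<noteq> 0" using lspan_eq_iff[OF v(1) w(1)] ab(3) v w by simp
    then show ?thesis unfolding v(2) w(2) by (rule stab_set_facts(2)[OF v(1) w(1)])
  qed
  show "card {h \<in> carrier Gq. act h a = a \<and> act h b = b} = t"
    if ab: "a \<in> points" "b \<in> points" "a \<noteq> b" for a b
  proof -
    obtain v where v: "v \<noteq> 0" "a = lspan v" using pointsE[OF ab(1)] .
    obtain w where w: "w \<noteq> 0" "b = lspan w" using pointsE[OF ab(2)] .
    have "cr v w \<noteq> 0" using lspan_eq_iff[OF v(1) w(1)] ab(3) v w by simp
    then show ?thesis unfolding v(2) w(2) by (rule stab_set_facts(1)[OF v(1) w(1)])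
  qed
  show "subgroup C Gq" if "C \<in> CC" for C
    using that alg_M_subgroup by (auto simp: CC_def)
  show "\<exists>g\<in>carrier Gq. C = range (\<lambda>k::nat. g [^]\<^bsub>Gq\<^esub> k)" if C: "C \<in> CC" for C
  proof -
    obtain B where B: "anis B" "C = proj ` (alg B \<inter> carrier M)" using C by (auto simp: CC_def)
    obtain g where g: "g \<in> alg B \<inter> carrier M" "\<forall>A\<in>alg B \<inter> carrier M. \<exists>k x. A = mat x ** mpow g k"
      using alg_gen[OF B(1)] by blast
    have "C = range (\<lambda>k::nat. proj g [^]\<^bsub>Gq\<^esub> k)"
      unfolding B by (rule cyclic_image[OF g(1) _ _ _ g(2)]) (use alg_mult M_closed mat1_M mat_in_alg in auto)
    then show ?thesis using g(1) proj_carrier by blast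
  qed
  show "card C = c" if C: "C \<in> CC" for C
  proof -
    obtain B where B: "anis B" "C = proj ` (alg B \<inter> carrier M)" using C by (auto simp: CC_def)
    have "card (proj ` (alg B \<inter> carrier M)) * card (scal M) = card (alg B \<inter> carrier M)"
      by (rule card_proj_image) (auto intro: M_closed alg_mult mat_in_alg)
    then show ?thesis using alg_card[OF B(1)] card_scal_pos B by simp
  qed
  show "C \<inter> C' = {\<one>\<^bsub>Gq\<^esub>}" if "C \<in> CC" "C' \<in> CC" "C \<noteq> C'" for C C'
    using that CC_inter unfolding CC_def by blast
  show "(\<exists>C\<in>CC. g \<in> C) \<longleftrightarrow> {x \<in> points. act g x = x} = {}" if g: "g \<in> carrier Gq" "g \<noteq> \<one>\<^bsub>Gq\<^esub>" for g
  proof -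
    obtain A where A: "A \<in> carrier M" "g = proj A" using GqE[OF g(1)] .
    then show ?thesis using CC_fixed_point_free[OF A(1)] proj_one_iff[OF A(1)] g(2) by blast
  qed
  show "x \<cdot> y \<in> C" if xy: "C \<in> CC" "x \<in> carrier Gq - C" "y \<in> carrier Gq - C"
    "\<forall>z\<in>C. x \<cdot> z \<cdot> inv\<^bsub>Gq\<^esub> x \<in> C" "\<forall>z\<in>C. y \<cdot> z \<cdot> inv\<^bsub>Gq\<^esub> y \<in> C" for C x y
  proof -
    obtain B where B: "anis B" "C = proj ` (alg B \<inter> carrier M)" using xy(1) by (auto simp: CC_def)
    show ?thesis using CC_product[OF B(1)] xy(2-) unfolding B(2) by blast
  qed
  show "\<exists>w\<in>carrier Gq - {\<one>\<^bsub>Gq\<^esub>}. (\<forall>z\<in>C. w \<cdot> z \<cdot> inv\<^bsub>Gq\<^esub> w \<in> C) \<and>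
      (\<forall>z\<in>C'. w \<cdot> z \<cdot> inv\<^bsub>Gq\<^esub> w \<in> C')"
    if C: "even CARD('a)" "C \<in> CC" "C' \<in> CC" "C \<noteq> C'" for C C'
  proof -
    obtain B where B: "anis B" "C = proj ` (alg B \<inter> carrier M)" using C(2) by (auto simp: CC_def)
    obtain B' where B': "anis B'" "C' = proj ` (alg B' \<inter> carrier M)" using C(3) by (auto simp: CC_def)
    have "alg B \<noteq> alg B'" using C(4) B B' by auto
    then show ?thesis using CC_common_normalizer[OF C(1) B(1) B'(1)] unfolding B(2) B'(2) by blast
  qed
qed (use q3 dt dc d12 dt3 in auto)

lemma rho_Gq: "rho Gq = enat (CARD('a) ^ 2 + 1)"
  by (rule line_action.rho_eq[OF line_action_Gq])

end

section \<open>The instances GL and SL\<close>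

lemma mpow_diag: "cr v w \<noteq> 0 \<Longrightarrow> mpow (diag v w x y) k = diag v w (x ^ k) (y ^ k)"
  by (induction k) (simp_all add: mpow_Suc diag_mult diag_scalar[symmetric])

lemma fixes_two_iff: assumes vw: "cr v w \<noteq> 0"
  shows "cr v (A *v v) = 0 \<and> cr w (A *v w) = 0 \<longleftrightarrow> (\<exists>x y. A = diag v w x y)"
proof
  have nz: "v \<noteq> 0" "w \<noteq> 0" using vw by (auto simp: cr_def)
  assume "cr v (A *v v) = 0 \<and> cr w (A *v w) = 0"
  then obtain x y where "A *v v = x *s v" "A *v w = y *s w"
    using cr_zero_iff[OF nz(1)] cr_zero_iff[OF nz(2)] by blast
  then show "\<exists>x y. A = diag v w x y" using diag_unique[OF vw] by blast
next
  assume "\<exists>x y. A = diag v w x y"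
  then obtain x y where "A = diag v w x y" by blast
  then show "cr v (A *v v) = 0 \<and> cr w (A *v w) = 0"
    using diag_v[OF vw, of x y] diag_w[OF vw, of x y] by (simp add: cr_def)
qed

lemma carrier_GL: "carrier (GL :: ('a::field^2^2) monoid) = {A. det A \<noteq> 0}"
  by (auto simp: GL_def invertible_det_nz)

lemma carrier_SL: "carrier (SL :: ('a::field^2^2) monoid) = {A. det A = 1}"
  by (simp add: SL_def)

lemma det_mat2: "det (mat x :: 'a::comm_ring_1^2^2) = x * x"
  by (simp add: det_2 mat_def)

lemma mat_inj: "mat x = (mat y :: 'a::field^2^2) \<longleftrightarrow> x = y"
  by (auto simp: vec_eq_iff forall_2 mat_def)

lemma card_scal_GL: "card (scal (GL :: ('a::{field,finite}^2^2) monoid)) = CARD('a) - 1"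
proof -
  have "scal (GL :: ('a^2^2) monoid) = mat ` (UNIV - {0})"
    by (auto simp: scal_def scalar_matrices_def carrier_GL det_mat2)
  moreover have "inj_on (mat :: 'a \<Rightarrow> 'a^2^2) (UNIV - {0})" by (simp add: inj_on_def mat_inj)
  ultimately show ?thesis by (simp add: card_image card_Diff_singleton)
qed

lemma card_scal_SL: "card (scal (SL :: ('a::{field,finite}^2^2) monoid)) = card {x::'a. x * x = 1}"
proof -
  have "scal (SL :: ('a^2^2) monoid) = mat ` {x. x * x = 1}"
    by (auto simp: scal_def scalar_matrices_def carrier_SL det_mat2)
  moreover have "inj_on (mat :: 'a \<Rightarrow> 'a^2^2) {x. x * x = 1}" by (simp add: inj_on_def mat_inj)
  ultimately show ?thesis by (simp add: card_image)
qed

lemma GL_quotient: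
  assumes q3: "CARD('a::{field,finite}) \<ge> 3"
  shows "matrix_quotient (GL :: ('a^2^2) monoid) (CARD('a) - 1) (CARD('a) + 1) 1"
proof
  fix v w :: "'a^2" assume vw: "cr v w \<noteq> 0"
  let ?S = "{A \<in> carrier GL. cr v (A *v v) = 0 \<and> cr w (A *v w) = 0}"
  have S: "?S = (\<lambda>(x, y). diag v w x y) ` ((UNIV - {0}) \<times> (UNIV - {0}))"
    by (auto simp: fixes_two_iff[OF vw] carrier_GL det_diag[OF vw])
  have "inj_on (\<lambda>(x, y). diag v w x y) ((UNIV - {0}) \<times> (UNIV - {0}))"
    using diag_inj[OF vw] by (auto simp: inj_on_def)
  then show "card ?S = (CARD('a) - 1) * card (scal (GL :: ('a^2^2) monoid))"
    unfolding S card_scal_GL by (simp add: card_image card_Diff_singleton card_cartesian_product)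
  obtain g :: 'a where g: "g \<noteq> 0" "\<And>x. x \<noteq> 0 \<Longrightarrow> \<exists>k. x = g ^ k" using field_generator by metis
  show "\<exists>g\<in>?S. \<forall>A\<in>?S. \<exists>k x. A = mat x ** mpow g k"
  \<comment> \<open>Modulo scalars only the ratio of the two eigenvalues counts.\<close>
  proof (intro bexI[of _ "diag v w g 1"] ballI)
    show "diag v w g 1 \<in> ?S" unfolding S using g by auto
    fix A assume "A \<in> ?S"
    then obtain x y where A: "A = diag v w x y" "x \<noteq> 0" "y \<noteq> 0" unfolding S by auto
    then obtain k where k: "x / y = g ^ k" using g(2)[of "x / y"] by auto
    have "mat y ** mpow (diag v w g 1) k = diag v w (y * g ^ k) y"
      by (simp add: mpow_diag[OF vw] diag_scalar[OF vw, symmetric] diag_mult[OF vw])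
    also have "y * g ^ k = x" using k A by (simp add: field_simps)
    finally show "\<exists>k x. A = mat x ** mpow (diag v w g 1) k" using A by metis
  qed
next
  fix B :: "'a^2^2" assume B: "anis B"
  have K: "alg B \<inter> carrier GL = alg B - {0}"
    using alg_det[OF B] by (auto simp: carrier_GL) (simp add: det_2)
  have "card (alg B - {0}) = CARD('a) ^ 2 - 1"
    using card_alg[OF B] mat_in_alg[of 0 B] by (simp add: card_Diff_singleton)
  also have "\<dots> = (CARD('a) + 1) * (CARD('a) - 1)" by (simp add: power2_eq_square algebra_simps)
  finally show "card (alg B \<inter> carrier GL) = (CARD('a) + 1) * card (scal (GL :: ('a^2^2) monoid))"
    unfolding K card_scal_GL .
  obtain g where g: "g \<in> alg B" "g \<noteq> 0" "alg B - {0} = range (mpow g)" using alg_generator[OF B] by blast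
  have "\<exists>k x. A = mat x ** mpow g k" if A: "A \<in> alg B - {0}" for A
  proof -
    obtain k where "A = mat 1 ** mpow g k" using A unfolding g(3) by auto
    then show ?thesis by blast
  qed
  then show "\<exists>g\<in>alg B \<inter> carrier GL. \<forall>A\<in>alg B \<inter> carrier GL. \<exists>k x. A = mat x ** mpow g k"
    unfolding K using g by blast
qed (use q3 in auto)

text \<open>These roots of unity are the scalars of determinant 1; their number is the
  \<open>d\<close> for \<open>SL\<close>.\<close>

lemma card_root_of_unity: "card {x::'a::{field,finite}. x * x = 1} = 1 \<and> (1::'a) + 1 = 0 \<or>
  card {x::'a. x * x = 1} = 2 \<and> odd CARD('a)"
proof -
  have S: "{x::'a. x * x = 1} = {1, - 1}" by (auto simp: square_eq_1_iff)
  show ?thesis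
  proof (cases "(1::'a) + 1 = 0")
    case True
    then have "- 1 = (1::'a)" by (metis add_eq_0_iff)
    then have "{x::'a. x * x = 1} = {1}" using S by simp
    then have "card {x::'a. x * x = 1} = 1" by simp
    then show ?thesis using True by blast
  next
    case False
    then have "1 \<noteq> (- 1 :: 'a)" by (metis add.right_inverse)
    then have "card {x::'a. x * x = 1} = 2" unfolding S by simp
    then show ?thesis using False even_char2 by blast
  qed
qed

lemma SL_quotient:
  assumes q7: "CARD('a::{field,finite}) \<ge> 7" and d: "d = card {x::'a. x * x = 1}"
    and dt: "d * t + 1 = CARD('a)" and dc: "d * c = CARD('a) + 1"
  shows "matrix_quotient (SL :: ('a^2^2) monoid) t c d"
proof
  fix v w :: "'a^2" assume vw: "cr v w \<noteq> 0"
  let ?S = "{A \<in> carrier SL. cr v (A *v v) = 0 \<and> cr w (A *v w) = 0}"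
  have S: "?S = (\<lambda>x. diag v w x (1 / x)) ` (UNIV - {0})"
  proof
    show "?S \<subseteq> (\<lambda>x. diag v w x (1 / x)) ` (UNIV - {0})"
    proof
      fix A assume "A \<in> ?S"
      then obtain x y where A: "A = diag v w x y" "x * y = 1"
        by (auto simp: fixes_two_iff[OF vw] carrier_SL det_diag[OF vw])
      then have "x \<noteq> 0" by auto
      moreover have "y = 1 / x" using A(2) calculation by (simp add: eq_divide_eq mult.commute)
      ultimately show "A \<in> (\<lambda>x. diag v w x (1 / x)) ` (UNIV - {0})" using A by blast
    qed
    show "(\<lambda>x. diag v w x (1 / x)) ` (UNIV - {0}) \<subseteq> ?S"
      by (auto simp: fixes_two_iff[OF vw] carrier_SL det_diag[OF vw])
  qed
  have "inj_on (\<lambda>x. diag v w x (1 / x)) (UNIV - {0})"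
    using diag_inj[OF vw] by (auto simp: inj_on_def)
  then have "card ?S = CARD('a) - 1" unfolding S by (simp add: card_image card_Diff_singleton)
  then show "card ?S = t * card (scal (SL :: ('a^2^2) monoid))"
    unfolding card_scal_SL d[symmetric] using dt by (simp add: mult.commute)
  obtain g :: 'a where g: "g \<noteq> 0" "\<And>x. x \<noteq> 0 \<Longrightarrow> \<exists>k. x = g ^ k" using field_generator by metis
  show "\<exists>g\<in>?S. \<forall>A\<in>?S. \<exists>k x. A = mat x ** mpow g k"
  proof (intro bexI[of _ "diag v w g (1 / g)"] ballI)
    show "diag v w g (1 / g) \<in> ?S" unfolding S using g by auto
    fix A assume "A \<in> ?S"
    then obtain x where A: "A = diag v w x (1 / x)" "x \<noteq> 0" unfolding S by auto
    then obtain k where k: "x = g ^ k" using g(2) by blast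
    have "A = mat 1 ** mpow (diag v w g (1 / g)) k"
      by (simp add: A k mpow_diag[OF vw] power_divide)
    then show "\<exists>k x. A = mat x ** mpow (diag v w g (1 / g)) k" by blast
  qed
next
  fix B :: "'a^2^2" assume B: "anis B"
  have K: "alg B \<inter> carrier SL = {A \<in> alg B. det A = 1}" by (auto simp: carrier_SL)
  show "card (alg B \<inter> carrier SL) = c * card (scal (SL :: ('a^2^2) monoid))"
    unfolding K card_norm_one[OF B] card_scal_SL d[symmetric] using dc by (simp add: mult.commute)
  obtain g where g: "g \<in> alg B" "g \<noteq> 0" "alg B - {0} = range (mpow g)" using alg_generator[OF B] by blast
  have dg: "det g \<noteq> 0" using alg_det[OF B] g by blast
  have "\<exists>m>0. det g ^ m = 1"
  proof -
    have "\<not> inj (\<lambda>k::nat. det g ^ k)" using finite_imageD[of "\<lambda>k::nat. det g ^ k" UNIV] by auto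
    then obtain i j where ij: "det g ^ i = det g ^ j" "i < j" by (metis injI linorder_less_linear)
    have "det g ^ i * det g ^ (j - i) = det g ^ j" using ij(2) by (simp add: power_add[symmetric])
    then have "det g ^ i * det g ^ (j - i) = det g ^ i * 1" using ij(1) by simp
    then show ?thesis using dg ij by (intro exI[of _ "j - i"]) simp
  qed
  then have ex: "\<exists>m. m > 0 \<and> det g ^ m = 1" by blast
  \<comment> \<open>The order of \<open>det g\<close>. The norm-one subgroup of the cyclic group
    generated by \<open>g\<close> is generated by \<open>mpow g m\<close>, by division with
    remainder in the exponent.\<close>
  define m where "m = (LEAST m. m > 0 \<and> det g ^ m = 1)"
  have m: "m > 0" "det g ^ m = 1" using LeastI_ex[OF ex] by (auto simp: m_def)
  have least: "det g ^ k \<noteq> 1" if "0 < k" "k < m" for k using not_less_Least[of k] that by (auto simp: m_def)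
  have gm: "mpow g m \<in> alg B" using g(3) by blast
  show "\<exists>g\<in>alg B \<inter> carrier SL. \<forall>A\<in>alg B \<inter> carrier SL. \<exists>k x. A = mat x ** mpow g k"
    unfolding K
  proof (intro bexI[of _ "mpow g m"] ballI)
    show "mpow g m \<in> {A \<in> alg B. det A = 1}" using gm m by (simp add: det_mpow)
    fix A assume A: "A \<in> {A \<in> alg B. det A = 1}"
    then have "A \<in> alg B - {0}" by (auto simp: det_2)
    then obtain k where k: "A = mpow g k" unfolding g(3) by blast
    have "det g ^ k = 1" using A k by (simp add: det_mpow)
    moreover have "det g ^ k = (det g ^ m) ^ (k div m) * det g ^ (k mod m)"
      by (simp add: power_mult[symmetric] power_add[symmetric])
    ultimately have "det g ^ (k mod m) = 1" using m by simp
    then have "k mod m = 0" using least[of "k mod m"] m by (cases "k mod m = 0") auto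
    then have "k = m * (k div m)" by auto
    then have "A = mat 1 ** mpow (mpow g m) (k div m)" using k mpow_mult[of g m "k div m"] by simp
    then show "\<exists>k x. A = mat x ** mpow (mpow g m) k" by blast
  qed
qed (use q7 d dt dc card_root_of_unity[where 'a = 'a] in auto)

theorem theorem2:
  fixes q :: nat
  assumes "primepow q" and "q \<ge> 3"
    and "CARD('a::{field, finite}) = q"
  shows "rho (PGL :: ('a ^ 2 ^ 2) set monoid) = enat (q ^ 2 + 1) \<and>
    (q \<ge> 7 \<longrightarrow> rho (PSL :: ('a ^ 2 ^ 2) set monoid) = enat (q ^ 2 + 1))"
proof (intro conjI impI)
  have "matrix_quotient (GL :: ('a^2^2) monoid) (CARD('a) - 1) (CARD('a) + 1) 1"
    using assms by (intro GL_quotient) simp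
  then show "rho (PGL :: ('a ^ 2 ^ 2) set monoid) = enat (q ^ 2 + 1)"
    unfolding PGL_def scal_def[symmetric]
    using matrix_quotient.rho_Gq matrix_quotient.Gq_def assms(3) by fastforce
next
  assume "q \<ge> 7"
  define d where "d = card {x::'a. x * x = 1}"
  \<comment> \<open>The parameter \<open>d\<close> is 1 in characteristic 2 and 2 otherwise; in the
    latter case \<open>q\<close> is odd, so \<open>d\<close> divides both \<open>q - 1\<close> and
    \<open>q + 1\<close>.\<close>
  have "\<exists>t c. d * t + 1 = CARD('a) \<and> d * c = CARD('a) + 1"
    using card_root_of_unity[where 'a = 'a]
  proof
    assume "card {x::'a. x * x = 1} = 1 \<and> (1::'a) + 1 = 0"
    then show ?thesis using assms by (intro exI[of _ "q - 1"] exI[of _ "q + 1"]) (simp add: d_def)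
  next
    assume *: "card {x::'a. x * x = 1} = 2 \<and> odd CARD('a)"
    then obtain k where "CARD('a) = 2 * k + 1" by (auto elim: oddE)
    then show ?thesis using * by (intro exI[of _ k] exI[of _ "k + 1"]) (simp add: d_def)
  qed
  then obtain t c where "d * t + 1 = CARD('a)" "d * c = CARD('a) + 1" by blast
  then have "matrix_quotient (SL :: ('a^2^2) monoid) t c d"
    using \<open>q \<ge> 7\<close> assms d_def by (intro SL_quotient) auto
  then show "rho (PSL :: ('a ^ 2 ^ 2) set monoid) = enat (q ^ 2 + 1)"
    unfolding PSL_def scal_def[symmetric]
    using matrix_quotient.rho_Gq matrix_quotient.Gq_def assms(3) by fastforce
qed

end
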